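(* Let $E$ be a field of characteristic $0$, $\mathcal{C}$ a neutral Tannakian category over $E$, and $\mathcal{D}$ a Tannakian subcategory of $\mathcal{C}$ containing all $1$-dimensional objects of $\mathcal{C}$. Let $\overline{\mathcal{D}}$ and its basic objects be as defined in the context. Let $V$ be an object of $\mathcal{C}$ and $n=\dim_EV$. (i) The object $V$ is a basic object of $\overline{\mathcal{D}}$ if and only if there exists a tuple $\underline u$ with $\mathrm{length}(\underline u)<n$ such that $\mathbf{S}^{\underline u}(V)\in\mathcal{D}$. (ii) If a tuple $\underline u$ as in (i) exists, then $\mathbf{S}^{\underline v}(V)\in\mathcal{D}$ for every tuple $\underline v$ such that $\gcd(\ell(\underline u),n)\mid\ell(\underline v)$.
   Context: Categories are essentially small. A Tannakian subcategory of $\mathcal{C}$ is a strictly full subcategory closed under subquotients, direct sums, tensor products and duals. Dimensions are computed via a fixed fiber functor. $\overline{\mathcal{D}}$ is the full subcategory of $\mathcal{C}$ whose objects are the $V$ isomorphic to a finite direct sum $\bigoplus_iV_i$ such that, for every $i$, there exists an object $W_i$ of $\mathcal{C}$ with $V_i\otimes W_i\in\mathcal{D}$. A basic object of $\overline{\mathcal{D}}$ is an object $V$ of $\overline{\mathcal{D}}$ for which there exists an object $W$ of $\mathcal{C}$ with $V\otimes W\in\mathcal{D}$. Tuples are of finite length with positive integer entries (indexing Young diagrams); $\mathrm{length}(\underline u)$ is the number of entries and $\ell(\underline u)$ the sum of the entries of $\underline u$. Let $V_{\underline u}$ be the irreducible $E$-representation of the symmetric group $\mathcal{S}_{\ell(\underline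 u)}$ attached to $\underline u$. The Schur functor is $\mathbf{S}^{\underline u}(V)=\mathcal{H}om(V_{\underline u},V^{\otimes\ell(\underline u)})^{\mathcal{S}_{\ell(\underline u)}}$, where $\mathcal{S}_{\ell(\underline u)}$ acts on $V^{\otimes\ell(\underline u)}$ by permuting factors; for an $E$-vector space $V$, this is the irreducible representation of $\mathrm{GL}(V)$ of highest weight $\underline u$ (zero if $\mathrm{length}(\underline u)>\dim V$).
   Formalization: In the definition of basic objects W (and each W_i) is taken nonzero, since W = 0 would make every V basic; the tuple u is nonempty, since S^()(V) = 1 always lies in D; and (i) is stated for n ≥ 2, since for n ≤ 1 V is basic but no nonempty u has length < n. *)

theory Defs
  imports Complex_Main "HOL-Combinatorics.Permutations"
begin

section \<open>Categories\<close>

text \<open>Objects and arrows form sets inside types. This covers every essentially small category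
  up to equivalence.\<close>

record ('o, 'a) category =
  Ob :: "'o set"
  Arr :: "'a set"
  Src :: "'a \<Rightarrow> 'o"
  Tgt :: "'a \<Rightarrow> 'o"
  Ident :: "'o \<Rightarrow> 'a"
  Comp :: "'a \<Rightarrow> 'a \<Rightarrow> 'a"  (infixr "\<cdot>\<index>" 70)

definition homs :: "('o, 'a, 'm) category_scheme \<Rightarrow> 'o \<Rightarrow> 'o \<Rightarrow> 'a set" where
  "homs C A B = {f \<in> Arr C. Src C f = A \<and> Tgt C f = B}"

locale category =
  fixes C :: "('o, 'a, 'm) category_scheme" (structure)
  assumes Src_Ob: "f \<in> Arr C \<Longrightarrow> Src C f \<in> Ob C"
    and Tgt_Ob: "f \<in> Arr C \<Longrightarrow> Tgt C f \<in> Ob C"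
    and Ident_hom: "A \<in> Ob C \<Longrightarrow> Ident C A \<in> homs C A A"
    and Comp_hom: "f \<in> homs C A B \<Longrightarrow> g \<in> homs C B B' \<Longrightarrow> g \<cdot> f \<in> homs C A B'"
    and Comp_Ident_right: "f \<in> homs C A B \<Longrightarrow> f \<cdot> Ident C A = f"
    and Comp_Ident_left: "f \<in> homs C A B \<Longrightarrow> Ident C B \<cdot> f = f"
    and Comp_assoc: "f \<in> homs C A\<^sub>1 A\<^sub>2 \<Longrightarrow> g \<in> homs C A\<^sub>2 A\<^sub>3 \<Longrightarrow> h \<in> homs C A\<^sub>3 A\<^sub>4 \<Longrightarrow>
      (h \<cdot> g) \<cdot> f = h \<cdot> (g \<cdot> f)"

definition inverse_arrows :: "('o, 'a, 'm) category_scheme \<Rightarrow> 'a \<Rightarrow> 'a \<Rightarrow> bool" where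
  "inverse_arrows C f g \<longleftrightarrow> f \<in> Arr C \<and> g \<in> homs C (Tgt C f) (Src C f) \<and>
    g \<cdot>\<^bsub>C\<^esub> f = Ident C (Src C f) \<and> f \<cdot>\<^bsub>C\<^esub> g = Ident C (Tgt C f)"

definition is_iso :: "('o, 'a, 'm) category_scheme \<Rightarrow> 'a \<Rightarrow> bool" where
  "is_iso C f \<longleftrightarrow> (\<exists>g. inverse_arrows C f g)"

definition inv_arr :: "('o, 'a, 'm) category_scheme \<Rightarrow> 'a \<Rightarrow> 'a" where
  "inv_arr C f = (THE g. inverse_arrows C f g)"

definition isomorphic :: "('o, 'a, 'm) category_scheme \<Rightarrow> 'o \<Rightarrow> 'o \<Rightarrow> bool" where
  "isomorphic C A B \<longleftrightarrow> (\<exists>f \<in> homs C A B. is_iso C f)"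

definition is_mono :: "('o, 'a, 'm) category_scheme \<Rightarrow> 'a \<Rightarrow> bool" where
  "is_mono C f \<longleftrightarrow> f \<in> Arr C \<and>
    (\<forall>T. \<forall>g \<in> homs C T (Src C f). \<forall>h \<in> homs C T (Src C f). f \<cdot>\<^bsub>C\<^esub> g = f \<cdot>\<^bsub>C\<^esub> h \<longrightarrow> g = h)"

definition is_epi :: "('o, 'a, 'm) category_scheme \<Rightarrow> 'a \<Rightarrow> bool" where
  "is_epi C f \<longleftrightarrow> f \<in> Arr C \<and>
    (\<forall>T. \<forall>g \<in> homs C (Tgt C f) T. \<forall>h \<in> homs C (Tgt C f) T. g \<cdot>\<^bsub>C\<^esub> f = h \<cdot>\<^bsub>C\<^esub> f \<longrightarrow> g = h)"

definition is_zero_object :: "('o, 'a, 'm) category_scheme \<Rightarrow> 'o \<Rightarrow> bool" where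
  "is_zero_object C Z \<longleftrightarrow> Z \<in> Ob C \<and>
    (\<forall>A \<in> Ob C. (\<exists>!f. f \<in> homs C A Z) \<and> (\<exists>!f. f \<in> homs C Z A))"

definition is_subquotient :: "('o, 'a, 'm) category_scheme \<Rightarrow> 'o \<Rightarrow> 'o \<Rightarrow> bool" where
  "is_subquotient C Z X \<longleftrightarrow>
    (\<exists>Y. (\<exists>i \<in> homs C Y X. is_mono C i) \<and> (\<exists>q \<in> homs C Y Z. is_epi C q))"


section \<open>Linear and abelian categories\<close>

text \<open>\<open>Zero C A B\<close> is the zero arrow from \<open>A\<close> to \<open>B\<close>; \<open>Add\<close> and \<open>Scale\<close> are meaningful for
  parallel arrows only.\<close>

record ('o, 'a, 'e) linear_category = "('o, 'a) category" +
  Zero :: "'o \<Rightarrow> 'o \<Rightarrow> 'a"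
  Add :: "'a \<Rightarrow> 'a \<Rightarrow> 'a"
  Scale :: "'e \<Rightarrow> 'a \<Rightarrow> 'a"

locale linear_category = category C
  for C :: "('o, 'a, 'e::field, 'm) linear_category_scheme" (structure) +
  assumes Zero_hom: "A \<in> Ob C \<Longrightarrow> B \<in> Ob C \<Longrightarrow> Zero C A B \<in> homs C A B"
    and Add_hom: "f \<in> homs C A B \<Longrightarrow> g \<in> homs C A B \<Longrightarrow> Add C f g \<in> homs C A B"
    and Scale_hom: "f \<in> homs C A B \<Longrightarrow> Scale C c f \<in> homs C A B"
    and Add_assoc: "f \<in> homs C A B \<Longrightarrow> g \<in> homs C A B \<Longrightarrow> h \<in> homs C A B \<Longrightarrow>
      Add C (Add C f g) h = Add C f (Add C g h)"
    and Add_commute: "f \<in> homs C A B \<Longrightarrow> g \<in> homs C A B \<Longrightarrow> Add C f g = Add C g f"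
    and Add_Zero: "f \<in> homs C A B \<Longrightarrow> Add C (Zero C A B) f = f"
    and Add_inverse: "f \<in> homs C A B \<Longrightarrow> Add C (Scale C (- 1) f) f = Zero C A B"
    and Scale_Add: "f \<in> homs C A B \<Longrightarrow> g \<in> homs C A B \<Longrightarrow>
      Scale C c (Add C f g) = Add C (Scale C c f) (Scale C c g)"
    and Scale_add: "f \<in> homs C A B \<Longrightarrow> Scale C (c + d) f = Add C (Scale C c f) (Scale C d f)"
    and Scale_Scale: "f \<in> homs C A B \<Longrightarrow> Scale C c (Scale C d f) = Scale C (c * d) f"
    and Scale_one: "f \<in> homs C A B \<Longrightarrow> Scale C 1 f = f"
    and Comp_Add_left: "f \<in> homs C A B \<Longrightarrow> g \<in> homs C B B' \<Longrightarrow> h \<in> homs C B B' \<Longrightarrow>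
      Add C g h \<cdot> f = Add C (g \<cdot> f) (h \<cdot> f)"
    and Comp_Add_right: "f \<in> homs C A B \<Longrightarrow> g \<in> homs C A B \<Longrightarrow> h \<in> homs C B B' \<Longrightarrow>
      h \<cdot> Add C f g = Add C (h \<cdot> f) (h \<cdot> g)"
    and Comp_Scale_left: "f \<in> homs C A B \<Longrightarrow> g \<in> homs C B B' \<Longrightarrow>
      Scale C c g \<cdot> f = Scale C c (g \<cdot> f)"
    and Comp_Scale_right: "f \<in> homs C A B \<Longrightarrow> g \<in> homs C B B' \<Longrightarrow>
      g \<cdot> Scale C c f = Scale C c (g \<cdot> f)"

definition is_kernel :: "('o, 'a, 'e, 'm) linear_category_scheme \<Rightarrow> 'a \<Rightarrow> 'a \<Rightarrow> bool" where
  "is_kernel C f k \<longleftrightarrow> f \<in> Arr C \<and> k \<in> Arr C \<and> Tgt C k = Src C f \<and>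
    f \<cdot>\<^bsub>C\<^esub> k = Zero C (Src C k) (Tgt C f) \<and>
    (\<forall>T. \<forall>h \<in> homs C T (Src C f). f \<cdot>\<^bsub>C\<^esub> h = Zero C T (Tgt C f) \<longrightarrow>
      (\<exists>!h'. h' \<in> homs C T (Src C k) \<and> k \<cdot>\<^bsub>C\<^esub> h' = h))"

definition is_cokernel :: "('o, 'a, 'e, 'm) linear_category_scheme \<Rightarrow> 'a \<Rightarrow> 'a \<Rightarrow> bool" where
  "is_cokernel C f q \<longleftrightarrow> f \<in> Arr C \<and> q \<in> Arr C \<and> Src C q = Tgt C f \<and>
    q \<cdot>\<^bsub>C\<^esub> f = Zero C (Src C f) (Tgt C q) \<and>
    (\<forall>T. \<forall>h \<in> homs C (Tgt C f) T. h \<cdot>\<^bsub>C\<^esub> f = Zero C (Src C f) T \<longrightarrow>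
      (\<exists>!h'. h' \<in> homs C (Tgt C q) T \<and> h' \<cdot>\<^bsub>C\<^esub> q = h))"

text \<open>Exactness of \<open>0 \<rightarrow> \<cdot> \<rightarrow> \<cdot> \<rightarrow> \<cdot> \<rightarrow> 0\<close> with middle arrows \<open>f\<close>, \<open>g\<close>.\<close>

definition short_exact :: "('o, 'a, 'e, 'm) linear_category_scheme \<Rightarrow> 'a \<Rightarrow> 'a \<Rightarrow> bool" where
  "short_exact C f g \<longleftrightarrow> is_kernel C g f \<and> is_cokernel C f g"

definition is_biproduct ::
  "('o, 'a, 'e, 'm) linear_category_scheme \<Rightarrow> 'o \<Rightarrow> 'o \<Rightarrow> 'o \<Rightarrow> bool" where
  "is_biproduct C A B S \<longleftrightarrow>
    (\<exists>i\<^sub>1 \<in> homs C A S. \<exists>i\<^sub>2 \<in> homs C B S. \<exists>p\<^sub>1 \<in> homs C S A. \<exists>p\<^sub>2 \<in> homs C S B.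
      p\<^sub>1 \<cdot>\<^bsub>C\<^esub> i\<^sub>1 = Ident C A \<and> p\<^sub>2 \<cdot>\<^bsub>C\<^esub> i\<^sub>2 = Ident C B \<and>
      p\<^sub>1 \<cdot>\<^bsub>C\<^esub> i\<^sub>2 = Zero C B A \<and> p\<^sub>2 \<cdot>\<^bsub>C\<^esub> i\<^sub>1 = Zero C A B \<and>
      Add C (i\<^sub>1 \<cdot>\<^bsub>C\<^esub> p\<^sub>1) (i\<^sub>2 \<cdot>\<^bsub>C\<^esub> p\<^sub>2) = Ident C S)"

inductive is_direct_sum :: "('o, 'a, 'e, 'm) linear_category_scheme \<Rightarrow> 'o list \<Rightarrow> 'o \<Rightarrow> bool"
  for C where
  Nil: "is_zero_object C Z \<Longrightarrow> is_direct_sum C [] Z"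
| Cons: "is_direct_sum C Vs T \<Longrightarrow> is_biproduct C V T S \<Longrightarrow> is_direct_sum C (V # Vs) S"

locale abelian_category = linear_category +
  assumes zero_object: "\<exists>Z. is_zero_object C Z"
    and biproducts: "A \<in> Ob C \<Longrightarrow> B \<in> Ob C \<Longrightarrow> \<exists>S. is_biproduct C A B S"
    and kernels: "f \<in> Arr C \<Longrightarrow> \<exists>k. is_kernel C f k"
    and cokernels: "f \<in> Arr C \<Longrightarrow> \<exists>q. is_cokernel C f q"
    and mono_normal: "is_mono C f \<Longrightarrow> \<exists>g. is_kernel C g f"
    and epi_normal: "is_epi C f \<Longrightarrow> \<exists>g. is_cokernel C g f"


section \<open>Rigid tensor categories\<close>

record ('o, 'a, 'e) tensor_category = "('o, 'a, 'e) linear_category" +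
  TOb :: "'o \<Rightarrow> 'o \<Rightarrow> 'o"  (infixr "\<otimes>\<^sub>o\<index>" 75)
  TArr :: "'a \<Rightarrow> 'a \<Rightarrow> 'a"  (infixr "\<otimes>\<^sub>a\<index>" 75)
  Unit :: "'o"
  Assoc :: "'o \<Rightarrow> 'o \<Rightarrow> 'o \<Rightarrow> 'a"
  LUnit :: "'o \<Rightarrow> 'a"
  RUnit :: "'o \<Rightarrow> 'a"
  Braid :: "'o \<Rightarrow> 'o \<Rightarrow> 'a"

text \<open>A symmetric monoidal structure with \<open>E\<close>-bilinear tensor product, whose symmetry is
  \<open>Braid\<close>.\<close>

locale tensor_category = linear_category C
  for C :: "('o, 'a, 'e::field, 'm) tensor_category_scheme" (structure) +
  assumes TOb: "A \<in> Ob C \<Longrightarrow> B \<in> Ob C \<Longrightarrow> A \<otimes>\<^sub>o B \<in> Ob C"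
    and Unit: "Unit C \<in> Ob C"
    and TArr_hom: "f \<in> homs C A B \<Longrightarrow> g \<in> homs C A' B' \<Longrightarrow>
      f \<otimes>\<^sub>a g \<in> homs C (A \<otimes>\<^sub>o A') (B \<otimes>\<^sub>o B')"
    and TArr_Ident: "A \<in> Ob C \<Longrightarrow> B \<in> Ob C \<Longrightarrow> Ident C A \<otimes>\<^sub>a Ident C B = Ident C (A \<otimes>\<^sub>o B)"
    and TArr_Comp: "f \<in> homs C A\<^sub>1 A\<^sub>2 \<Longrightarrow> g \<in> homs C A\<^sub>2 A\<^sub>3 \<Longrightarrow>
      f' \<in> homs C B\<^sub>1 B\<^sub>2 \<Longrightarrow> g' \<in> homs C B\<^sub>2 B\<^sub>3 \<Longrightarrow>
      (g \<cdot> f) \<otimes>\<^sub>a (g' \<cdot> f') = (g \<otimes>\<^sub>a g') \<cdot> (f \<otimes>\<^sub>a f')"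
    and TArr_Add_left: "f \<in> homs C A B \<Longrightarrow> g \<in> homs C A B \<Longrightarrow> h \<in> homs C A' B' \<Longrightarrow>
      Add C f g \<otimes>\<^sub>a h = Add C (f \<otimes>\<^sub>a h) (g \<otimes>\<^sub>a h)"
    and TArr_Add_right: "f \<in> homs C A B \<Longrightarrow> g \<in> homs C A B \<Longrightarrow> h \<in> homs C A' B' \<Longrightarrow>
      h \<otimes>\<^sub>a Add C f g = Add C (h \<otimes>\<^sub>a f) (h \<otimes>\<^sub>a g)"
    and TArr_Scale_left: "f \<in> homs C A B \<Longrightarrow> g \<in> homs C A' B' \<Longrightarrow>
      Scale C c f \<otimes>\<^sub>a g = Scale C c (f \<otimes>\<^sub>a g)"
    and TArr_Scale_right: "f \<in> homs C A B \<Longrightarrow> g \<in> homs C A' B' \<Longrightarrow>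
      f \<otimes>\<^sub>a Scale C c g = Scale C c (f \<otimes>\<^sub>a g)"
    and Assoc_hom: "A\<^sub>1 \<in> Ob C \<Longrightarrow> A\<^sub>2 \<in> Ob C \<Longrightarrow> A\<^sub>3 \<in> Ob C \<Longrightarrow>
      Assoc C A\<^sub>1 A\<^sub>2 A\<^sub>3 \<in> homs C ((A\<^sub>1 \<otimes>\<^sub>o A\<^sub>2) \<otimes>\<^sub>o A\<^sub>3) (A\<^sub>1 \<otimes>\<^sub>o (A\<^sub>2 \<otimes>\<^sub>o A\<^sub>3))"
    and Assoc_iso: "A\<^sub>1 \<in> Ob C \<Longrightarrow> A\<^sub>2 \<in> Ob C \<Longrightarrow> A\<^sub>3 \<in> Ob C \<Longrightarrow> is_iso C (Assoc C A\<^sub>1 A\<^sub>2 A\<^sub>3)"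
    and Assoc_natural: "f\<^sub>1 \<in> homs C A\<^sub>1 B\<^sub>1 \<Longrightarrow> f\<^sub>2 \<in> homs C A\<^sub>2 B\<^sub>2 \<Longrightarrow> f\<^sub>3 \<in> homs C A\<^sub>3 B\<^sub>3 \<Longrightarrow>
      Assoc C B\<^sub>1 B\<^sub>2 B\<^sub>3 \<cdot> ((f\<^sub>1 \<otimes>\<^sub>a f\<^sub>2) \<otimes>\<^sub>a f\<^sub>3) = (f\<^sub>1 \<otimes>\<^sub>a (f\<^sub>2 \<otimes>\<^sub>a f\<^sub>3)) \<cdot> Assoc C A\<^sub>1 A\<^sub>2 A\<^sub>3"
    and LUnit_hom: "A \<in> Ob C \<Longrightarrow> LUnit C A \<in> homs C (Unit C \<otimes>\<^sub>o A) A"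
    and LUnit_iso: "A \<in> Ob C \<Longrightarrow> is_iso C (LUnit C A)"
    and LUnit_natural: "f \<in> homs C A B \<Longrightarrow>
      LUnit C B \<cdot> (Ident C (Unit C) \<otimes>\<^sub>a f) = f \<cdot> LUnit C A"
    and RUnit_hom: "A \<in> Ob C \<Longrightarrow> RUnit C A \<in> homs C (A \<otimes>\<^sub>o Unit C) A"
    and RUnit_iso: "A \<in> Ob C \<Longrightarrow> is_iso C (RUnit C A)"
    and RUnit_natural: "f \<in> homs C A B \<Longrightarrow>
      RUnit C B \<cdot> (f \<otimes>\<^sub>a Ident C (Unit C)) = f \<cdot> RUnit C A"
    and Braid_hom: "A \<in> Ob C \<Longrightarrow> B \<in> Ob C \<Longrightarrow> Braid C A B \<in> homs C (A \<otimes>\<^sub>o B) (B \<otimes>\<^sub>o A)"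
    and Braid_natural: "f \<in> homs C A A' \<Longrightarrow> g \<in> homs C B B' \<Longrightarrow>
      Braid C A' B' \<cdot> (f \<otimes>\<^sub>a g) = (g \<otimes>\<^sub>a f) \<cdot> Braid C A B"
    and Braid_symmetric: "A \<in> Ob C \<Longrightarrow> B \<in> Ob C \<Longrightarrow>
      Braid C B A \<cdot> Braid C A B = Ident C (A \<otimes>\<^sub>o B)"
    and triangle: "A \<in> Ob C \<Longrightarrow> B \<in> Ob C \<Longrightarrow>
      (Ident C A \<otimes>\<^sub>a LUnit C B) \<cdot> Assoc C A (Unit C) B = RUnit C A \<otimes>\<^sub>a Ident C B"
    and pentagon: "A\<^sub>1 \<in> Ob C \<Longrightarrow> A\<^sub>2 \<in> Ob C \<Longrightarrow> A\<^sub>3 \<in> Ob C \<Longrightarrow> A\<^sub>4 \<in> Ob C \<Longrightarrow>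
      Assoc C A\<^sub>1 A\<^sub>2 (A\<^sub>3 \<otimes>\<^sub>o A\<^sub>4) \<cdot> Assoc C (A\<^sub>1 \<otimes>\<^sub>o A\<^sub>2) A\<^sub>3 A\<^sub>4 =
      (Ident C A\<^sub>1 \<otimes>\<^sub>a Assoc C A\<^sub>2 A\<^sub>3 A\<^sub>4) \<cdot> Assoc C A\<^sub>1 (A\<^sub>2 \<otimes>\<^sub>o A\<^sub>3) A\<^sub>4 \<cdot>
        (Assoc C A\<^sub>1 A\<^sub>2 A\<^sub>3 \<otimes>\<^sub>a Ident C A\<^sub>4)"
    and hexagon: "A\<^sub>1 \<in> Ob C \<Longrightarrow> A\<^sub>2 \<in> Ob C \<Longrightarrow> A\<^sub>3 \<in> Ob C \<Longrightarrow>
      Assoc C A\<^sub>2 A\<^sub>3 A\<^sub>1 \<cdot> Braid C A\<^sub>1 (A\<^sub>2 \<otimes>\<^sub>o A\<^sub>3) \<cdot> Assoc C A\<^sub>1 A\<^sub>2 A\<^sub>3 =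
      (Ident C A\<^sub>2 \<otimes>\<^sub>a Braid C A\<^sub>1 A\<^sub>3) \<cdot> Assoc C A\<^sub>2 A\<^sub>1 A\<^sub>3 \<cdot> (Braid C A\<^sub>1 A\<^sub>2 \<otimes>\<^sub>a Ident C A\<^sub>3)"

text \<open>\<open>A'\<close> is a dual of \<open>A\<close>: there are evaluation and coevaluation arrows satisfying the
  triangle identities.\<close>

definition is_dual :: "('o, 'a, 'e, 'm) tensor_category_scheme \<Rightarrow> 'o \<Rightarrow> 'o \<Rightarrow> bool" where
  "is_dual C A A' \<longleftrightarrow> A \<in> Ob C \<and> A' \<in> Ob C \<and>
    (\<exists>ev \<in> homs C (A' \<otimes>\<^sub>o\<^bsub>C\<^esub> A) (Unit C). \<exists>coev \<in> homs C (Unit C) (A \<otimes>\<^sub>o\<^bsub>C\<^esub> A').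
      RUnit C A \<cdot>\<^bsub>C\<^esub> (Ident C A \<otimes>\<^sub>a\<^bsub>C\<^esub> ev) \<cdot>\<^bsub>C\<^esub> Assoc C A A' A \<cdot>\<^bsub>C\<^esub> (coev \<otimes>\<^sub>a\<^bsub>C\<^esub> Ident C A)
        = LUnit C A \<and>
      LUnit C A' \<cdot>\<^bsub>C\<^esub> (ev \<otimes>\<^sub>a\<^bsub>C\<^esub> Ident C A') \<cdot>\<^bsub>C\<^esub> inv_arr C (Assoc C A' A A')
          \<cdot>\<^bsub>C\<^esub> (Ident C A' \<otimes>\<^sub>a\<^bsub>C\<^esub> coev)
        = RUnit C A')"

locale rigid_abelian_tensor_category = abelian_category C + tensor_category C
  for C :: "('o, 'a, 'e::field, 'm) tensor_category_scheme" (structure) +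
  assumes duals: "A \<in> Ob C \<Longrightarrow> \<exists>A'. is_dual C A A'"
    and End_Unit: "bij_betw (\<lambda>c. Scale C c (Ident C (Unit C))) UNIV (homs C (Unit C) (Unit C))"


section \<open>Fibre functors and neutral Tannakian categories\<close>

definition linear_on ::
  "('e \<Rightarrow> 'v \<Rightarrow> 'v) \<Rightarrow> 'v::ab_group_add set \<Rightarrow> 'v set \<Rightarrow> ('v \<Rightarrow> 'v) \<Rightarrow> bool" where
  "linear_on s U W f \<longleftrightarrow> f ` U \<subseteq> W \<and>
    (\<forall>x \<in> U. \<forall>y \<in> U. f (x + y) = f x + f y) \<and> (\<forall>c. \<forall>x \<in> U. f (s c x) = s c (f x))"

definition is_basis ::
  "('e::field \<Rightarrow> 'v \<Rightarrow> 'v) \<Rightarrow> 'v::ab_group_add set \<Rightarrow> 'v set \<Rightarrow> bool" where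
  "is_basis s U B \<longleftrightarrow> \<not> module.dependent s B \<and> module.span s B = U"

text \<open>A bilinear map \<open>\<mu>\<close> from \<open>U \<times> U'\<close> to \<open>W\<close> makes \<open>W\<close> a tensor product of \<open>U\<close> and \<open>U'\<close>,
  i.e. the induced linear map from the tensor product to \<open>W\<close> is an isomorphism, iff it maps pairs
  of basis vectors bijectively onto a basis of \<open>W\<close>.\<close>

definition is_tensor_product ::
  "('e::field \<Rightarrow> 'v \<Rightarrow> 'v) \<Rightarrow> 'v::ab_group_add set \<Rightarrow> 'v set \<Rightarrow> 'v set \<Rightarrow> ('v \<Rightarrow> 'v \<Rightarrow> 'v) \<Rightarrow> bool"
  where
  "is_tensor_product s U U' W \<mu> \<longleftrightarrow>
    (\<forall>x \<in> U. linear_on s U' W (\<mu> x)) \<and> (\<forall>y \<in> U'. linear_on s U W (\<lambda>x. \<mu> x y)) \<and>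
    (\<forall>B B'. is_basis s U B \<and> is_basis s U' B' \<longrightarrow>
      inj_on (\<lambda>(b, b'). \<mu> b b') (B \<times> B') \<and> is_basis s W ((\<lambda>(b, b'). \<mu> b b') ` (B \<times> B')))"

text \<open>The fibres are finite-dimensional subspaces of one ambient \<open>E\<close>-vector space, which is no
  restriction: any family of vector spaces embeds into its direct sum. The tensor constraint, an
  isomorphism from the tensor product of the fibres of \<open>X\<close> and \<open>Y\<close> to the fibre of their tensor
  product, is given by the corresponding bilinear map \<open>FTensor F X Y\<close>; the isomorphism from \<open>E\<close> to
  the fibre of the unit object by the image \<open>FUnit F\<close> of \<open>1\<close>.\<close>

record ('o, 'a, 'e, 'v) fibre_functor =
  FScale :: "'e \<Rightarrow> 'v \<Rightarrow> 'v"
  FOb :: "'o \<Rightarrow> 'v set"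
  FArr :: "'a \<Rightarrow> 'v \<Rightarrow> 'v"
  FTensor :: "'o \<Rightarrow> 'o \<Rightarrow> 'v \<Rightarrow> 'v \<Rightarrow> 'v"
  FUnit :: "'v"

definition fdim :: "('o, 'a, 'e::field, 'v::ab_group_add, 'n) fibre_functor_scheme \<Rightarrow> 'o \<Rightarrow> nat"
  where "fdim F X = vector_space.dim (FScale F) (FOb F X)"

locale neutral_tannakian_category =
  rigid_abelian_tensor_category C + V: vector_space "FScale F"
  for C :: "('o, 'a, 'e::field, 'm) tensor_category_scheme" (structure)
    and F :: "('o, 'a, 'e, 'v::ab_group_add, 'n) fibre_functor_scheme" +
  assumes FOb_subspace: "A \<in> Ob C \<Longrightarrow> V.subspace (FOb F A)"
    and FOb_finite_dim: "A \<in> Ob C \<Longrightarrow> \<exists>B. finite B \<and> V.span B = FOb F A"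
    and FArr_linear: "f \<in> homs C A B \<Longrightarrow> linear_on (FScale F) (FOb F A) (FOb F B) (FArr F f)"
    and FArr_Ident: "A \<in> Ob C \<Longrightarrow> x \<in> FOb F A \<Longrightarrow> FArr F (Ident C A) x = x"
    and FArr_Comp: "f \<in> homs C A B \<Longrightarrow> g \<in> homs C B B' \<Longrightarrow> x \<in> FOb F A \<Longrightarrow>
      FArr F (g \<cdot> f) x = FArr F g (FArr F f x)"
    and FArr_Add: "f \<in> homs C A B \<Longrightarrow> g \<in> homs C A B \<Longrightarrow> x \<in> FOb F A \<Longrightarrow>
      FArr F (Add C f g) x = FArr F f x + FArr F g x"
    and FArr_Scale: "f \<in> homs C A B \<Longrightarrow> x \<in> FOb F A \<Longrightarrow>
      FArr F (Scale C c f) x = FScale F c (FArr F f x)"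
    and FArr_faithful: "f \<in> homs C A B \<Longrightarrow> g \<in> homs C A B \<Longrightarrow>
      (\<And>x. x \<in> FOb F A \<Longrightarrow> FArr F f x = FArr F g x) \<Longrightarrow> f = g"
    and FArr_exact: "short_exact C f g \<Longrightarrow>
      inj_on (FArr F f) (FOb F (Src C f)) \<and>
      FArr F f ` FOb F (Src C f) = {x \<in> FOb F (Src C g). FArr F g x = 0} \<and>
      FArr F g ` FOb F (Src C g) = FOb F (Tgt C g)"
    and FTensor: "A \<in> Ob C \<Longrightarrow> B \<in> Ob C \<Longrightarrow>
      is_tensor_product (FScale F) (FOb F A) (FOb F B) (FOb F (A \<otimes>\<^sub>o B)) (FTensor F A B)"
    and FTensor_natural: "f \<in> homs C A A' \<Longrightarrow> g \<in> homs C B B' \<Longrightarrow>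
      x \<in> FOb F A \<Longrightarrow> y \<in> FOb F B \<Longrightarrow>
      FArr F (f \<otimes>\<^sub>a g) (FTensor F A B x y) = FTensor F A' B' (FArr F f x) (FArr F g y)"
    and FTensor_Assoc: "A\<^sub>1 \<in> Ob C \<Longrightarrow> A\<^sub>2 \<in> Ob C \<Longrightarrow> A\<^sub>3 \<in> Ob C \<Longrightarrow>
      x \<in> FOb F A\<^sub>1 \<Longrightarrow> y \<in> FOb F A\<^sub>2 \<Longrightarrow> z \<in> FOb F A\<^sub>3 \<Longrightarrow>
      FArr F (Assoc C A\<^sub>1 A\<^sub>2 A\<^sub>3) (FTensor F (A\<^sub>1 \<otimes>\<^sub>o A\<^sub>2) A\<^sub>3 (FTensor F A\<^sub>1 A\<^sub>2 x y) z) =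
      FTensor F A\<^sub>1 (A\<^sub>2 \<otimes>\<^sub>o A\<^sub>3) x (FTensor F A\<^sub>2 A\<^sub>3 y z)"
    and FTensor_Braid: "A \<in> Ob C \<Longrightarrow> B \<in> Ob C \<Longrightarrow> x \<in> FOb F A \<Longrightarrow> y \<in> FOb F B \<Longrightarrow>
      FArr F (Braid C A B) (FTensor F A B x y) = FTensor F B A y x"
    and FUnit: "is_basis (FScale F) (FOb F (Unit C)) {FUnit F}"
    and FTensor_LUnit: "A \<in> Ob C \<Longrightarrow> x \<in> FOb F A \<Longrightarrow>
      FArr F (LUnit C A) (FTensor F (Unit C) A (FUnit F) x) = x"
    and FTensor_RUnit: "A \<in> Ob C \<Longrightarrow> x \<in> FOb F A \<Longrightarrow>
      FArr F (RUnit C A) (FTensor F A (Unit C) x (FUnit F)) = x"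


section \<open>Tannakian subcategories\<close>

text \<open>A full subcategory is given by its set of objects. Finite direct sums and tensor products
  include the empty ones.\<close>

definition tannakian_subcategory :: "('o, 'a, 'e, 'm) tensor_category_scheme \<Rightarrow> 'o set \<Rightarrow> bool" where
  "tannakian_subcategory C D \<longleftrightarrow> D \<subseteq> Ob C \<and>
    (\<forall>X \<in> D. \<forall>Y. isomorphic C X Y \<longrightarrow> Y \<in> D) \<and>
    (\<forall>X \<in> D. \<forall>Z. is_subquotient C Z X \<longrightarrow> Z \<in> D) \<and>
    (\<forall>Xs S. set Xs \<subseteq> D \<and> is_direct_sum C Xs S \<longrightarrow> S \<in> D) \<and>
    Unit C \<in> D \<and> (\<forall>X \<in> D. \<forall>Y \<in> D. X \<otimes>\<^sub>o\<^bsub>C\<^esub> Y \<in> D) \<and>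
    (\<forall>X \<in> D. \<forall>X'. is_dual C X X' \<longrightarrow> X' \<in> D)"

text \<open>The object \<open>W\<close> has to be nonzero: a zero object \<open>W\<close> would satisfy the condition for
  every \<open>V\<close>.\<close>

definition tensors_into :: "('o, 'a, 'e, 'm) tensor_category_scheme \<Rightarrow> 'o set \<Rightarrow> 'o \<Rightarrow> bool" where
  "tensors_into C D V \<longleftrightarrow> (\<exists>W \<in> Ob C. \<not> is_zero_object C W \<and> V \<otimes>\<^sub>o\<^bsub>C\<^esub> W \<in> D)"

definition overline_subcategory :: "('o, 'a, 'e, 'm) tensor_category_scheme \<Rightarrow> 'o set \<Rightarrow> 'o set"
  where
  "overline_subcategory C D = {V \<in> Ob C. \<exists>Vs S.
    set Vs \<subseteq> Ob C \<and> (\<forall>V' \<in> set Vs. tensors_into C D V') \<and> is_direct_sum C Vs S \<and>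
    isomorphic C V S}"

definition basic_object :: "('o, 'a, 'e, 'm) tensor_category_scheme \<Rightarrow> 'o set \<Rightarrow> 'o \<Rightarrow> bool" where
  "basic_object C D V \<longleftrightarrow> V \<in> overline_subcategory C D \<and> tensors_into C D V"


section \<open>Irreducible representations of symmetric groups\<close>

text \<open>The symmetric group on \<open>k\<close> letters consists of the permutations of \<open>{..<k}\<close>.
  The number of boxes of the Young diagram \<open>u\<close> is \<open>sum_list u\<close>.\<close>

definition young_tuple :: "nat list \<Rightarrow> bool" where
  "young_tuple u \<longleftrightarrow> sorted_wrt (\<ge>) u \<and> (\<forall>m \<in> set u. 0 < m)"

text \<open>Rows and columns of the tableau of shape \<open>u\<close> whose boxes are numbered row by row.\<close>

definition tableau_row :: "nat list \<Rightarrow> nat \<Rightarrow> nat set" where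
  "tableau_row u i = {sum_list (take i u) + j |j. j < u ! i}"

definition tableau_column :: "nat list \<Rightarrow> nat \<Rightarrow> nat set" where
  "tableau_column u j = {sum_list (take i u) + j |i. i < length u \<and> j < u ! i}"

definition row_group :: "nat list \<Rightarrow> (nat \<Rightarrow> nat) set" where
  "row_group u = {\<sigma>. \<sigma> permutes {..<sum_list u} \<and>
    (\<forall>i < length u. \<sigma> ` tableau_row u i = tableau_row u i)}"

definition column_group :: "nat list \<Rightarrow> (nat \<Rightarrow> nat) set" where
  "column_group u = {\<sigma>. \<sigma> permutes {..<sum_list u} \<and>
    (\<forall>j. \<sigma> ` tableau_column u j = tableau_column u j)}"

text \<open>Elements of the group algebra are functions supported on the symmetric group.\<close>

definition group_algebra :: "nat \<Rightarrow> ((nat \<Rightarrow> nat) \<Rightarrow> 'e::field) set" where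
  "group_algebra k = {x. \<forall>\<sigma>. \<not> \<sigma> permutes {..<k} \<longrightarrow> x \<sigma> = 0}"

definition group_algebra_mult ::
  "nat \<Rightarrow> ((nat \<Rightarrow> nat) \<Rightarrow> 'e::field) \<Rightarrow> ((nat \<Rightarrow> nat) \<Rightarrow> 'e) \<Rightarrow> (nat \<Rightarrow> nat) \<Rightarrow> 'e" where
  "group_algebra_mult k x y = (\<lambda>\<pi>. if \<pi> permutes {..<k}
    then (\<Sum>\<sigma> | \<sigma> permutes {..<k}. x \<sigma> * y (inv \<sigma> \<circ> \<pi>)) else 0)"

definition young_symmetrizer :: "nat list \<Rightarrow> (nat \<Rightarrow> nat) \<Rightarrow> 'e::field" where
  "young_symmetrizer u = group_algebra_mult (sum_list u)
    (\<lambda>\<sigma>. if \<sigma> \<in> row_group u then 1 else 0)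
    (\<lambda>\<sigma>. if \<sigma> \<in> column_group u then of_int (sign \<sigma>) else 0)"

text \<open>The left ideal generated by the Young symmetrizer: the trivial representation if \<open>u\<close> has a
  single row, the sign representation if it has a single column.\<close>

definition specht_module :: "nat list \<Rightarrow> ((nat \<Rightarrow> nat) \<Rightarrow> 'e::field) set" where
  "specht_module u =
    (\<lambda>x. group_algebra_mult (sum_list u) x (young_symmetrizer u)) ` group_algebra (sum_list u)"

definition left_translate :: "(nat \<Rightarrow> nat) \<Rightarrow> ((nat \<Rightarrow> nat) \<Rightarrow> 'e) \<Rightarrow> (nat \<Rightarrow> nat) \<Rightarrow> 'e" where
  "left_translate \<sigma> x = (\<lambda>\<pi>. x (inv \<sigma> \<circ> \<pi>))"


section \<open>Schur functors\<close>

primrec tensor_power :: "('o, 'a, 'e, 'm) tensor_category_scheme \<Rightarrow> 'o \<Rightarrow> nat \<Rightarrow> 'o" where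
  "tensor_power C V 0 = Unit C"
| "tensor_power C V (Suc k) = tensor_power C V k \<otimes>\<^sub>o\<^bsub>C\<^esub> V"

text \<open>\<open>adjacent_swap C V k i\<close> exchanges the factors \<open>i\<close> and \<open>i + 1\<close> of the \<open>k\<close>-th tensor power
  (for \<open>i + 1 < k\<close>, factors being numbered from \<open>0\<close>).\<close>

primrec adjacent_swap :: "('o, 'a, 'e, 'm) tensor_category_scheme \<Rightarrow> 'o \<Rightarrow> nat \<Rightarrow> nat \<Rightarrow> 'a" where
  "adjacent_swap C V 0 i = Ident C (Unit C)"
| "adjacent_swap C V (Suc k) i =
    (if Suc i < k then adjacent_swap C V k i \<otimes>\<^sub>a\<^bsub>C\<^esub> Ident C V
     else if Suc i = k then
       inv_arr C (Assoc C (tensor_power C V i) V V) \<cdot>\<^bsub>C\<^esub>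
       (Ident C (tensor_power C V i) \<otimes>\<^sub>a\<^bsub>C\<^esub> Braid C V V) \<cdot>\<^bsub>C\<^esub>
       Assoc C (tensor_power C V i) V V
     else Ident C (tensor_power C V (Suc k)))"

definition swaps_perm :: "nat list \<Rightarrow> nat \<Rightarrow> nat" where
  "swaps_perm w = foldr (\<lambda>i \<sigma>. Transposition.transpose i (Suc i) \<circ> \<sigma>) w id"

definition swaps_arrow ::
  "('o, 'a, 'e, 'm) tensor_category_scheme \<Rightarrow> 'o \<Rightarrow> nat \<Rightarrow> nat list \<Rightarrow> 'a" where
  "swaps_arrow C V k w =
    foldr (\<lambda>i f. adjacent_swap C V k i \<cdot>\<^bsub>C\<^esub> f) w (Ident C (tensor_power C V k))"

text \<open>The action of \<open>\<sigma>\<close> on the tensor power is computed from a decomposition of \<open>\<sigma>\<close> into adjacent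
  transpositions; by coherence the choice of the decomposition is irrelevant.\<close>

definition perm_arrow ::
  "('o, 'a, 'e, 'm) tensor_category_scheme \<Rightarrow> 'o \<Rightarrow> nat \<Rightarrow> (nat \<Rightarrow> nat) \<Rightarrow> 'a" where
  "perm_arrow C V k \<sigma> =
    swaps_arrow C V k (SOME w. (\<forall>i \<in> set w. Suc i < k) \<and> swaps_perm w = \<sigma>)"

definition linear_into_hom ::
  "('o, 'a, 'e::field, 'm) linear_category_scheme \<Rightarrow> ('g \<Rightarrow> 'e) set \<Rightarrow> 'o \<Rightarrow> 'o \<Rightarrow>
    (('g \<Rightarrow> 'e) \<Rightarrow> 'a) \<Rightarrow> bool" where
  "linear_into_hom C M A B \<phi> \<longleftrightarrow> (\<forall>x \<in> M. \<phi> x \<in> homs C A B) \<and>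
    (\<forall>x \<in> M. \<forall>y \<in> M. \<phi> (\<lambda>g. x g + y g) = Add C (\<phi> x) (\<phi> y)) \<and>
    (\<forall>c. \<forall>x \<in> M. \<phi> (\<lambda>g. c * x g) = Scale C c (\<phi> x))"

text \<open>For a vector space \<open>M\<close> and an object \<open>X\<close>, the object \<open>H = \<H>om(M, X)\<close> represents the functor
  sending \<open>T\<close> to the space of linear maps from \<open>M\<close> to \<open>homs C T X\<close>. The universal such map \<open>\<epsilon>\<close>
  sends \<open>m\<close> to the evaluation at \<open>m\<close>, an arrow from \<open>H\<close> to \<open>X\<close>.\<close>

definition is_hom_object ::
  "('o, 'a, 'e::field, 'm) linear_category_scheme \<Rightarrow> ('g \<Rightarrow> 'e) set \<Rightarrow> 'o \<Rightarrow> 'o \<Rightarrow>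
    (('g \<Rightarrow> 'e) \<Rightarrow> 'a) \<Rightarrow> bool" where
  "is_hom_object C M X H \<epsilon> \<longleftrightarrow> X \<in> Ob C \<and> H \<in> Ob C \<and> linear_into_hom C M H X \<epsilon> \<and>
    (\<forall>T \<in> Ob C. \<forall>\<phi>. linear_into_hom C M T X \<phi> \<longrightarrow>
      (\<exists>!h. h \<in> homs C T H \<and> (\<forall>m \<in> M. \<epsilon> m \<cdot>\<^bsub>C\<^esub> h = \<phi> m)))"

text \<open>The largest subobject \<open>\<iota>\<close> of \<open>H\<close> on which all \<open>a g\<close> with \<open>g \<in> G\<close> act trivially.\<close>

definition is_invariants ::
  "('o, 'a, 'm) category_scheme \<Rightarrow> 'g set \<Rightarrow> ('g \<Rightarrow> 'a) \<Rightarrow> 'o \<Rightarrow> 'o \<Rightarrow> 'a \<Rightarrow> bool" where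
  "is_invariants C G a H S \<iota> \<longleftrightarrow> S \<in> Ob C \<and> \<iota> \<in> homs C S H \<and> (\<forall>g \<in> G. a g \<cdot>\<^bsub>C\<^esub> \<iota> = \<iota>) \<and>
    (\<forall>T. \<forall>h \<in> homs C T H. (\<forall>g \<in> G. a g \<cdot>\<^bsub>C\<^esub> h = h) \<longrightarrow>
      (\<exists>!h'. h' \<in> homs C T S \<and> \<iota> \<cdot>\<^bsub>C\<^esub> h' = h))"

text \<open>The symmetric group acts on \<open>\<H>om(M, X)\<close> by \<open>(\<sigma> \<phi>)(m) = \<sigma> (\<phi> (\<sigma>\<^sup>-\<^sup>1 m))\<close>.\<close>

definition is_schur_object ::
  "('o, 'a, 'e::field, 'm) tensor_category_scheme \<Rightarrow> nat list \<Rightarrow> 'o \<Rightarrow> 'o \<Rightarrow> bool" where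
  "is_schur_object C u V S \<longleftrightarrow> (\<exists>H \<epsilon> a \<iota>.
    is_hom_object C (specht_module u) (tensor_power C V (sum_list u)) H \<epsilon> \<and>
    (\<forall>\<sigma>. \<sigma> permutes {..<sum_list u} \<longrightarrow> a \<sigma> \<in> homs C H H \<and>
      (\<forall>m \<in> specht_module u.
        \<epsilon> m \<cdot>\<^bsub>C\<^esub> a \<sigma> = perm_arrow C V (sum_list u) \<sigma> \<cdot>\<^bsub>C\<^esub> \<epsilon> (left_translate (inv \<sigma>) m))) \<and>
    is_invariants C {\<sigma>. \<sigma> permutes {..<sum_list u}} a H S \<iota>)"

text \<open>The Schur functor on objects is determined up to isomorphism only.\<close>

definition schur :: "('o, 'a, 'e::field, 'm) tensor_category_scheme \<Rightarrow> nat list \<Rightarrow> 'o \<Rightarrow> 'o" where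
  "schur C u V = (SOME S. is_schur_object C u V S)"

end

theory Submission
  imports Defs "HOL-Library.Function_Algebras"
begin

text \<open>The proof avoids Tannaka duality. An arrow of \<open>C\<close> is mono or epi as soon as it is injective or
  surjective on fibres, and an action \<open>A \<otimes> S \<rightarrow> T\<close> that is faithful in \<open>A\<close> embeds \<open>A\<close> into \<open>T \<otimes> S\<^sup>\<or>\<close>, so
  that \<open>S, T \<in> D\<close> imply \<open>A \<in> D\<close>. Applied to \<open>End V = V \<otimes> V\<^sup>\<or>\<close> this shows that \<open>V\<close> is basic iff
  \<open>End V \<in> D\<close>: if \<open>V \<otimes> W \<in> D\<close> with \<open>W \<noteq> 0\<close>, then \<open>End V\<close> acts faithfully on \<open>V \<otimes> W\<close>; and if a Schur
  object of \<open>V\<close> for a tuple shorter than \<open>n\<close> lies in \<open>D\<close>, then \<open>End V\<close> acts faithfully on it by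
  derivations, because the Lie algebra of \<open>GL n\<close> does. If \<open>V\<close> is basic, so is \<open>X = V\<^sup>\<otimes>\<^sup>k\<close>, and since \<open>X\<close> is
  irreducible under \<open>End X \<in> D\<close>, a single nonzero arrow from an object of \<open>D\<close> to \<open>X\<close> puts \<open>X\<close>
  into \<open>D\<close>. Such an arrow comes from the determinant for \<open>k = n\<close> and from the Schur object for
  \<open>k = \<ell>(u)\<close>. The \<open>m\<close> with \<open>V\<^sup>\<otimes>\<^sup>m \<in> D\<close> are closed under addition and subtraction, hence contain
  all multiples of \<open>gcd (\<ell>(u)) n\<close>; and a Schur object embeds into a sum of copies of \<open>V\<^sup>\<otimes>\<^sup>m\<close>.\<close>

section \<open>Objects, arrows and their fibres\<close>

text \<open>The fibre functor is faithful, so equality of arrows is decided on fibres; but a linear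
  map between fibres is an arrow only if it is built from the tensor structure. This shapes the
  central step. An arrow from \<open>End V \<otimes> S\<close> to \<open>S\<close> is linear in
  \<open>End V\<close>, so a matrix \<open>X\<close> cannot act on a tensor power by
  \<open>X \<otimes> ... \<otimes> X\<close>, only by the derivation that applies it to one factor
  at a time. The bound on the length of the tuple makes this action faithful: a diagram with n equal
  rows yields a power of the determinant, which matrices of trace zero annihilate. A matrix is
  tested on tensors that carry one basis vector per row of the diagram. The bound leaves some basis
  vector free, and exchanging it with the label of a box or of a row isolates an off-diagonal entry
  or a difference of diagonal entries. Characteristic 0 permits division by the group orders and by
  the numbers of permutations that appear as factors.\<close>

context neutral_tannakian_category
begin

lemma hom_Ob: "f \<in> homs C A B \<Longrightarrow> A \<in> Ob C" "f \<in> homs C A B \<Longrightarrow> B \<in> Ob C"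
  using Src_Ob Tgt_Ob by (auto simp: homs_def)

lemma hom_Arr: "f \<in> homs C A B \<Longrightarrow> f \<in> Arr C" "f \<in> homs C A B \<Longrightarrow> Src C f = A"
  "f \<in> homs C A B \<Longrightarrow> Tgt C f = B"
  by (auto simp: homs_def)

lemma FArr_mem: "f \<in> homs C A B \<Longrightarrow> x \<in> FOb F A \<Longrightarrow> FArr F f x \<in> FOb F B"
  using FArr_linear by (fastforce simp: linear_on_def)

lemma FArr_plus: "f \<in> homs C A B \<Longrightarrow> x \<in> FOb F A \<Longrightarrow> y \<in> FOb F A \<Longrightarrow>
    FArr F f (x + y) = FArr F f x + FArr F f y"
  using FArr_linear by (auto simp: linear_on_def)

lemma FArr_scale: "f \<in> homs C A B \<Longrightarrow> x \<in> FOb F A \<Longrightarrow>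
    FArr F f (FScale F c x) = FScale F c (FArr F f x)"
  using FArr_linear by (auto simp: linear_on_def)

lemma FOb_0: "A \<in> Ob C \<Longrightarrow> 0 \<in> FOb F A"
  using FOb_subspace V.subspace_0 by blast

lemma FOb_plus: "A \<in> Ob C \<Longrightarrow> x \<in> FOb F A \<Longrightarrow> y \<in> FOb F A \<Longrightarrow> x + y \<in> FOb F A"
  using FOb_subspace V.subspace_add by blast

lemma FOb_scale: "A \<in> Ob C \<Longrightarrow> x \<in> FOb F A \<Longrightarrow> FScale F c x \<in> FOb F A"
  using FOb_subspace V.subspace_scale by blast

lemma FOb_sum: "A \<in> Ob C \<Longrightarrow> \<forall>i \<in> I. f i \<in> FOb F A \<Longrightarrow> sum f I \<in> FOb F A"
  using V.subspace_sum[OF FOb_subspace, of A I f] by simp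

lemma FArr_0: "f \<in> homs C A B \<Longrightarrow> FArr F f 0 = 0"
  using FArr_scale[of f A B 0 0] FOb_0 hom_Ob by (metis V.scale_zero_left)

lemma FArr_sum: "f \<in> homs C A B \<Longrightarrow> \<forall>i \<in> I. g i \<in> FOb F A \<Longrightarrow>
    FArr F f (sum g I) = (\<Sum>i\<in>I. FArr F f (g i))"
  by (induction I rule: infinite_finite_induct) 
    (auto simp: FArr_0 FArr_plus FOb_sum hom_Ob)

lemma linear_on_sum:
  assumes L: "linear_on (FScale F) (FOb F A) (FOb F B) L" and A: "A \<in> Ob C" and "\<forall>i \<in> I. f i \<in> FOb F A"
  shows "L (sum f I) = (\<Sum>i\<in>I. L (f i))"
proof -
  have add: "\<And>x y. x \<in> FOb F A \<Longrightarrow> y \<in> FOb F A \<Longrightarrow> L (x + y) = L x + L y"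
    and scale: "\<And>c x. x \<in> FOb F A \<Longrightarrow> L (FScale F c x) = FScale F c (L x)"
    using L unfolding linear_on_def by blast+
  have "L 0 = 0" using scale[OF FOb_0[OF A], of 0] by simp
  then show ?thesis using assms(3)
    by (induction I rule: infinite_finite_induct) (auto simp: add FOb_sum[OF A])
qed

lemma FArr_Zero: "A \<in> Ob C \<Longrightarrow> B \<in> Ob C \<Longrightarrow> x \<in> FOb F A \<Longrightarrow> FArr F (Zero C A B) x = 0"
  using FArr_Add[of "Zero C A B" A B "Zero C A B" x] Zero_hom[of A B] Add_Zero[of "Zero C A B" A B]
  by simp

lemma FArr_diff: "f \<in> homs C A B \<Longrightarrow> x \<in> FOb F A \<Longrightarrow> y \<in> FOb F A \<Longrightarrow>
    FArr F f (x - y) = FArr F f x - FArr F f y"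
  using FArr_plus[of f A B "x - y" y] FOb_subspace V.subspace_diff hom_Ob by fastforce

text \<open>Arrows with equal composites with \<open>f\<close> agree on fibres, hence agree by
  faithfulness; linearity reduces injectivity to a zero kernel.\<close>

lemma is_monoI:
  assumes f: "f \<in> homs C A B" and inj: "\<And>x. x \<in> FOb F A \<Longrightarrow> FArr F f x = 0 \<Longrightarrow> x = 0"
  shows "is_mono C f"
  unfolding is_mono_def
proof (intro conjI allI ballI impI)
  show "f \<in> Arr C" using f by (simp add: homs_def)
  fix T g h assume g: "g \<in> homs C T (Src C f)" and h: "h \<in> homs C T (Src C f)"
    and eq: "f \<cdot> g = f \<cdot> h"
  have gh: "g \<in> homs C T A" "h \<in> homs C T A" using g h f by (auto simp: homs_def)
  show "g = h"
  proof (rule FArr_faithful[OF gh])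
    fix x assume x: "x \<in> FOb F T"
    have m: "FArr F g x \<in> FOb F A" "FArr F h x \<in> FOb F A" using x gh FArr_mem by auto
    have "FArr F f (FArr F g x) = FArr F f (FArr F h x)"
      using FArr_Comp[OF gh(1) f x] FArr_Comp[OF gh(2) f x] eq by simp
    then have "FArr F f (FArr F g x - FArr F h x) = 0" using FArr_diff[OF f m] by simp
    then show "FArr F g x = FArr F h x"
      using inj m FOb_subspace V.subspace_diff hom_Ob(1)[OF f] eq_iff_diff_eq_0 by metis
  qed
qed

lemma is_epiI:
  assumes f: "f \<in> homs C A B" and surj: "FOb F B \<subseteq> FArr F f ` FOb F A"
  shows "is_epi C f"
  unfolding is_epi_def
proof (intro conjI allI ballI impI)
  show "f \<in> Arr C" using f by (simp add: homs_def)
  fix T g h assume g: "g \<in> homs C (Tgt C f) T" and h: "h \<in> homs C (Tgt C f) T"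
    and eq: "g \<cdot> f = h \<cdot> f"
  have gh: "g \<in> homs C B T" "h \<in> homs C B T" using g h f by (auto simp: homs_def)
  show "g = h"
  proof (rule FArr_faithful[OF gh])
    fix y assume "y \<in> FOb F B"
    then obtain x where x: "x \<in> FOb F A" "y = FArr F f x" using surj by auto
    show "FArr F g y = FArr F h y"
      using FArr_Comp[OF f gh(1) x(1)] FArr_Comp[OF f gh(2) x(1)] eq x by simp
  qed
qed

lemma Ident_epi_mono: "A \<in> Ob C \<Longrightarrow> is_epi C (Ident C A) \<and> is_mono C (Ident C A)"
  using is_epiI[OF Ident_hom, of A] is_monoI[OF Ident_hom, of A] FArr_Ident
  by force

text \<open>Hom sets carry only the binary operation \<open>Add\<close>. A sum over an index set is
  therefore described by its effect on fibres, which determines the arrow.\<close>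

lemma arrow_sum:
  assumes "finite I" "A \<in> Ob C" "B \<in> Ob C" "\<And>i. i \<in> I \<Longrightarrow> f i \<in> homs C A B"
  shows "\<exists>g \<in> homs C A B. \<forall>x \<in> FOb F A. FArr F g x = (\<Sum>i\<in>I. FArr F (f i) x)"
  using assms(1,4)
proof (induction I)
  case empty
  then show ?case using FArr_Zero[OF assms(2,3)] Zero_hom[OF assms(2,3)] by auto
next
  case (insert i I)
  then obtain g where g: "g \<in> homs C A B" "\<And>x. x \<in> FOb F A \<Longrightarrow> FArr F g x = (\<Sum>i\<in>I. FArr F (f i) x)"
    by auto
  have fi: "f i \<in> homs C A B" using insert by auto
  show ?case
    using insert FArr_Add[OF fi g(1)] Add_hom[OF fi g(1)] g(2)
    by (intro bexI[of _ "Add C (f i) g"]) auto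
qed

text \<open>The image of \<open>e\<close> is the kernel of \<open>1 - e\<close>, and
  \<open>e\<close> factors through it because \<open>(1 - e) e = 0\<close>. Invariants and the
  determinant arise in this way from averaging arrows.\<close>

lemma split_idempotent:
  assumes e: "e \<in> homs C X X" and idem: "\<And>x. x \<in> FOb F X \<Longrightarrow> FArr F e (FArr F e x) = FArr F e x"
  shows "\<exists>Y k r. k \<in> homs C Y X \<and> r \<in> homs C X Y \<and> (\<forall>y \<in> FOb F Y. FArr F r (FArr F k y) = y) \<and>
    (\<forall>x \<in> FOb F X. FArr F k (FArr F r x) = FArr F e x)"
proof -
  have X: "X \<in> Ob C" using hom_Ob[OF e] by auto
  define d where "d = Add C (Ident C X) (Scale C (- 1) e)"
  have d: "d \<in> homs C X X" unfolding d_def by (intro Add_hom Ident_hom Scale_hom X e)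
  have Fd: "FArr F d x = x - FArr F e x" if "x \<in> FOb F X" for x
    unfolding d_def using FArr_Add[OF Ident_hom[OF X] Scale_hom[OF e] that] FArr_Scale[OF e that]
      FArr_Ident[OF X that] by simp
  obtain k where k: "is_kernel C d k" using kernels hom_Arr(1)[OF d] by blast
  define Y where "Y = Src C k"
  have kh: "k \<in> homs C Y X" and dk: "d \<cdot> k = Zero C Y X"
    and univ: "\<And>T h. h \<in> homs C T X \<Longrightarrow> d \<cdot> h = Zero C T X \<Longrightarrow> \<exists>!h'. h' \<in> homs C T Y \<and> k \<cdot> h' = h"
    using k d unfolding is_kernel_def Y_def homs_def by auto
  have Y: "Y \<in> Ob C" using hom_Ob kh by auto
  have "d \<cdot> e = Zero C X X"
  proof (rule FArr_faithful[OF Comp_hom[OF e d] Zero_hom[OF X X]])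
    fix x assume x: "x \<in> FOb F X"
    then show "FArr F (d \<cdot> e) x = FArr F (Zero C X X) x"
      using FArr_Comp[OF e d x] Fd[OF FArr_mem[OF e x]] idem FArr_Zero[OF X X x] by simp
  qed
  then obtain r where r: "r \<in> homs C X Y" "k \<cdot> r = e" using univ[OF e] by blast
  have Fkr: "FArr F k (FArr F r x) = FArr F e x" if "x \<in> FOb F X" for x
    using FArr_Comp[OF r(1) kh that] r(2) by simp
  have rk: "r \<cdot> k \<in> homs C Y Y" using Comp_hom[OF kh r(1)] .
  have Fek: "FArr F e (FArr F k y) = FArr F k y" if "y \<in> FOb F Y" for y
    using FArr_Comp[OF kh d that] dk FArr_Zero[OF Y X that] Fd[OF FArr_mem[OF kh that]] by simp
  \<comment> \<open>Both \<open>r \<cdot> k\<close> and the identity lift \<open>k\<close> through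
    the kernel \<open>k\<close>, and such a lift is unique.\<close>
  have "k \<cdot> (r \<cdot> k) = k"
  proof (rule FArr_faithful[OF Comp_hom[OF rk kh] kh])
    fix y assume y: "y \<in> FOb F Y"
    show "FArr F (k \<cdot> r \<cdot> k) y = FArr F k y"
      using FArr_Comp[OF rk kh y] FArr_Comp[OF kh r(1) y] Fkr[OF FArr_mem[OF kh y]] Fek[OF y] by simp
  qed
  moreover have "k \<cdot> Ident C Y = k" using Comp_Ident_right[OF kh] .
  ultimately have "r \<cdot> k = Ident C Y" using univ[OF kh dk] rk Ident_hom[OF Y] by blast
  then have "FArr F r (FArr F k y) = y" if "y \<in> FOb F Y" for y
    using FArr_Comp[OF kh r(1) that] FArr_Ident[OF Y that] by simp
  then show ?thesis using kh r(1) Fkr by blast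
qed

text \<open>On a zero object the identity is the zero arrow; conversely, all arrows to or from an
  object with zero fibre agree on fibres. A nonzero object thus provides a nonzero vector to compute
  with.\<close>

lemma zero_object_iff: 
  assumes "A \<in> Ob C" shows "is_zero_object C A \<longleftrightarrow> FOb F A = {0}"
proof
  assume z: "is_zero_object C A"
  have "Ident C A = Zero C A A"
    using z Ident_hom[OF assms] Zero_hom[OF assms assms] assms unfolding is_zero_object_def by blast
  then have "x = 0" if "x \<in> FOb F A" for x
    using FArr_Zero[OF assms assms that] FArr_Ident[OF assms that] by simp
  then show "FOb F A = {0}" using FOb_0[OF assms] by blast
next
  assume z: "FOb F A = {0}"
  show "is_zero_object C A"
    unfolding is_zero_object_def
  proof (intro conjI ballI assms)
    fix B assume B: "B \<in> Ob C"
    have "f = Zero C B A" if f: "f \<in> homs C B A" for f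
    proof (rule FArr_faithful[OF f Zero_hom[OF B assms]])
      fix x assume x: "x \<in> FOb F B"
      show "FArr F f x = FArr F (Zero C B A) x"
        using FArr_mem[OF f x] FArr_mem[OF Zero_hom[OF B assms] x] z by simp
    qed
    then show "\<exists>!f. f \<in> homs C B A" using Zero_hom[OF B assms] by blast
    have "f = Zero C A B" if f: "f \<in> homs C A B" for f
    proof (rule FArr_faithful[OF f Zero_hom[OF assms B]])
      fix x assume x: "x \<in> FOb F A"
      then show "FArr F f x = FArr F (Zero C A B) x"
        using z FArr_0[OF f] FArr_0[OF Zero_hom[OF assms B]] by simp
    qed
    then show "\<exists>!f. f \<in> homs C A B" using Zero_hom[OF assms B] by blast
  qed
qed

section \<open>Inverse arrows and isomorphic objects\<close>

lemma inverse_arrows_unique: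
  assumes "inverse_arrows C f g" "inverse_arrows C f h" shows "g = h"
proof -
  have f: "f \<in> homs C (Src C f) (Tgt C f)" using assms by (auto simp: inverse_arrows_def homs_def)
  have g: "g \<in> homs C (Tgt C f) (Src C f)" and h: "h \<in> homs C (Tgt C f) (Src C f)"
    using assms by (auto simp: inverse_arrows_def)
  have "g = (h \<cdot> f) \<cdot> g" using assms Comp_Ident_left[OF g] by (simp add: inverse_arrows_def)
  also have "\<dots> = h" using assms Comp_assoc[OF g f h] Comp_Ident_right[OF h]
    by (simp add: inverse_arrows_def)
  finally show ?thesis .
qed

lemma inv_arr:
  assumes "f \<in> homs C A B" "is_iso C f"
  shows "inv_arr C f \<in> homs C B A" "inv_arr C f \<cdot> f = Ident C A" "f \<cdot> inv_arr C f = Ident C B"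
proof -
  obtain g where g: "inverse_arrows C f g" using assms by (auto simp: is_iso_def)
  have "inv_arr C f = g" unfolding inv_arr_def using g inverse_arrows_unique by blast
  then show "inv_arr C f \<in> homs C B A" "inv_arr C f \<cdot> f = Ident C A" "f \<cdot> inv_arr C f = Ident C B"
    using g assms(1) by (auto simp: inverse_arrows_def homs_def)
qed

lemma FArr_inv_arr:
  assumes "f \<in> homs C A B" "is_iso C f"
  shows "x \<in> FOb F A \<Longrightarrow> FArr F (inv_arr C f) (FArr F f x) = x"
    "y \<in> FOb F B \<Longrightarrow> FArr F f (FArr F (inv_arr C f) y) = y"
proof -
  note i = inv_arr[OF assms]
  show "x \<in> FOb F A \<Longrightarrow> FArr F (inv_arr C f) (FArr F f x) = x"
    using FArr_Comp[OF assms(1) i(1)] i(2) FArr_Ident hom_Ob[OF assms(1)] by metis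
  show "y \<in> FOb F B \<Longrightarrow> FArr F f (FArr F (inv_arr C f) y) = y"
    using FArr_Comp[OF i(1) assms(1)] i(3) FArr_Ident hom_Ob[OF assms(1)] by metis
qed

lemma isomorphicI:
  assumes "f \<in> homs C A B" "g \<in> homs C B A" "g \<cdot> f = Ident C A" "f \<cdot> g = Ident C B"
  shows "isomorphic C A B"
  unfolding isomorphic_def is_iso_def inverse_arrows_def using assms
  by (intro bexI[of _ f] exI[of _ g]) (auto simp: homs_def)

lemma isomorphicE:
  assumes "isomorphic C A B"
  obtains f g where "f \<in> homs C A B" "g \<in> homs C B A" "g \<cdot> f = Ident C A" "f \<cdot> g = Ident C B"
  using assms inv_arr unfolding isomorphic_def by blast

lemma isomorphic_Ob: "isomorphic C A B \<Longrightarrow> A \<in> Ob C" "isomorphic C A B \<Longrightarrow> B \<in> Ob C"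
  using hom_Ob unfolding isomorphic_def by blast+

lemma isomorphic_refl: "A \<in> Ob C \<Longrightarrow> isomorphic C A A"
  by (rule isomorphicI[of "Ident C A" _ _ "Ident C A"]) (auto simp: Ident_hom Comp_Ident_left[OF Ident_hom])

lemma isomorphic_sym: "isomorphic C A B \<Longrightarrow> isomorphic C B A"
  by (elim isomorphicE) (rule isomorphicI)

lemma isomorphic_trans [trans]:
  assumes "isomorphic C A B" "isomorphic C B B'" shows "isomorphic C A B'"
proof -
  obtain f g where fg: "f \<in> homs C A B" "g \<in> homs C B A" "g \<cdot> f = Ident C A" "f \<cdot> g = Ident C B"
    using assms(1) by (rule isomorphicE)
  obtain f' g' where fg': "f' \<in> homs C B B'" "g' \<in> homs C B' B" "g' \<cdot> f' = Ident C B" "f' \<cdot> g' = Ident C B'"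
    using assms(2) by (rule isomorphicE)
  have "(g \<cdot> g') \<cdot> (f' \<cdot> f) = g \<cdot> (g' \<cdot> f') \<cdot> f"
    using Comp_assoc[OF Comp_hom[OF fg(1) fg'(1)] fg'(2) fg(2)] Comp_assoc[OF fg(1) fg'(1,2)] by simp
  moreover have "(f' \<cdot> f) \<cdot> (g \<cdot> g') = f' \<cdot> (f \<cdot> g) \<cdot> g'"
    using Comp_assoc[OF Comp_hom[OF fg'(2) fg(2)] fg(1) fg'(1)] Comp_assoc[OF fg'(2) fg(2,1)] by simp
  ultimately show ?thesis
    using fg fg' Comp_Ident_left[OF fg(1)] Comp_Ident_left[OF fg'(2)]
    by (intro isomorphicI[OF Comp_hom[OF fg(1) fg'(1)] Comp_hom[OF fg'(2) fg(2)]]) auto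
qed

lemma isomorphic_TOb:
  assumes "isomorphic C A A'" "isomorphic C B B'" shows "isomorphic C (A \<otimes>\<^sub>o B) (A' \<otimes>\<^sub>o B')"
proof -
  obtain f g where fg: "f \<in> homs C A A'" "g \<in> homs C A' A" "g \<cdot> f = Ident C A" "f \<cdot> g = Ident C A'"
    using assms(1) by (rule isomorphicE)
  obtain f' g' where fg': "f' \<in> homs C B B'" "g' \<in> homs C B' B" "g' \<cdot> f' = Ident C B" "f' \<cdot> g' = Ident C B'"
    using assms(2) by (rule isomorphicE)
  note ob = isomorphic_Ob[OF assms(1)] isomorphic_Ob[OF assms(2)]
  show ?thesis
  proof (rule isomorphicI[OF TArr_hom[OF fg(1) fg'(1)] TArr_hom[OF fg(2) fg'(2)]])
    show "(g \<otimes>\<^sub>a g') \<cdot> (f \<otimes>\<^sub>a f') = Ident C (A \<otimes>\<^sub>o B)"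
      using TArr_Comp[OF fg(1,2) fg'(1,2)] fg fg' TArr_Ident ob by simp
    show "(f \<otimes>\<^sub>a f') \<cdot> (g \<otimes>\<^sub>a g') = Ident C (A' \<otimes>\<^sub>o B')"
      using TArr_Comp[OF fg(2,1) fg'(2,1)] fg fg' TArr_Ident ob by simp
  qed
qed

lemma isomorphic_Assoc:
  "A\<^sub>1 \<in> Ob C \<Longrightarrow> A\<^sub>2 \<in> Ob C \<Longrightarrow> A\<^sub>3 \<in> Ob C \<Longrightarrow>
    isomorphic C ((A\<^sub>1 \<otimes>\<^sub>o A\<^sub>2) \<otimes>\<^sub>o A\<^sub>3) (A\<^sub>1 \<otimes>\<^sub>o (A\<^sub>2 \<otimes>\<^sub>o A\<^sub>3))"
  unfolding isomorphic_def using Assoc_hom Assoc_iso by blast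

lemma isomorphic_RUnit: "A \<in> Ob C \<Longrightarrow> isomorphic C (A \<otimes>\<^sub>o Unit C) A"
  unfolding isomorphic_def using RUnit_hom RUnit_iso by blast

lemma isomorphic_Braid: "A \<in> Ob C \<Longrightarrow> B \<in> Ob C \<Longrightarrow> isomorphic C (A \<otimes>\<^sub>o B) (B \<otimes>\<^sub>o A)"
  by (rule isomorphicI[OF Braid_hom Braid_hom]) (auto simp: Braid_symmetric)

text \<open>The chain consists of associators and one braiding. Membership in \<open>D\<close>
  depends only on the existence of an isomorphism, so no coherence is involved.\<close>

lemma isomorphic_interchange:
  assumes [simp]: "A \<in> Ob C" "B \<in> Ob C" "A' \<in> Ob C" "B' \<in> Ob C"
  shows "isomorphic C ((A \<otimes>\<^sub>o A') \<otimes>\<^sub>o (B \<otimes>\<^sub>o B')) ((A \<otimes>\<^sub>o B) \<otimes>\<^sub>o (A' \<otimes>\<^sub>o B'))"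
proof -
  note [simp] = TOb isomorphic_refl
  have "isomorphic C ((A \<otimes>\<^sub>o A') \<otimes>\<^sub>o (B \<otimes>\<^sub>o B')) (A \<otimes>\<^sub>o (A' \<otimes>\<^sub>o (B \<otimes>\<^sub>o B')))"
    by (simp add: isomorphic_Assoc)
  also have "isomorphic C \<dots> (A \<otimes>\<^sub>o ((A' \<otimes>\<^sub>o B) \<otimes>\<^sub>o B'))"
    by (simp add: isomorphic_Assoc isomorphic_TOb isomorphic_sym)
  also have "isomorphic C \<dots> (A \<otimes>\<^sub>o ((B \<otimes>\<^sub>o A') \<otimes>\<^sub>o B'))"
    by (simp add: isomorphic_Braid isomorphic_TOb)
  also have "isomorphic C \<dots> (A \<otimes>\<^sub>o (B \<otimes>\<^sub>o (A' \<otimes>\<^sub>o B')))"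
    by (simp add: isomorphic_Assoc isomorphic_TOb)
  also have "isomorphic C \<dots> ((A \<otimes>\<^sub>o B) \<otimes>\<^sub>o (A' \<otimes>\<^sub>o B'))"
    by (simp add: isomorphic_Assoc isomorphic_sym)
  finally show ?thesis .
qed

end

section \<open>Tensor products and duals on fibres\<close>

context neutral_tannakian_category
begin

abbreviation tens :: "'o \<Rightarrow> 'o \<Rightarrow> 'v \<Rightarrow> 'v \<Rightarrow> 'v" where "tens \<equiv> FTensor F"
abbreviation scale :: "'e \<Rightarrow> 'v \<Rightarrow> 'v"  (infixr "*\<^sub>v" 75) where "scale \<equiv> FScale F"
abbreviation functional :: "('v \<Rightarrow> 'e) \<Rightarrow> bool" where
  "functional \<equiv> Vector_Spaces.linear (FScale F) (*)"

sublocale VE: vector_space_pair "FScale F" "(*) :: 'e \<Rightarrow> 'e \<Rightarrow> 'e"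
  by unfold_locales (auto simp: algebra_simps)

lemma functional_simps:
  assumes "functional \<alpha>"
  shows "\<alpha> (x + y) = \<alpha> x + \<alpha> y" "\<alpha> (c *\<^sub>v x) = c * \<alpha> x" "\<alpha> 0 = 0" "\<alpha> (sum f I) = (\<Sum>i\<in>I. \<alpha> (f i))"
proof -
  interpret Vector_Spaces.linear "FScale F" "(*)" \<alpha> by (rule assms)
  show "\<alpha> (x + y) = \<alpha> x + \<alpha> y" "\<alpha> (c *\<^sub>v x) = c * \<alpha> x" "\<alpha> 0 = 0" "\<alpha> (sum f I) = (\<Sum>i\<in>I. \<alpha> (f i))"
    by (auto simp: add scale zero sum)
qed

lemma tens_linear:
  assumes "A \<in> Ob C" "B \<in> Ob C"
  shows "x \<in> FOb F A \<Longrightarrow> linear_on (FScale F) (FOb F B) (FOb F (A \<otimes>\<^sub>o B)) (tens A B x)"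
    and "y \<in> FOb F B \<Longrightarrow> linear_on (FScale F) (FOb F A) (FOb F (A \<otimes>\<^sub>o B)) (\<lambda>x. tens A B x y)"
  using FTensor[OF assms] by (auto simp: is_tensor_product_def)

context
  fixes A B assumes A: "A \<in> Ob C" and B: "B \<in> Ob C"
begin

lemma tens_mem: "x \<in> FOb F A \<Longrightarrow> y \<in> FOb F B \<Longrightarrow> tens A B x y \<in> FOb F (A \<otimes>\<^sub>o B)"
  using tens_linear(1)[OF A B] unfolding linear_on_def by blast

lemma tens_plus_right: "x \<in> FOb F A \<Longrightarrow> y \<in> FOb F B \<Longrightarrow> z \<in> FOb F B \<Longrightarrow>
    tens A B x (y + z) = tens A B x y + tens A B x z"
  using tens_linear(1)[OF A B] unfolding linear_on_def by blast

lemma tens_scale_right: "x \<in> FOb F A \<Longrightarrow> y \<in> FOb F B \<Longrightarrow>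
    tens A B x (c *\<^sub>v y) = c *\<^sub>v tens A B x y"
  using tens_linear(1)[OF A B] unfolding linear_on_def by blast

lemma tens_plus_left: "x \<in> FOb F A \<Longrightarrow> z \<in> FOb F A \<Longrightarrow> y \<in> FOb F B \<Longrightarrow>
    tens A B (x + z) y = tens A B x y + tens A B z y"
  using tens_linear(2)[OF A B] unfolding linear_on_def by blast

lemma tens_scale_left: "x \<in> FOb F A \<Longrightarrow> y \<in> FOb F B \<Longrightarrow>
    tens A B (c *\<^sub>v x) y = c *\<^sub>v tens A B x y"
  using tens_linear(2)[OF A B] unfolding linear_on_def by blast

lemma tens_0_right: "x \<in> FOb F A \<Longrightarrow> tens A B x 0 = 0"
  using tens_scale_right[of x 0 0] FOb_0[OF B] by simp

lemma tens_0_left: "y \<in> FOb F B \<Longrightarrow> tens A B 0 y = 0"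
  using tens_scale_left[of 0 y 0] FOb_0[OF A] by simp

lemma tens_sum_right: "x \<in> FOb F A \<Longrightarrow> \<forall>i \<in> I. f i \<in> FOb F B \<Longrightarrow>
    tens A B x (sum f I) = (\<Sum>i\<in>I. tens A B x (f i))"
  by (induction I rule: infinite_finite_induct) (auto simp: tens_0_right tens_plus_right FOb_sum B)

lemma tens_sum_left: "\<forall>i \<in> I. f i \<in> FOb F A \<Longrightarrow> y \<in> FOb F B \<Longrightarrow>
    tens A B (sum f I) y = (\<Sum>i\<in>I. tens A B (f i) y)"
  by (induction I rule: infinite_finite_induct) (auto simp: tens_0_left tens_plus_left FOb_sum A)

end

section \<open>Bases of fibres, vectors of a tensor product and functionals on it\<close>

lemma ex_basis:
  assumes A: "A \<in> Ob C"
  shows "\<exists>B. is_basis (FScale F) (FOb F A) B \<and> B \<subseteq> FOb F A \<and> finite B \<and> card B = fdim F A"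
proof -
  obtain B where B: "B \<subseteq> FOb F A" "V.independent B" "FOb F A \<subseteq> V.span B" "card B = V.dim (FOb F A)"
    using V.basis_exists by blast
  obtain B0 where "finite B0" "V.span B0 = FOb F A" using FOb_finite_dim[OF A] by blast
  then have "finite B" using V.independent_span_bound B by blast
  moreover have "V.span B = FOb F A" using B V.span_minimal[OF _ FOb_subspace[OF A]] by blast
  ultimately show ?thesis using B by (auto simp: is_basis_def fdim_def)
qed

lemma fdim_eqI:
  assumes "is_basis (FScale F) (FOb F A) B" shows "fdim F A = card B"
  unfolding fdim_def using assms V.dim_span_eq_card_independent[of B] by (auto simp: is_basis_def)

lemma basis_containing:
  assumes A: "A \<in> Ob C" and x: "x \<in> FOb F A" "x \<noteq> 0"
  shows "\<exists>B. is_basis (FScale F) (FOb F A) B \<and> x \<in> B"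
proof -
  have "V.independent {x}" using x by simp
  then obtain B where "{x} \<subseteq> B" "B \<subseteq> FOb F A" "V.independent B" "FOb F A \<subseteq> V.span B"
    using V.maximal_independent_subset_extend[of "{x}" "FOb F A"] x by blast
  moreover then have "V.span B = FOb F A" using V.span_minimal[OF _ FOb_subspace[OF A]] by blast
  ultimately show ?thesis by (auto simp: is_basis_def)
qed

text \<open>Nonzero vectors extend to bases, and then their product belongs to a basis of the tensor
  product.\<close>

lemma tens_nonzero:
  assumes "A \<in> Ob C" "B \<in> Ob C" "x \<in> FOb F A" "y \<in> FOb F B" "x \<noteq> 0" "y \<noteq> 0"
  shows "tens A B x y \<noteq> 0"
proof -
  obtain X where X: "is_basis (FScale F) (FOb F A) X" "x \<in> X" using basis_containing assms by blast
  obtain Y where Y: "is_basis (FScale F) (FOb F B) Y" "y \<in> Y" using basis_containing assms by blast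
  have "is_basis (FScale F) (FOb F (A \<otimes>\<^sub>o B)) ((\<lambda>(b, b'). tens A B b b') ` (X \<times> Y))"
    using FTensor[OF assms(1,2)] X(1) Y(1) by (auto simp: is_tensor_product_def)
  then have "V.independent ((\<lambda>(b, b'). tens A B b b') ` (X \<times> Y))" by (simp add: is_basis_def)
  moreover have "tens A B x y \<in> (\<lambda>(b, b'). tens A B b b') ` (X \<times> Y)" using X Y by force
  ultimately show ?thesis using V.dependent_zero by metis
qed

text \<open>Scalar multiples have no case of their own because a scalar is absorbed into the first
  factor.\<close>

lemma tens_induct [consumes 3, case_names tens zero add]:
  assumes A: "A \<in> Ob C" and B: "B \<in> Ob C" and z: "z \<in> FOb F (A \<otimes>\<^sub>o B)"
    and tens: "\<And>x y. x \<in> FOb F A \<Longrightarrow> y \<in> FOb F B \<Longrightarrow> P (tens A B x y)"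
    and zero: "P 0"
    and add: "\<And>z z'. z \<in> FOb F (A \<otimes>\<^sub>o B) \<Longrightarrow> z' \<in> FOb F (A \<otimes>\<^sub>o B) \<Longrightarrow> P z \<Longrightarrow> P z' \<Longrightarrow> P (z + z')"
  shows "P z"
proof -
  obtain X where X: "is_basis (FScale F) (FOb F A) X" "X \<subseteq> FOb F A" using ex_basis A by blast
  obtain Y where Y: "is_basis (FScale F) (FOb F B) Y" "Y \<subseteq> FOb F B" using ex_basis B by blast
  have "is_basis (FScale F) (FOb F (A \<otimes>\<^sub>o B)) ((\<lambda>(b, b'). tens A B b b') ` (X \<times> Y))"
    using FTensor[OF A B] X(1) Y(1) by (auto simp: is_tensor_product_def)
  then have "z \<in> V.span ((\<lambda>(b, b'). tens A B b b') ` (X \<times> Y))" using z by (simp add: is_basis_def)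
  then have "z \<in> FOb F (A \<otimes>\<^sub>o B) \<and> P z"
  proof (induction rule: V.span_induct_alt)
    case base
    show ?case using zero FOb_0 TOb A B by blast
  next
    case (step c x y)
    then obtain b b' where b: "b \<in> X" "b' \<in> Y" "x = tens A B b b'" by auto
    then have m: "b \<in> FOb F A" "b' \<in> FOb F B" using X Y by auto
    then have c: "c *\<^sub>v b \<in> FOb F A" "c *\<^sub>v x = tens A B (c *\<^sub>v b) b'"
      using FOb_scale A tens_scale_left[OF A B] b by auto
    then show ?case using step add tens m tens_mem[OF A B] FOb_plus[OF TOb[OF A B]] by auto
  qed
  then show ?thesis by simp
qed

text \<open>The functional is prescribed on products of basis vectors, where injectivity recovers
  the two factors. Linearity extends the product formula first to all \<open>y\<close>, then to all
  \<open>x\<close>.\<close>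

lemma functional_tens:
  assumes A: "A \<in> Ob C" and B: "B \<in> Ob C" and \<alpha>: "functional \<alpha>" and \<beta>: "functional \<beta>"
  shows "\<exists>\<gamma>. functional \<gamma> \<and> (\<forall>x \<in> FOb F A. \<forall>y \<in> FOb F B. \<gamma> (tens A B x y) = \<alpha> x * \<beta> y)"
proof -
  obtain X where X: "is_basis (FScale F) (FOb F A) X" "X \<subseteq> FOb F A" using ex_basis A by blast
  obtain Y where Y: "is_basis (FScale F) (FOb F B) Y" "Y \<subseteq> FOb F B" using ex_basis B by blast
  let ?t = "\<lambda>(b, b'). tens A B b b'"
  have inj: "inj_on ?t (X \<times> Y)" and "is_basis (FScale F) (FOb F (A \<otimes>\<^sub>o B)) (?t ` (X \<times> Y))"
    using FTensor[OF A B] X(1) Y(1) by (auto simp: is_tensor_product_def)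
  then have "V.independent (?t ` (X \<times> Y))" by (simp add: is_basis_def)
  then obtain \<gamma> where \<gamma>: "functional \<gamma>"
    and g: "\<And>w. w \<in> ?t ` (X \<times> Y) \<Longrightarrow> \<gamma> w = (\<lambda>(b, b'). \<alpha> b * \<beta> b') (inv_into (X \<times> Y) ?t w)"
    using VE.linear_independent_extend[of _ "\<lambda>w. (\<lambda>(b, b'). \<alpha> b * \<beta> b') (inv_into (X \<times> Y) ?t w)"]
    by blast
  note simps = functional_simps[OF \<alpha>] functional_simps[OF \<beta>] functional_simps[OF \<gamma>]
  have basis: "\<gamma> (tens A B b b') = \<alpha> b * \<beta> b'" if "b \<in> X" "b' \<in> Y" for b b'
    using g[of "tens A B b b'"] that inv_into_f_f[OF inj, of "(b, b')"] by force
  have spanX: "FOb F A = V.span X" and spanY: "FOb F B = V.span Y" using X Y by (auto simp: is_basis_def)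
  have 1: "\<gamma> (tens A B b y) = \<alpha> b * \<beta> y" if b: "b \<in> X" and y: "y \<in> FOb F B" for b y
  proof -
    have b': "b \<in> FOb F A" using b X by auto
    have "y \<in> V.span Y" using y spanY by simp
    then have "y \<in> FOb F B \<and> \<gamma> (tens A B b y) = \<alpha> b * \<beta> y"
    proof (induction rule: V.span_induct_alt)
      case base
      then show ?case using tens_0_right[OF A B b'] FOb_0[OF B] simps by simp
    next
      case (step c x y)
      have x: "x \<in> FOb F B" using step(1) Y by auto
      have m: "c *\<^sub>v x \<in> FOb F B" "y \<in> FOb F B" using FOb_scale[OF B x] step by auto
      then have "\<gamma> (tens A B b (c *\<^sub>v x + y)) = c * (\<alpha> b * \<beta> x) + \<alpha> b * \<beta> y"
        using tens_plus_right[OF A B b' m] tens_scale_right[OF A B b' x] basis[OF b step(1)] step(2)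
        by (simp add: simps)
      moreover have "\<alpha> b * \<beta> (c *\<^sub>v x + y) = c * (\<alpha> b * \<beta> x) + \<alpha> b * \<beta> y"
        by (simp only: functional_simps[OF \<beta>] distrib_left mult.left_commute)
      ultimately show ?case using FOb_plus[OF B m] by simp
    qed
    then show ?thesis by simp
  qed
  have "\<gamma> (tens A B x y) = \<alpha> x * \<beta> y" if x: "x \<in> FOb F A" and y: "y \<in> FOb F B" for x y
  proof -
    have "x \<in> V.span X" using x spanX by simp
    then have "x \<in> FOb F A \<and> \<gamma> (tens A B x y) = \<alpha> x * \<beta> y"
    proof (induction rule: V.span_induct_alt)
      case base
      then show ?case using tens_0_left[OF A B y] FOb_0[OF A] simps by simp
    next
      case (step c z x)
      have z: "z \<in> FOb F A" using step(1) X by auto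
      have m: "c *\<^sub>v z \<in> FOb F A" "x \<in> FOb F A" using FOb_scale[OF A z] step by auto
      then have "\<gamma> (tens A B (c *\<^sub>v z + x) y) = c * (\<alpha> z * \<beta> y) + \<alpha> x * \<beta> y"
        using tens_plus_left[OF A B m y] tens_scale_left[OF A B z y] 1[OF step(1) y] step(2)
        by (simp add: simps)
      moreover have "\<alpha> (c *\<^sub>v z + x) * \<beta> y = c * (\<alpha> z * \<beta> y) + \<alpha> x * \<beta> y"
        by (simp only: functional_simps[OF \<alpha>] distrib_right mult.assoc)
      ultimately show ?case using FOb_plus[OF A m] by simp
    qed
    then show ?thesis by simp
  qed
  then show ?thesis using \<gamma> by blast
qed

lemma FUnit_mem: "FUnit F \<in> FOb F (Unit C)" and FUnit_nonzero: "FUnit F \<noteq> 0"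
  using FUnit V.span_superset[of "{FUnit F}"] by (auto simp: is_basis_def)

lemma Unit_scalar:
  assumes "x \<in> FOb F (Unit C)" shows "\<exists>c. x = c *\<^sub>v FUnit F"
  using FUnit assms V.span_singleton[of "FUnit F"] unfolding is_basis_def by auto

lemma inv_arr_Assoc:
  assumes "A\<^sub>1 \<in> Ob C" "A\<^sub>2 \<in> Ob C" "A\<^sub>3 \<in> Ob C"
  shows "inv_arr C (Assoc C A\<^sub>1 A\<^sub>2 A\<^sub>3) \<in> homs C (A\<^sub>1 \<otimes>\<^sub>o (A\<^sub>2 \<otimes>\<^sub>o A\<^sub>3)) ((A\<^sub>1 \<otimes>\<^sub>o A\<^sub>2) \<otimes>\<^sub>o A\<^sub>3)"
    and "x \<in> FOb F A\<^sub>1 \<Longrightarrow> y \<in> FOb F A\<^sub>2 \<Longrightarrow> z \<in> FOb F A\<^sub>3 \<Longrightarrow>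
      FArr F (inv_arr C (Assoc C A\<^sub>1 A\<^sub>2 A\<^sub>3)) (tens A\<^sub>1 (A\<^sub>2 \<otimes>\<^sub>o A\<^sub>3) x (tens A\<^sub>2 A\<^sub>3 y z)) =
      tens (A\<^sub>1 \<otimes>\<^sub>o A\<^sub>2) A\<^sub>3 (tens A\<^sub>1 A\<^sub>2 x y) z"
proof -
  note i = Assoc_hom[OF assms] Assoc_iso[OF assms]
  show "inv_arr C (Assoc C A\<^sub>1 A\<^sub>2 A\<^sub>3) \<in> homs C (A\<^sub>1 \<otimes>\<^sub>o (A\<^sub>2 \<otimes>\<^sub>o A\<^sub>3)) ((A\<^sub>1 \<otimes>\<^sub>o A\<^sub>2) \<otimes>\<^sub>o A\<^sub>3)"
    by (rule inv_arr[OF i])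
  assume x: "x \<in> FOb F A\<^sub>1" "y \<in> FOb F A\<^sub>2" "z \<in> FOb F A\<^sub>3"
  then show "FArr F (inv_arr C (Assoc C A\<^sub>1 A\<^sub>2 A\<^sub>3)) (tens A\<^sub>1 (A\<^sub>2 \<otimes>\<^sub>o A\<^sub>3) x (tens A\<^sub>2 A\<^sub>3 y z)) =
      tens (A\<^sub>1 \<otimes>\<^sub>o A\<^sub>2) A\<^sub>3 (tens A\<^sub>1 A\<^sub>2 x y) z"
    using FArr_inv_arr(1)[OF i, of "tens (A\<^sub>1 \<otimes>\<^sub>o A\<^sub>2) A\<^sub>3 (tens A\<^sub>1 A\<^sub>2 x y) z"] FTensor_Assoc[OF assms x]
      tens_mem TOb assms by simp
qed

text \<open>The fibre of a dual \<open>B'\<close> of \<open>B\<close> is the dual vector space: \<open>ys\<close> and \<open>\<xi>s\<close> play the role of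
  dual bases and \<open>\<beta>\<close> that of the evaluation pairing.\<close>

lemma dual_fibre:
  assumes "is_dual C B B'"
  obtains \<beta> :: "'v \<Rightarrow> 'v \<Rightarrow> 'e" and N :: nat and ys \<xi>s :: "nat \<Rightarrow> 'v"
  where "\<And>i. i < N \<Longrightarrow> ys i \<in> FOb F B" "\<And>i. i < N \<Longrightarrow> \<xi>s i \<in> FOb F B'"
    and "\<And>x. x \<in> FOb F B \<Longrightarrow> (\<Sum>i<N. \<beta> (\<xi>s i) x *\<^sub>v ys i) = x"
    and "\<And>\<xi>. \<xi> \<in> FOb F B' \<Longrightarrow> (\<Sum>i<N. \<beta> \<xi> (ys i) *\<^sub>v \<xi>s i) = \<xi>"
    and "\<And>A. A \<in> Ob C \<Longrightarrow> \<exists>e \<in> homs C ((A \<otimes>\<^sub>o B') \<otimes>\<^sub>o B) A. \<forall>a \<in> FOb F A. \<forall>\<xi> \<in> FOb F B'. \<forall>x \<in> FOb F B.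
      FArr F e (tens (A \<otimes>\<^sub>o B') B (tens A B' a \<xi>) x) = \<beta> \<xi> x *\<^sub>v a"
    and "\<And>A. A \<in> Ob C \<Longrightarrow> \<exists>c \<in> homs C A ((A \<otimes>\<^sub>o B) \<otimes>\<^sub>o B'). \<forall>a \<in> FOb F A.
      FArr F c a = (\<Sum>i<N. tens (A \<otimes>\<^sub>o B) B' (tens A B a (ys i)) (\<xi>s i))"
proof -
  have B: "B \<in> Ob C" "B' \<in> Ob C" using assms by (auto simp: is_dual_def)
  note U = Unit
  obtain ev coev where ev: "ev \<in> homs C (B' \<otimes>\<^sub>o B) (Unit C)"
    and coev: "coev \<in> homs C (Unit C) (B \<otimes>\<^sub>o B')"
    and tri1: "RUnit C B \<cdot> (Ident C B \<otimes>\<^sub>a ev) \<cdot> Assoc C B B' B \<cdot> (coev \<otimes>\<^sub>a Ident C B) = LUnit C B"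
    and tri2: "LUnit C B' \<cdot> (ev \<otimes>\<^sub>a Ident C B') \<cdot> inv_arr C (Assoc C B' B B')
          \<cdot> (Ident C B' \<otimes>\<^sub>a coev) = RUnit C B'"
    using assms unfolding is_dual_def by blast
  \<comment> \<open>The fibre of the unit is the line through \<open>FUnit F\<close>, so the
    evaluation arrow takes scalar values.\<close>
  define \<beta> where "\<beta> \<xi> x = (SOME c. FArr F ev (tens B' B \<xi> x) = c *\<^sub>v FUnit F)" for \<xi> x
  have \<beta>: "FArr F ev (tens B' B \<xi> x) = \<beta> \<xi> x *\<^sub>v FUnit F" if "\<xi> \<in> FOb F B'" "x \<in> FOb F B" for \<xi> x
    unfolding \<beta>_def using someI_ex[OF Unit_scalar[OF FArr_mem[OF ev tens_mem[OF B(2,1) that]]]] .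
  \<comment> \<open>Indexing by an initial segment of the natural numbers lets two sums of products
    be concatenated. Applied to the coevaluation of \<open>FUnit F\<close>, this yields
    \<open>ys\<close> and \<open>\<xi>s\<close>.\<close>
  have sums: "\<exists>N ys \<xi>s. (\<forall>i<N::nat. ys i \<in> FOb F B \<and> \<xi>s i \<in> FOb F B') \<and> z = (\<Sum>i<N. tens B B' (ys i) (\<xi>s i))"
    if "z \<in> FOb F (B \<otimes>\<^sub>o B')" for z
    using B that
  proof (induction rule: tens_induct)
    case (tens x y)
    then show ?case by (intro exI[of _ "Suc 0"] exI[of _ "\<lambda>_. x"] exI[of _ "\<lambda>_. y"]) auto
  next
    case zero
    then show ?case by (intro exI[of _ "0"]) auto
  next
    case (add z z')
    then obtain N ys \<xi>s N' ys' \<xi>s' where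
      1: "\<forall>i<N::nat. ys i \<in> FOb F B \<and> \<xi>s i \<in> FOb F B'" "z = (\<Sum>i<N. tens B B' (ys i) (\<xi>s i))"
      and 2: "\<forall>i<N'::nat. ys' i \<in> FOb F B \<and> \<xi>s' i \<in> FOb F B'" "z' = (\<Sum>i<N'. tens B B' (ys' i) (\<xi>s' i))"
      by blast
    define Y where "Y i = (if i < N then ys i else ys' (i - N))" for i
    define \<Xi> where "\<Xi> i = (if i < N then \<xi>s i else \<xi>s' (i - N))" for i
    have "(\<Sum>i<N + N'. tens B B' (Y i) (\<Xi> i)) =
        (\<Sum>i<N. tens B B' (Y i) (\<Xi> i)) + (\<Sum>i<N'. tens B B' (Y (N + i)) (\<Xi> (N + i)))"
      by (induction N') (simp_all add: add.assoc)
    also have "\<dots> = z + z'" using 1 2 by (simp add: Y_def \<Xi>_def)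
    finally show ?case using 1 2 by (intro exI[of _ "N + N'"] exI[of _ Y] exI[of _ \<Xi>]) (auto simp: Y_def \<Xi>_def)
  qed
  obtain N :: nat and ys \<xi>s where mem: "\<And>i. i < N \<Longrightarrow> ys i \<in> FOb F B" "\<And>i. i < N \<Longrightarrow> \<xi>s i \<in> FOb F B'"
    and co: "FArr F coev (FUnit F) = (\<Sum>i<N. tens B B' (ys i) (\<xi>s i))"
    using sums[OF FArr_mem[OF coev FUnit_mem]] by blast
  \<comment> \<open>The evaluation is tensored with an arbitrary object \<open>A\<close> on the
    left, so that the last two factors can be contracted while \<open>A\<close> is kept.\<close>
  have e: "\<exists>e \<in> homs C ((A \<otimes>\<^sub>o B') \<otimes>\<^sub>o B) A. \<forall>a \<in> FOb F A. \<forall>\<xi> \<in> FOb F B'. \<forall>x \<in> FOb F B.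
      FArr F e (tens (A \<otimes>\<^sub>o B') B (tens A B' a \<xi>) x) = \<beta> \<xi> x *\<^sub>v a" if A: "A \<in> Ob C" for A
  proof -
    note h1 = Assoc_hom[OF A B(2,1)] and h2 = TArr_hom[OF Ident_hom[OF A] ev] and h3 = RUnit_hom[OF A]
    show ?thesis
    proof (intro bexI[OF _ Comp_hom[OF Comp_hom[OF h1 h2] h3]] ballI)
      fix a \<xi> x assume *: "a \<in> FOb F A" "\<xi> \<in> FOb F B'" "x \<in> FOb F B"
      then show "FArr F (RUnit C A \<cdot> (Ident C A \<otimes>\<^sub>a ev) \<cdot> Assoc C A B' B)
          (tens (A \<otimes>\<^sub>o B') B (tens A B' a \<xi>) x) = \<beta> \<xi> x *\<^sub>v a"
        using A B U TOb by (simp add: FArr_Comp[OF Comp_hom[OF h1 h2] h3] FArr_Comp[OF h1 h2] tens_mem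
          FTensor_Assoc FTensor_natural[OF Ident_hom[OF A] ev] FArr_Ident \<beta> tens_scale_right
          FUnit_mem FArr_scale[OF h3] FTensor_RUnit)
    qed
  qed
  have c: "\<exists>c \<in> homs C A ((A \<otimes>\<^sub>o B) \<otimes>\<^sub>o B'). \<forall>a \<in> FOb F A.
      FArr F c a = (\<Sum>i<N. tens (A \<otimes>\<^sub>o B) B' (tens A B a (ys i)) (\<xi>s i))" if A: "A \<in> Ob C" for A
  proof -
    note r = RUnit_hom[OF A] RUnit_iso[OF A]
    note h1 = inv_arr(1)[OF r] and h2 = TArr_hom[OF Ident_hom[OF A] coev] and h3 = inv_arr_Assoc(1)[OF A B]
    have ri: "FArr F (inv_arr C (RUnit C A)) a = tens A (Unit C) a (FUnit F)" if "a \<in> FOb F A" for a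
      using FArr_inv_arr(1)[OF r tens_mem[OF A U that FUnit_mem]] FTensor_RUnit[OF A that] by simp
    show ?thesis
    proof (intro bexI[OF _ Comp_hom[OF Comp_hom[OF h1 h2] h3]] ballI)
      fix a assume a: "a \<in> FOb F A"
      show "FArr F (inv_arr C (Assoc C A B B') \<cdot> (Ident C A \<otimes>\<^sub>a coev) \<cdot> inv_arr C (RUnit C A)) a =
        (\<Sum>i<N. tens (A \<otimes>\<^sub>o B) B' (tens A B a (ys i)) (\<xi>s i))"
        using A B U a mem
        by (simp add: TOb FArr_Comp[OF Comp_hom[OF h1 h2] h3] FArr_Comp[OF h1 h2] ri FTensor_natural[OF Ident_hom[OF A] coev]
            FUnit_mem FArr_Ident co tens_sum_right FArr_sum[OF h3] tens_mem inv_arr_Assoc(2))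
    qed
  qed
  \<comment> \<open>The first triangle identity evaluated at \<open>1 \<otimes> x\<close> is the
    expansion of \<open>x\<close> in dual bases.\<close>
  have z1: "(\<Sum>i<N. \<beta> (\<xi>s i) x *\<^sub>v ys i) = x" if x: "x \<in> FOb F B" for x
  proof -
    note I = Ident_hom[OF B(1)]
    note h0 = TArr_hom[OF coev I] and h1 = Assoc_hom[OF B(1,2,1)] and h2 = TArr_hom[OF I ev] and h3 = RUnit_hom[OF B(1)]
    note g1 = Comp_hom[OF h0 h1] note g2 = Comp_hom[OF g1 h2]
    have t: "tens (Unit C) B (FUnit F) x \<in> FOb F (Unit C \<otimes>\<^sub>o B)" using tens_mem[OF U B(1) FUnit_mem x] .
    have m: "\<forall>i \<in> {..<N}. tens (B \<otimes>\<^sub>o B') B (tens B B' (ys i) (\<xi>s i)) x \<in> FOb F ((B \<otimes>\<^sub>o B') \<otimes>\<^sub>o B)"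
      using tens_mem TOb B mem x by simp
    have s: "tens (B \<otimes>\<^sub>o B') B (\<Sum>i<N. tens B B' (ys i) (\<xi>s i)) x =
        (\<Sum>i<N. tens (B \<otimes>\<^sub>o B') B (tens B B' (ys i) (\<xi>s i)) x)"
      using tens_mem mem by (simp add: tens_sum_left TOb B x)
    have "x = FArr F (LUnit C B) (tens (Unit C) B (FUnit F) x)" using FTensor_LUnit[OF B(1) x] by simp
    also have "\<dots> = FArr F (RUnit C B \<cdot> (Ident C B \<otimes>\<^sub>a ev) \<cdot> Assoc C B B' B \<cdot> (coev \<otimes>\<^sub>a Ident C B))
        (tens (Unit C) B (FUnit F) x)" using tri1 by simp
    also have "\<dots> = FArr F (RUnit C B) (FArr F (Ident C B \<otimes>\<^sub>a ev) (FArr F (Assoc C B B' B)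
        (FArr F (coev \<otimes>\<^sub>a Ident C B) (tens (Unit C) B (FUnit F) x))))"
      using FArr_Comp[OF g2 h3 t] FArr_Comp[OF g1 h2 t] FArr_Comp[OF h0 h1 t] by simp
    also have "\<dots> = FArr F (RUnit C B) (FArr F (Ident C B \<otimes>\<^sub>a ev) (FArr F (Assoc C B B' B)
        (\<Sum>i<N. tens (B \<otimes>\<^sub>o B') B (tens B B' (ys i) (\<xi>s i)) x)))"
      using FTensor_natural[OF coev I FUnit_mem x] co s FArr_Ident[OF B(1) x] by simp
    also have "\<dots> = (\<Sum>i<N. FArr F (RUnit C B) (FArr F (Ident C B \<otimes>\<^sub>a ev) (FArr F (Assoc C B B' B)
        (tens (B \<otimes>\<^sub>o B') B (tens B B' (ys i) (\<xi>s i)) x))))"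
      using m by (simp add: FArr_sum[OF h1] FArr_sum[OF h2] FArr_sum[OF h3] FArr_mem[OF h1] FArr_mem[OF h2])
    also have "\<dots> = (\<Sum>i<N. \<beta> (\<xi>s i) x *\<^sub>v ys i)"
      using mem x B U
      by (simp add: FTensor_Assoc FTensor_natural[OF I ev] FArr_Ident tens_mem \<beta> tens_scale_right FUnit_mem
          FArr_scale[OF h3] FTensor_RUnit)
    finally show ?thesis by simp
  qed
  \<comment> \<open>Likewise the second triangle identity evaluated at
    \<open>\<xi> \<otimes> 1\<close> expands \<open>\<xi>\<close>.\<close>
  have z2: "(\<Sum>i<N. \<beta> \<xi> (ys i) *\<^sub>v \<xi>s i) = \<xi>" if x: "\<xi> \<in> FOb F B'" for \<xi>
  proof -
    note I = Ident_hom[OF B(2)]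
    note h0 = TArr_hom[OF I coev] and h1 = inv_arr_Assoc(1)[OF B(2,1,2)] and h2 = TArr_hom[OF ev I] and h3 = LUnit_hom[OF B(2)]
    note g1 = Comp_hom[OF h0 h1] note g2 = Comp_hom[OF g1 h2]
    have t: "tens B' (Unit C) \<xi> (FUnit F) \<in> FOb F (B' \<otimes>\<^sub>o Unit C)" using tens_mem[OF B(2) U x FUnit_mem] .
    have m: "\<forall>i \<in> {..<N}. tens B' (B \<otimes>\<^sub>o B') \<xi> (tens B B' (ys i) (\<xi>s i)) \<in> FOb F (B' \<otimes>\<^sub>o (B \<otimes>\<^sub>o B'))"
      using tens_mem TOb B mem x by simp
    have "\<xi> = FArr F (RUnit C B') (tens B' (Unit C) \<xi> (FUnit F))" using FTensor_RUnit[OF B(2) x] by simp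
    also have "\<dots> = FArr F (LUnit C B' \<cdot> (ev \<otimes>\<^sub>a Ident C B') \<cdot> inv_arr C (Assoc C B' B B')
          \<cdot> (Ident C B' \<otimes>\<^sub>a coev)) (tens B' (Unit C) \<xi> (FUnit F))" using tri2 by simp
    also have "\<dots> = FArr F (LUnit C B') (FArr F (ev \<otimes>\<^sub>a Ident C B') (FArr F (inv_arr C (Assoc C B' B B'))
        (FArr F (Ident C B' \<otimes>\<^sub>a coev) (tens B' (Unit C) \<xi> (FUnit F)))))"
      using FArr_Comp[OF g2 h3 t] FArr_Comp[OF g1 h2 t] FArr_Comp[OF h0 h1 t] by simp
    also have "\<dots> = FArr F (LUnit C B') (FArr F (ev \<otimes>\<^sub>a Ident C B') (FArr F (inv_arr C (Assoc C B' B B'))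
        (\<Sum>i<N. tens B' (B \<otimes>\<^sub>o B') \<xi> (tens B B' (ys i) (\<xi>s i)))))"
      using FTensor_natural[OF I coev x FUnit_mem] co FArr_Ident[OF B(2) x]
        tens_mem[OF B mem] by (simp add: tens_sum_right[OF B(2) TOb[OF B] x])
    also have "\<dots> = (\<Sum>i<N. FArr F (LUnit C B') (FArr F (ev \<otimes>\<^sub>a Ident C B') (FArr F (inv_arr C (Assoc C B' B B'))
        (tens B' (B \<otimes>\<^sub>o B') \<xi> (tens B B' (ys i) (\<xi>s i))))))"
      using m by (simp add: FArr_sum[OF h1] FArr_sum[OF h2] FArr_sum[OF h3] FArr_mem[OF h1] FArr_mem[OF h2])
    also have "\<dots> = (\<Sum>i<N. \<beta> \<xi> (ys i) *\<^sub>v \<xi>s i)"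
      using mem x B U
      by (simp add: inv_arr_Assoc(2) FTensor_natural[OF ev I] FArr_Ident tens_mem \<beta> tens_scale_left FUnit_mem
          FArr_scale[OF h3] FTensor_LUnit)
    finally show ?thesis by simp
  qed
  show thesis using that[of N ys \<xi>s \<beta>] mem z1 z2 e c by blast
qed

end

section \<open>Membership in the subcategory\<close>

locale tannakian_pair = neutral_tannakian_category C F
  for C :: "('o, 'a, 'e::field, 'm) tensor_category_scheme" (structure)
    and F :: "('o, 'a, 'e, 'v::ab_group_add, 'n) fibre_functor_scheme" +
  fixes D :: "'o set"
  assumes subcategory: "tannakian_subcategory C D"
    and one_dimensional: "L \<in> Ob C \<Longrightarrow> fdim F L = 1 \<Longrightarrow> L \<in> D"
begin

lemma D_Ob: "X \<in> D \<Longrightarrow> X \<in> Ob C"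
  and D_isomorphic: "X \<in> D \<Longrightarrow> isomorphic C X Y \<Longrightarrow> Y \<in> D"
  and D_subquotient: "X \<in> D \<Longrightarrow> is_subquotient C Z X \<Longrightarrow> Z \<in> D"
  and D_direct_sum: "set Xs \<subseteq> D \<Longrightarrow> is_direct_sum C Xs S \<Longrightarrow> S \<in> D"
  and D_Unit: "Unit C \<in> D"
  and D_TOb: "X \<in> D \<Longrightarrow> Y \<in> D \<Longrightarrow> X \<otimes>\<^sub>o Y \<in> D"
  and D_dual: "X \<in> D \<Longrightarrow> is_dual C X X' \<Longrightarrow> X' \<in> D"
  using subcategory unfolding tannakian_subcategory_def by blast+

lemma D_subobject:
  assumes "X \<in> D" and f: "f \<in> homs C Y X" and "\<And>y. y \<in> FOb F Y \<Longrightarrow> FArr F f y = 0 \<Longrightarrow> y = 0"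
  shows "Y \<in> D"
proof (rule D_subquotient[OF assms(1)])
  show "is_subquotient C Y X" unfolding is_subquotient_def
    using f is_monoI[OF f assms(3)] Ident_hom Ident_epi_mono hom_Ob[OF f] by blast
qed

lemma D_quotient:
  assumes "X \<in> D" and f: "f \<in> homs C X Z" and "FOb F Z \<subseteq> FArr F f ` FOb F X"
  shows "Z \<in> D"
proof (rule D_subquotient[OF assms(1)])
  show "is_subquotient C Z X" unfolding is_subquotient_def
    using f is_epiI[OF f assms(3)] Ident_hom Ident_epi_mono hom_Ob[OF f] by blast
qed

text \<open>The arrows combine into one arrow to a direct sum of the \<open>X i\<close>. The
  induction keeps only what matters of such an arrow: its target lies in \<open>D\<close>, and its
  kernel lies in all the kernels.\<close>

lemma D_joint_subobject:
  assumes A: "A \<in> Ob C" and I: "finite I" and "\<And>i. i \<in> I \<Longrightarrow> X i \<in> D" "\<And>i. i \<in> I \<Longrightarrow> f i \<in> homs C A (X i)"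
    and inj: "\<And>a. a \<in> FOb F A \<Longrightarrow> \<forall>i \<in> I. FArr F (f i) a = 0 \<Longrightarrow> a = 0"
  shows "A \<in> D"
proof -
  have "\<exists>P \<in> D. \<exists>h \<in> homs C A P. \<forall>a \<in> FOb F A. FArr F h a = 0 \<longrightarrow> (\<forall>i \<in> I. FArr F (f i) a = 0)"
    using I assms(3,4)
  proof (induction I)
    case empty
    obtain Z where "is_zero_object C Z" using zero_object by blast
    then have "Z \<in> D" using D_direct_sum[of "[]" Z] is_direct_sum.Nil by fastforce
    then show ?case using Zero_hom[OF A D_Ob] by auto
  next
    case (insert i I)
    then obtain P h where P: "P \<in> D" and h: "h \<in> homs C A P"
      and 0: "\<And>a. a \<in> FOb F A \<Longrightarrow> FArr F h a = 0 \<Longrightarrow> \<forall>i \<in> I. FArr F (f i) a = 0"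
      by auto
    have Xi: "X i \<in> D" and fi: "f i \<in> homs C A (X i)" using insert by auto
    \<comment> \<open>\<open>is_direct_sum\<close> closes every list with a zero object, so the sum
      of \<open>X i\<close> and \<open>P\<close> is built as the biproduct of \<open>X i\<close>
      with the biproduct of \<open>P\<close> and \<open>Z\<close>.\<close>
    obtain Z where Z: "is_zero_object C Z" using zero_object by blast
    have Z': "Z \<in> Ob C" using Z by (auto simp: is_zero_object_def)
    obtain Q where Q: "is_biproduct C P Z Q" using biproducts D_Ob[OF P] Z' by blast
    have Q': "Q \<in> Ob C" using Q hom_Ob unfolding is_biproduct_def by blast
    obtain R where R: "is_biproduct C (X i) Q R" using biproducts D_Ob[OF Xi] Q' by blast
    have RD: "R \<in> D"
      using D_direct_sum[of "[X i, P]" R] Xi P is_direct_sum.Cons[OF is_direct_sum.Cons[OF is_direct_sum.Nil[OF Z] Q] R]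
      by auto
    obtain j p where jp: "j \<in> homs C P Q" "p \<in> homs C Q P" "p \<cdot> j = Ident C P"
      using Q unfolding is_biproduct_def by blast
    obtain i\<^sub>1 i\<^sub>2 p\<^sub>1 p\<^sub>2 where R': "i\<^sub>1 \<in> homs C (X i) R" "i\<^sub>2 \<in> homs C Q R" "p\<^sub>1 \<in> homs C R (X i)" "p\<^sub>2 \<in> homs C R Q"
      "p\<^sub>1 \<cdot> i\<^sub>1 = Ident C (X i)" "p\<^sub>2 \<cdot> i\<^sub>2 = Ident C Q" "p\<^sub>1 \<cdot> i\<^sub>2 = Zero C Q (X i)" "p\<^sub>2 \<cdot> i\<^sub>1 = Zero C (X i) Q"
      using R unfolding is_biproduct_def by blast
    let ?h = "Add C (i\<^sub>1 \<cdot> f i) (i\<^sub>2 \<cdot> (j \<cdot> h))"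
    have h1: "i\<^sub>1 \<cdot> f i \<in> homs C A R" and jh: "j \<cdot> h \<in> homs C A Q" and h2: "i\<^sub>2 \<cdot> (j \<cdot> h) \<in> homs C A R"
      using Comp_hom fi R' jp h by blast+
    have "\<forall>a \<in> FOb F A. FArr F ?h a = 0 \<longrightarrow> (\<forall>i \<in> insert i I. FArr F (f i) a = 0)"
    proof (intro ballI impI)
      fix a k assume a: "a \<in> FOb F A" and z: "FArr F ?h a = 0" and k: "k \<in> insert i I"
      let ?x = "FArr F (f i) a" and ?y = "FArr F j (FArr F h a)"
      have x: "?x \<in> FOb F (X i)" and y: "?y \<in> FOb F Q" using a FArr_mem fi h jp by blast+
      have s: "FArr F i\<^sub>1 ?x + FArr F i\<^sub>2 ?y = 0"
        using z FArr_Add[OF h1 h2 a] FArr_Comp[OF fi R'(1) a] FArr_Comp[OF jh R'(2) a] FArr_Comp[OF h jp(1) a]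
        by simp
      note m = FArr_mem[OF R'(1) x] FArr_mem[OF R'(2) y]
      have "?x = 0"
        using arg_cong[OF s, of "FArr F p\<^sub>1"] FArr_plus[OF R'(3) m] FArr_Comp[OF R'(1,3) x] FArr_Comp[OF R'(2,3) y]
          R'(5,7) FArr_Ident[OF D_Ob[OF Xi] x] FArr_Zero[OF Q' D_Ob[OF Xi] y] FArr_0[OF R'(3)] by simp
      moreover have "?y = 0"
        using arg_cong[OF s, of "FArr F p\<^sub>2"] FArr_plus[OF R'(4) m] FArr_Comp[OF R'(1,4) x] FArr_Comp[OF R'(2,4) y]
          R'(6,8) FArr_Ident[OF Q' y] FArr_Zero[OF D_Ob[OF Xi] Q' x] FArr_0[OF R'(4)] by simp
      then have "FArr F h a = 0"
        using FArr_Comp[OF jp(1,2) FArr_mem[OF h a]] jp(3) FArr_Ident[OF D_Ob[OF P] FArr_mem[OF h a]] FArr_0[OF jp(2)]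
        by simp
      ultimately show "FArr F (f k) a = 0" using 0[OF a] k by auto
    qed
    then show ?case using RD Add_hom[OF h1 h2] by blast
  qed
  then show ?thesis using D_subobject inj by blast
qed

text \<open>Duality transposes \<open>g i\<close> into an arrow from \<open>A\<close> to
  \<open>T i \<otimes> S'\<close>, where \<open>S'\<close> is dual to \<open>S i\<close>. A family
  is allowed because the action on a Schur object will be given by several arrows, one for each
  basis vector of the Specht module, whose faithfulness is known only jointly.\<close>

lemma D_joint_action:
  assumes A: "A \<in> Ob C" and I: "finite I" and S: "\<And>i. i \<in> I \<Longrightarrow> S i \<in> D" and T: "\<And>i. i \<in> I \<Longrightarrow> T i \<in> D"
    and g: "\<And>i. i \<in> I \<Longrightarrow> g i \<in> homs C (A \<otimes>\<^sub>o S i) (T i)"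
    and inj: "\<And>a. a \<in> FOb F A \<Longrightarrow> (\<And>i s. i \<in> I \<Longrightarrow> s \<in> FOb F (S i) \<Longrightarrow> FArr F (g i) (tens A (S i) a s) = 0)
      \<Longrightarrow> a = 0"
  shows "A \<in> D"
proof -
  have "\<exists>X \<in> D. \<exists>h \<in> homs C A X. \<forall>a \<in> FOb F A. FArr F h a = 0 \<longrightarrow>
      (\<forall>s \<in> FOb F (S i). FArr F (g i) (tens A (S i) a s) = 0)" if i: "i \<in> I" for i
  proof -
    have Si: "S i \<in> Ob C" and Ti: "T i \<in> Ob C" using S T i D_Ob by auto
    obtain S' where S': "is_dual C (S i) S'" using duals Si by blast
    have S'D: "S' \<in> D" and S'Ob: "S' \<in> Ob C" using D_dual S' S i D_Ob by auto
    obtain \<beta> :: "'v \<Rightarrow> 'v \<Rightarrow> 'e" and N :: nat and ys \<xi>s where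
      mem: "\<And>i'. i' < N \<Longrightarrow> ys i' \<in> FOb F (S i)" "\<And>i. i < N \<Longrightarrow> \<xi>s i \<in> FOb F S'"
      and id: "\<And>x. x \<in> FOb F (S i) \<Longrightarrow> (\<Sum>i<N. \<beta> (\<xi>s i) x *\<^sub>v ys i) = x"
      and e: "\<And>A. A \<in> Ob C \<Longrightarrow> \<exists>e \<in> homs C ((A \<otimes>\<^sub>o S') \<otimes>\<^sub>o S i) A. \<forall>a \<in> FOb F A. \<forall>\<xi> \<in> FOb F S'. \<forall>x \<in> FOb F (S i).
      FArr F e (tens (A \<otimes>\<^sub>o S') (S i) (tens A S' a \<xi>) x) = \<beta> \<xi> x *\<^sub>v a"
      and c: "\<And>A. A \<in> Ob C \<Longrightarrow> \<exists>c \<in> homs C A ((A \<otimes>\<^sub>o S i) \<otimes>\<^sub>o S'). \<forall>a \<in> FOb F A.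
      FArr F c a = (\<Sum>i'<N. tens (A \<otimes>\<^sub>o S i) S' (tens A (S i) a (ys i')) (\<xi>s i'))"
      by (rule dual_fibre[OF S']) blast
    obtain e where e: "e \<in> homs C ((T i \<otimes>\<^sub>o S') \<otimes>\<^sub>o S i) (T i)"
      "\<And>a \<xi> x. a \<in> FOb F (T i) \<Longrightarrow> \<xi> \<in> FOb F S' \<Longrightarrow> x \<in> FOb F (S i) \<Longrightarrow>
      FArr F e (tens (T i \<otimes>\<^sub>o S') (S i) (tens (T i) S' a \<xi>) x) = \<beta> \<xi> x *\<^sub>v a"
      using e[OF Ti] by blast
    obtain c where c: "c \<in> homs C A ((A \<otimes>\<^sub>o S i) \<otimes>\<^sub>o S')" "\<And>a. a \<in> FOb F A \<Longrightarrow>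
      FArr F c a = (\<Sum>i'<N. tens (A \<otimes>\<^sub>o S i) S' (tens A (S i) a (ys i')) (\<xi>s i'))"
      using c[OF A] by blast
    have gi: "g i \<in> homs C (A \<otimes>\<^sub>o S i) (T i)" using g i by auto
    let ?h = "g i \<otimes>\<^sub>a Ident C S'"
    have h: "?h \<in> homs C ((A \<otimes>\<^sub>o S i) \<otimes>\<^sub>o S') (T i \<otimes>\<^sub>o S')" by (rule TArr_hom[OF gi Ident_hom[OF S'Ob]])
    have "\<forall>s \<in> FOb F (S i). FArr F (g i) (tens A (S i) a s) = 0"
      if a: "a \<in> FOb F A" and z: "FArr F (?h \<cdot> c) a = 0" for a
    proof
      fix s assume s: "s \<in> FOb F (S i)"
      have at: "tens A (S i) a (ys i') \<in> FOb F (A \<otimes>\<^sub>o S i)" if "i' < N" for i'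
        using tens_mem[OF A Si a] mem that by auto
      have gm: "FArr F (g i) (tens A (S i) a (ys i')) \<in> FOb F (T i)" if "i' < N" for i'
        using FArr_mem[OF gi] at that by auto
      \<comment> \<open>The transposed arrow sends \<open>a\<close> to the sum of the
        \<open>g (a \<otimes> y) \<otimes> \<xi>\<close> over the dual bases; contracting the last
        factor with \<open>s\<close> recovers \<open>g (a \<otimes> s)\<close>.\<close>
      have "0 = (\<Sum>i'<N. tens (T i) S' (FArr F (g i) (tens A (S i) a (ys i'))) (\<xi>s i'))"
        using z FArr_Comp[OF c(1) h a] c(2)[OF a] mem at
        by (simp add: FArr_sum[OF h] tens_mem TOb A Si S'Ob FTensor_natural[OF gi Ident_hom[OF S'Ob]] FArr_Ident[OF S'Ob])
      then have "0 = FArr F e (tens (T i \<otimes>\<^sub>o S') (S i) (\<Sum>i'<N. tens (T i) S' (FArr F (g i) (tens A (S i) a (ys i'))) (\<xi>s i')) s)"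
        using tens_0_left[OF TOb[OF Ti S'Ob] Si s] FArr_0[OF e(1)] by simp
      also have "\<dots> = (\<Sum>i'<N. \<beta> (\<xi>s i') s *\<^sub>v FArr F (g i) (tens A (S i) a (ys i')))"
        using mem gm s by (simp add: tens_sum_left[OF TOb[OF Ti S'Ob] Si] tens_mem[OF Ti S'Ob] FArr_sum[OF e(1)]
            tens_mem[OF TOb[OF Ti S'Ob] Si] e(2))
      also have "\<dots> = FArr F (g i) (tens A (S i) a (\<Sum>i'<N. \<beta> (\<xi>s i') s *\<^sub>v ys i'))"
        using mem at by (simp add: tens_sum_right[OF A Si a] FOb_scale[OF Si] tens_scale_right[OF A Si a]
            FArr_sum[OF gi] FOb_scale[OF TOb[OF A Si]] FArr_scale[OF gi])
      finally show "FArr F (g i) (tens A (S i) a s) = 0" using id[OF s] by simp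
    qed
    then show ?thesis using D_TOb[OF T[OF i] S'D] Comp_hom[OF c(1) h] by blast
  qed
  then obtain X h where "\<And>i. i \<in> I \<Longrightarrow> X i \<in> D" "\<And>i. i \<in> I \<Longrightarrow> h i \<in> homs C A (X i)"
    and hg: "\<And>i a s. i \<in> I \<Longrightarrow> a \<in> FOb F A \<Longrightarrow> FArr F (h i) a = 0 \<Longrightarrow> s \<in> FOb F (S i) \<Longrightarrow>
      FArr F (g i) (tens A (S i) a s) = 0"
    by metis
  then show ?thesis by (intro D_joint_subobject[OF A I, of X h]) (auto intro: inj)
qed

lemma D_action:
  assumes A: "A \<in> Ob C" and S: "S \<in> D" and T: "T \<in> D" and g: "g \<in> homs C (A \<otimes>\<^sub>o S) T"
    and inj: "\<And>a. a \<in> FOb F A \<Longrightarrow> (\<And>s. s \<in> FOb F S \<Longrightarrow> FArr F g (tens A S a s) = 0) \<Longrightarrow> a = 0"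
  shows "A \<in> D"
  using D_joint_action[OF A, of "{()}" "\<lambda>_. S" "\<lambda>_. T" "\<lambda>_. g"] assms by auto

text \<open>The identity of \<open>A \<otimes> S\<close> counts as an action of \<open>A\<close>,
  faithful because tensoring with a nonzero vector is injective. Later this subtracts exponents of
  tensor powers.\<close>

lemma D_cancel:
  assumes A: "A \<in> Ob C" and S: "S \<in> D" "\<not> is_zero_object C S" and AS: "A \<otimes>\<^sub>o S \<in> D"
  shows "A \<in> D"
proof -
  have SO: "S \<in> Ob C" by (rule D_Ob[OF S(1)])
  obtain s where s: "s \<in> FOb F S" "s \<noteq> 0" using S(2) zero_object_iff[OF SO] FOb_0[OF SO] by blast
  show ?thesis
  proof (rule D_action[OF A S(1) AS Ident_hom[OF TOb[OF A SO]]])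
    fix a assume a: "a \<in> FOb F A" and "\<And>s. s \<in> FOb F S \<Longrightarrow> FArr F (Ident C (A \<otimes>\<^sub>o S)) (tens A S a s) = 0"
    then have "tens A S a s = 0" using s FArr_Ident[OF TOb[OF A SO] tens_mem[OF A SO a s(1)]] by simp
    then show "a = 0" using tens_nonzero[OF A SO a s(1)] s(2) by blast
  qed
qed

end

section \<open>Endomorphisms acting on tensor products\<close>

context neutral_tannakian_category
begin

text \<open>\<open>L X\<close> is the endomorphism of the fibre of \<open>V\<close> that corresponds to \<open>X\<close> under
  \<open>V \<otimes> V\<^sup>\<or> = End V\<close>.\<close>

lemma endomorphism_action:
  assumes "is_dual C V V'"
  obtains L where "\<And>X. X \<in> FOb F (V \<otimes>\<^sub>o V') \<Longrightarrow> linear_on (FScale F) (FOb F V) (FOb F V) (L X)"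
    and "\<And>X. X \<in> FOb F (V \<otimes>\<^sub>o V') \<Longrightarrow> (\<And>v. v \<in> FOb F V \<Longrightarrow> L X v = 0) \<Longrightarrow> X = 0"
    and "\<And>W. W \<in> Ob C \<Longrightarrow> \<exists>g \<in> homs C ((V \<otimes>\<^sub>o V') \<otimes>\<^sub>o (V \<otimes>\<^sub>o W)) (V \<otimes>\<^sub>o W).
      \<forall>X \<in> FOb F (V \<otimes>\<^sub>o V'). \<forall>v \<in> FOb F V. \<forall>w \<in> FOb F W.
      FArr F g (tens (V \<otimes>\<^sub>o V') (V \<otimes>\<^sub>o W) X (tens V W v w)) = tens V W (L X v) w"
    and "\<And>W. W \<in> Ob C \<Longrightarrow> \<exists>g \<in> homs C ((V \<otimes>\<^sub>o V') \<otimes>\<^sub>o (W \<otimes>\<^sub>o V)) (W \<otimes>\<^sub>o V).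
      \<forall>X \<in> FOb F (V \<otimes>\<^sub>o V'). \<forall>v \<in> FOb F V. \<forall>w \<in> FOb F W.
      FArr F g (tens (V \<otimes>\<^sub>o V') (W \<otimes>\<^sub>o V) X (tens W V w v)) = tens W V w (L X v)"
proof -
  have V: "V \<in> Ob C" and V': "V' \<in> Ob C" using assms by (auto simp: is_dual_def)
  define Q where "Q = V \<otimes>\<^sub>o V'"
  have Q: "Q \<in> Ob C" unfolding Q_def by (rule TOb[OF V V'])
  obtain \<beta> :: "'v \<Rightarrow> 'v \<Rightarrow> 'e" and N :: nat and ys \<xi>s where
    mem: "\<And>i. i < N \<Longrightarrow> ys i \<in> FOb F V" "\<And>i. i < N \<Longrightarrow> \<xi>s i \<in> FOb F V'"
    and id: "\<And>\<xi>. \<xi> \<in> FOb F V' \<Longrightarrow> (\<Sum>i<N. \<beta> \<xi> (ys i) *\<^sub>v \<xi>s i) = \<xi>"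
    and e: "\<And>A. A \<in> Ob C \<Longrightarrow> \<exists>e \<in> homs C ((A \<otimes>\<^sub>o V') \<otimes>\<^sub>o V) A. \<forall>a \<in> FOb F A. \<forall>\<xi> \<in> FOb F V'. \<forall>x \<in> FOb F V.
      FArr F e (tens (A \<otimes>\<^sub>o V') V (tens A V' a \<xi>) x) = \<beta> \<xi> x *\<^sub>v a"
    by (rule dual_fibre[OF assms]) blast
  obtain e where e: "e \<in> homs C (Q \<otimes>\<^sub>o V) V" "\<And>a \<xi> x. a \<in> FOb F V \<Longrightarrow> \<xi> \<in> FOb F V' \<Longrightarrow> x \<in> FOb F V \<Longrightarrow>
      FArr F e (tens Q V (tens V V' a \<xi>) x) = \<beta> \<xi> x *\<^sub>v a"
    using e[OF V] unfolding Q_def by blast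
  define L where "L X v = FArr F e (tens Q V X v)" for X v
  have Lm: "L X v \<in> FOb F V" if "X \<in> FOb F Q" "v \<in> FOb F V" for X v
    unfolding L_def using FArr_mem[OF e(1) tens_mem[OF Q V that]] .
  have L: "linear_on (FScale F) (FOb F V) (FOb F V) (L X)" if X: "X \<in> FOb F Q" for X
    unfolding linear_on_def L_def
    using X V Q FArr_mem[OF e(1)]
    by (auto simp: tens_plus_right tens_scale_right FArr_plus[OF e(1)] FArr_scale[OF e(1)] tens_mem)
  \<comment> \<open>\<open>X\<close> is recovered from the values of its endomorphism on the dual
    basis, which is why \<open>L\<close> is injective.\<close>
  have rec: "(\<Sum>i<N. tens V V' (L X (ys i)) (\<xi>s i)) = X" if X: "X \<in> FOb F Q" for X
    using V V' X[unfolded Q_def]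
  proof (induction rule: tens_induct)
    case (tens x \<xi>)
    have "(\<Sum>i<N. tens V V' (L (tens V V' x \<xi>) (ys i)) (\<xi>s i)) = (\<Sum>i<N. tens V V' x (\<beta> \<xi> (ys i) *\<^sub>v \<xi>s i))"
      using mem tens by (simp add: L_def e(2) tens_scale_left[OF V V'] tens_scale_right[OF V V'])
    also have "\<dots> = tens V V' x (\<Sum>i<N. \<beta> \<xi> (ys i) *\<^sub>v \<xi>s i)"
      using mem by (simp add: tens_sum_right[OF V V' tens(1)] FOb_scale[OF V'])
    finally show ?case using id[OF tens(2)] by simp
  next
    case zero
    have "L 0 v = 0" if "v \<in> FOb F V" for v
      unfolding L_def using tens_0_left[OF Q V that] FArr_0[OF e(1)] by simp
    then show ?case using mem by (simp add: tens_0_left[OF V V'])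
  next
    case (add z z')
    have zz: "z \<in> FOb F Q" "z' \<in> FOb F Q" using add by (auto simp: Q_def)
    have "L (z + z') v = L z v + L z' v" if "v \<in> FOb F V" for v
      unfolding L_def using zz that by (simp add: tens_plus_left[OF Q V] FArr_plus[OF e(1)] tens_mem[OF Q V])
    then show ?case using mem add(3,4) Lm zz by (simp add: tens_plus_left[OF V V'] sum.distrib)
  qed
  have inj: "X = 0" if X: "X \<in> FOb F Q" and z: "\<And>v. v \<in> FOb F V \<Longrightarrow> L X v = 0" for X
    using rec[OF X] mem z by (simp add: tens_0_left[OF V V'])
  have left: "\<exists>g \<in> homs C (Q \<otimes>\<^sub>o (V \<otimes>\<^sub>o W)) (V \<otimes>\<^sub>o W).
      \<forall>X \<in> FOb F Q. \<forall>v \<in> FOb F V. \<forall>w \<in> FOb F W.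
      FArr F g (tens Q (V \<otimes>\<^sub>o W) X (tens V W v w)) = tens V W (L X v) w" if W: "W \<in> Ob C" for W
  proof -
    note h1 = inv_arr_Assoc(1)[OF Q V W] and h2 = TArr_hom[OF e(1) Ident_hom[OF W]]
    show ?thesis
    proof (intro bexI[OF _ Comp_hom[OF h1 h2]] ballI)
      fix X v w assume "X \<in> FOb F Q" "v \<in> FOb F V" "w \<in> FOb F W"
      then show "FArr F ((e \<otimes>\<^sub>a Ident C W) \<cdot> inv_arr C (Assoc C Q V W)) (tens Q (V \<otimes>\<^sub>o W) X (tens V W v w)) =
          tens V W (L X v) w"
        using Q V W by (simp add: FArr_Comp[OF h1 h2] tens_mem TOb inv_arr_Assoc(2)
            FTensor_natural[OF e(1) Ident_hom[OF W]] FArr_Ident L_def)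
    qed
  qed
  \<comment> \<open>This side matches \<open>tensor_power\<close>, which appends factors on the
    right: the endomorphism acts on the last factor.\<close>
  have right: "\<exists>g \<in> homs C (Q \<otimes>\<^sub>o (W \<otimes>\<^sub>o V)) (W \<otimes>\<^sub>o V).
      \<forall>X \<in> FOb F Q. \<forall>v \<in> FOb F V. \<forall>w \<in> FOb F W.
      FArr F g (tens Q (W \<otimes>\<^sub>o V) X (tens W V w v)) = tens W V w (L X v)" if W: "W \<in> Ob C" for W
  proof -
    obtain g where g: "g \<in> homs C (Q \<otimes>\<^sub>o (V \<otimes>\<^sub>o W)) (V \<otimes>\<^sub>o W)"
      "\<And>X v w. X \<in> FOb F Q \<Longrightarrow> v \<in> FOb F V \<Longrightarrow> w \<in> FOb F W \<Longrightarrow>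
      FArr F g (tens Q (V \<otimes>\<^sub>o W) X (tens V W v w)) = tens V W (L X v) w" using left[OF W] by blast
    note h1 = TArr_hom[OF Ident_hom[OF Q] Braid_hom[OF W V]] and h3 = Braid_hom[OF V W]
    show ?thesis
    proof (intro bexI[OF _ Comp_hom[OF Comp_hom[OF h1 g(1)] h3]] ballI)
      fix X v w assume "X \<in> FOb F Q" "v \<in> FOb F V" "w \<in> FOb F W"
      then show "FArr F (Braid C V W \<cdot> g \<cdot> (Ident C Q \<otimes>\<^sub>a Braid C W V)) (tens Q (W \<otimes>\<^sub>o V) X (tens W V w v)) =
          tens W V w (L X v)"
        using Q V W Lm by (simp add: FArr_Comp[OF Comp_hom[OF h1 g(1)] h3] FArr_Comp[OF h1 g(1)] tens_mem TOb
            FTensor_natural[OF Ident_hom[OF Q] Braid_hom[OF W V]] FArr_Ident FTensor_Braid g(2))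
    qed
  qed
  show thesis using that[of L] L inj left right unfolding Q_def by blast
qed

section \<open>Nonzero objects and tensor powers\<close>

lemma nonzero_TOb:
  assumes "A \<in> Ob C" "B \<in> Ob C" "\<not> is_zero_object C A" "\<not> is_zero_object C B"
  shows "\<not> is_zero_object C (A \<otimes>\<^sub>o B)"
  using assms tens_nonzero[OF assms(1,2)] tens_mem[OF assms(1,2)] FOb_0
  unfolding zero_object_iff[OF assms(1)] zero_object_iff[OF assms(2)] zero_object_iff[OF TOb[OF assms(1,2)]]
  by blast

lemma nonzero_Unit: "\<not> is_zero_object C (Unit C)"
  unfolding zero_object_iff[OF Unit] using FUnit_mem FUnit_nonzero by blast

lemma tensor_power_Ob: "V \<in> Ob C \<Longrightarrow> tensor_power C V k \<in> Ob C"
  by (induction k) (auto simp: Unit TOb)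

lemma tensor_power_nonzero: "V \<in> Ob C \<Longrightarrow> \<not> is_zero_object C V \<Longrightarrow> \<not> is_zero_object C (tensor_power C V k)"
  by (induction k) (auto simp: nonzero_Unit nonzero_TOb tensor_power_Ob)

lemma tensor_power_add:
  assumes V: "V \<in> Ob C"
  shows "isomorphic C (tensor_power C V k \<otimes>\<^sub>o tensor_power C V l) (tensor_power C V (k + l))"
proof (induction l)
  case 0
  show ?case by (simp add: isomorphic_RUnit tensor_power_Ob[OF V])
next
  case (Suc l)
  note P = tensor_power_Ob[OF V]
  have "isomorphic C (tensor_power C V k \<otimes>\<^sub>o tensor_power C V (Suc l))
      ((tensor_power C V k \<otimes>\<^sub>o tensor_power C V l) \<otimes>\<^sub>o V)"
    by (simp add: isomorphic_sym[OF isomorphic_Assoc] P V)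
  also have "isomorphic C \<dots> (tensor_power C V (k + l) \<otimes>\<^sub>o V)"
    by (rule isomorphic_TOb[OF Suc isomorphic_refl[OF V]])
  finally show ?case by simp
qed

end

section \<open>Objects whose tensor product with some nonzero object lies in
  \<open>D\<close>\<close>

context tannakian_pair
begin

lemma End_in_D_of_tensors_into:
  assumes V: "tensors_into C D V" and V': "is_dual C V V'"
  shows "V \<otimes>\<^sub>o V' \<in> D"
proof -
  obtain W where W: "W \<in> Ob C" "\<not> is_zero_object C W" "V \<otimes>\<^sub>o W \<in> D" using V by (auto simp: tensors_into_def)
  obtain w where w: "w \<in> FOb F W" "w \<noteq> 0" using W zero_object_iff[OF W(1)] FOb_0[OF W(1)] by blast
  have VO: "V \<in> Ob C" "V' \<in> Ob C" using V' by (auto simp: is_dual_def)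
  obtain L where L: "\<And>X. X \<in> FOb F (V \<otimes>\<^sub>o V') \<Longrightarrow> linear_on (FScale F) (FOb F V) (FOb F V) (L X)"
    and inj: "\<And>X. X \<in> FOb F (V \<otimes>\<^sub>o V') \<Longrightarrow> (\<And>v. v \<in> FOb F V \<Longrightarrow> L X v = 0) \<Longrightarrow> X = 0"
    and act: "\<And>W. W \<in> Ob C \<Longrightarrow> \<exists>g \<in> homs C ((V \<otimes>\<^sub>o V') \<otimes>\<^sub>o (V \<otimes>\<^sub>o W)) (V \<otimes>\<^sub>o W).
      \<forall>X \<in> FOb F (V \<otimes>\<^sub>o V'). \<forall>v \<in> FOb F V. \<forall>w \<in> FOb F W.
      FArr F g (tens (V \<otimes>\<^sub>o V') (V \<otimes>\<^sub>o W) X (tens V W v w)) = tens V W (L X v) w"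
    by (rule endomorphism_action[OF V']) blast
  obtain g where g: "g \<in> homs C ((V \<otimes>\<^sub>o V') \<otimes>\<^sub>o (V \<otimes>\<^sub>o W)) (V \<otimes>\<^sub>o W)"
    and act: "\<And>X v w. X \<in> FOb F (V \<otimes>\<^sub>o V') \<Longrightarrow> v \<in> FOb F V \<Longrightarrow> w \<in> FOb F W \<Longrightarrow>
      FArr F g (tens (V \<otimes>\<^sub>o V') (V \<otimes>\<^sub>o W) X (tens V W v w)) = tens V W (L X v) w"
    using act[OF W(1)] by blast
  show ?thesis
  proof (rule D_action[OF TOb[OF VO] W(3,3) g])
    fix X assume X: "X \<in> FOb F (V \<otimes>\<^sub>o V')"
      and 0: "\<And>s. s \<in> FOb F (V \<otimes>\<^sub>o W) \<Longrightarrow> FArr F g (tens (V \<otimes>\<^sub>o V') (V \<otimes>\<^sub>o W) X s) = 0"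
    have "L X v = 0" if v: "v \<in> FOb F V" for v
    proof (rule ccontr)
      assume "L X v \<noteq> 0"
      moreover have "L X v \<in> FOb F V" using L[OF X] v by (auto simp: linear_on_def)
      ultimately show False
        using tens_nonzero[OF VO(1) W(1) _ w(1) _ w(2)] act[OF X v w(1)] 0[OF tens_mem[OF VO(1) W(1) v w(1)]] by simp
    qed
    then show "X = 0" by (rule inj[OF X])
  qed
qed

lemma tensors_into_TOb:
  assumes A: "A \<in> Ob C" "tensors_into C D A" and B: "B \<in> Ob C" "tensors_into C D B"
  shows "tensors_into C D (A \<otimes>\<^sub>o B)"
proof -
  obtain W where W: "W \<in> Ob C" "\<not> is_zero_object C W" "A \<otimes>\<^sub>o W \<in> D" using A by (auto simp: tensors_into_def)
  obtain W' where W': "W' \<in> Ob C" "\<not> is_zero_object C W'" "B \<otimes>\<^sub>o W' \<in> D" using B by (auto simp: tensors_into_def)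
  have "(A \<otimes>\<^sub>o B) \<otimes>\<^sub>o (W \<otimes>\<^sub>o W') \<in> D"
    using D_isomorphic[OF D_TOb[OF W(3) W'(3)] isomorphic_interchange[OF A(1) B(1) W(1) W'(1)]] .
  then show ?thesis using nonzero_TOb[OF W(1) W'(1) W(2) W'(2)] TOb[OF W(1) W'(1)]
    by (auto simp: tensors_into_def)
qed

lemma tensors_into_tensor_power:
  assumes "V \<in> Ob C" "tensors_into C D V" shows "tensors_into C D (tensor_power C V k)"
proof (induction k)
  case 0
  show ?case using Unit nonzero_Unit D_TOb[OF D_Unit D_Unit] by (auto simp: tensors_into_def)
next
  case (Suc k)
  then show ?case using tensors_into_TOb tensor_power_Ob assms by simp
qed

text \<open>This uses the irreducibility of \<open>X\<close> under \<open>End X = X \<otimes> X\<^sup>\<or>\<close>.\<close>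

lemma D_of_nonzero_arrow:
  assumes X: "X \<in> Ob C" "tensors_into C D X" and S: "S \<in> D" and f: "f \<in> homs C S X"
    and s: "s \<in> FOb F S" "FArr F f s \<noteq> 0"
  shows "X \<in> D"
proof -
  obtain X' where X': "is_dual C X X'" using duals X by blast
  have X'O: "X' \<in> Ob C" and SO: "S \<in> Ob C" using X' D_Ob[OF S] by (auto simp: is_dual_def)
  have XD: "X \<otimes>\<^sub>o X' \<in> D" by (rule End_in_D_of_tensors_into[OF X(2) X'])
  let ?Q = "X \<otimes>\<^sub>o X'"
  have Q: "?Q \<in> Ob C" by (rule TOb[OF X(1) X'O])
  obtain \<beta> :: "'v \<Rightarrow> 'v \<Rightarrow> 'e" and N :: nat and ys \<xi>s where
    mem: "\<And>i. i < N \<Longrightarrow> \<xi>s i \<in> FOb F X'"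
    and id: "\<And>x. x \<in> FOb F X \<Longrightarrow> (\<Sum>i<N. \<beta> (\<xi>s i) x *\<^sub>v ys i) = x"
    and e: "\<And>A. A \<in> Ob C \<Longrightarrow> \<exists>e \<in> homs C ((A \<otimes>\<^sub>o X') \<otimes>\<^sub>o X) A. \<forall>a \<in> FOb F A. \<forall>\<xi> \<in> FOb F X'. \<forall>x \<in> FOb F X.
      FArr F e (tens (A \<otimes>\<^sub>o X') X (tens A X' a \<xi>) x) = \<beta> \<xi> x *\<^sub>v a"
    by (rule dual_fibre[OF X']) blast
  obtain e where e: "e \<in> homs C (?Q \<otimes>\<^sub>o X) X" "\<And>a \<xi> x. a \<in> FOb F X \<Longrightarrow> \<xi> \<in> FOb F X' \<Longrightarrow> x \<in> FOb F X \<Longrightarrow>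
      FArr F e (tens ?Q X (tens X X' a \<xi>) x) = \<beta> \<xi> x *\<^sub>v a"
    using e[OF X(1)] by blast
  have fs: "FArr F f s \<in> FOb F X" by (rule FArr_mem[OF f s(1)])
  \<comment> \<open>If all these functionals vanished on \<open>FArr F f s\<close>, the expansion in
    dual bases would make that vector zero.\<close>
  obtain i where i: "i < N" "\<beta> (\<xi>s i) (FArr F f s) \<noteq> 0"
  proof (rule ccontr)
    assume "\<not> thesis"
    then have "\<forall>i<N. \<beta> (\<xi>s i) (FArr F f s) = 0" using that by blast
    then show False using id[OF fs] s(2) by simp
  qed
  note h = TArr_hom[OF Ident_hom[OF Q] f]
  show ?thesis
  proof (rule D_quotient[OF D_TOb[OF XD S] Comp_hom[OF h e(1)]], rule subsetI)
    fix x assume x: "x \<in> FOb F X"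
    \<comment> \<open>With this scalar the rank one endomorphism \<open>x \<otimes> \<xi>\<close>
      sends \<open>FArr F f s\<close> to the prescribed vector \<open>x\<close>. So
      \<open>End X\<close> applied to one nonzero vector already fills the fibre of
      \<open>X\<close>.\<close>
    let ?c = "inverse (\<beta> (\<xi>s i) (FArr F f s))"
    have cx: "?c *\<^sub>v x \<in> FOb F X" by (rule FOb_scale[OF X(1) x])
    have t: "tens X X' (?c *\<^sub>v x) (\<xi>s i) \<in> FOb F ?Q" by (rule tens_mem[OF X(1) X'O cx mem[OF i(1)]])
    have "FArr F (e \<cdot> (Ident C ?Q \<otimes>\<^sub>a f)) (tens ?Q S (tens X X' (?c *\<^sub>v x) (\<xi>s i)) s) = x"
      using i FArr_Comp[OF h e(1) tens_mem[OF Q SO t s(1)]]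
        FTensor_natural[OF Ident_hom[OF Q] f t s(1)] FArr_Ident[OF Q t] e(2)[OF cx mem[OF i(1)] fs] by simp
    then show "x \<in> FArr F (e \<cdot> (Ident C ?Q \<otimes>\<^sub>a f)) ` FOb F (?Q \<otimes>\<^sub>o S)"
      using tens_mem[OF Q SO t s(1)] by (metis imageI)
  qed
qed

lemma tensor_power_gcd_in_D:
  assumes V: "V \<in> Ob C" "\<not> is_zero_object C V" and k: "tensor_power C V k \<in> D" and n: "tensor_power C V n \<in> D"
    and m: "gcd k n dvd m" and "0 < k"
  shows "tensor_power C V m \<in> D"
proof -
  have add: "tensor_power C V (i + j) \<in> D" if "tensor_power C V i \<in> D" "tensor_power C V j \<in> D" for i j
    using D_isomorphic[OF D_TOb[OF that] tensor_power_add[OF V(1)]] .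
  have mult: "tensor_power C V (i * j) \<in> D" if "tensor_power C V i \<in> D" for i j
    by (induction j) (use D_Unit add that in \<open>auto simp del: tensor_power.simps(2)\<close>)
  \<comment> \<open>Bezout within the natural numbers: after multiplication by \<open>q\<close>, the
    exponent \<open>m\<close> is what remains of \<open>k * (x * q)\<close> when
    \<open>n * (y * q)\<close> is cancelled.\<close>
  obtain x y where xy: "k * x = n * y + gcd k n" using bezout_nat[of k n] \<open>0 < k\<close> by blast
  obtain q where q: "m = gcd k n * q" using m by auto
  have eq: "m + n * (y * q) = k * (x * q)"
    using arg_cong[OF xy, of "\<lambda>z. z * q"] q by (simp add: algebra_simps)
  show ?thesis
  proof (rule D_cancel[OF tensor_power_Ob[OF V(1)] mult[OF n, of "y * q"] tensor_power_nonzero[OF V]])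
    have "tensor_power C V (m + n * (y * q)) \<in> D" unfolding eq by (rule mult[OF k])
    then show "tensor_power C V m \<otimes>\<^sub>o tensor_power C V (n * (y * q)) \<in> D"
      using D_isomorphic isomorphic_sym[OF tensor_power_add[OF V(1)]] by blast
  qed
qed

end

section \<open>Permutations of tensor powers\<close>

lemma swaps_perm_Nil: "swaps_perm [] = id"
  and swaps_perm_Cons: "swaps_perm (i # w) = Transposition.transpose i (Suc i) \<circ> swaps_perm w"
  by (simp_all add: swaps_perm_def)

lemma swaps_perm_append: "swaps_perm (w @ w') = swaps_perm w \<circ> swaps_perm w'"
  by (induction w) (simp_all add: swaps_perm_Nil swaps_perm_Cons comp_assoc)

lemma swaps_perm_permutes: "\<forall>i \<in> set w. Suc i < k \<Longrightarrow> swaps_perm w permutes {..<k}"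
proof (induction w)
  case Nil
  show "swaps_perm [] permutes {..<k}" by (simp add: swaps_perm_Nil permutes_id)
next
  case (Cons i w)
  then have "swaps_perm w permutes {..<k}" "Transposition.transpose i (Suc i) permutes {..<k}"
    by (auto intro: permutes_swap_id)
  then show "swaps_perm (i # w) permutes {..<k}" unfolding swaps_perm_Cons by (rule permutes_compose)
qed

text \<open>Induction on \<open>k\<close>: adjacent swaps carry the last letter to its image under
  \<open>\<sigma>\<close>, and the remaining factor of \<open>\<sigma>\<close> fixes that letter.
  This makes the choice in \<open>perm_arrow\<close> meaningful.\<close>

lemma ex_swaps_perm:
  assumes "\<sigma> permutes {..<k}"
  shows "\<exists>w. (\<forall>i \<in> set w. Suc i < k) \<and> swaps_perm w = \<sigma>"
  using assms
proof (induction k arbitrary: \<sigma>)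
  case 0
  then show ?case by (auto intro: exI[of _ "[]"] simp: swaps_perm_Nil)
next
  case (Suc k)
  have "\<exists>w. (\<forall>i \<in> set w. Suc i < Suc k) \<and> swaps_perm w k = j" if "j \<le> k" for j
    using that
  proof (induction j rule: inc_induct)
    case base
    show ?case by (auto intro: exI[of _ "[]"] simp: swaps_perm_Nil)
  next
    case (step j)
    then obtain w where "\<forall>i \<in> set w. Suc i < Suc k" "swaps_perm w k = Suc j" by blast
    then show ?case using step by (intro exI[of _ "j # w"]) (auto simp: swaps_perm_Cons)
  qed
  moreover have "\<sigma> k \<le> k" using permutes_in_image[OF Suc.prems, of k] by simp
  ultimately obtain w where w: "\<forall>i \<in> set w. Suc i < Suc k" "swaps_perm w k = \<sigma> k" by blast
  have p: "swaps_perm w permutes {..<Suc k}" using swaps_perm_permutes w(1) by blast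
  let ?\<tau> = "inv (swaps_perm w) \<circ> \<sigma>"
  have "?\<tau> permutes {..<k}"
  proof (rule permutes_superset)
    show "?\<tau> permutes {..<Suc k}" using permutes_compose[OF Suc.prems permutes_inv[OF p]] .
    have "inv (swaps_perm w) (\<sigma> k) = k" using w(2) permutes_inverses(2)[OF p, of k] by simp
    moreover have "x = k" if "x \<in> {..<Suc k} - {..<k}" for x using that by auto
    ultimately show "?\<tau> x = x" if "x \<in> {..<Suc k} - {..<k}" for x using that by fastforce
  qed
  then obtain w' where w': "\<forall>i \<in> set w'. Suc i < k" "swaps_perm w' = ?\<tau>" using Suc.IH by blast
  have "swaps_perm (w @ w') = \<sigma>"
    using w'(2) permutes_inv_o(1)[OF p] by (simp add: swaps_perm_append comp_assoc[symmetric])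
  then show ?case using w w' by (intro exI[of _ "w @ w'"]) auto
qed

section \<open>Pure tensors and the permutation of their factors\<close>

context neutral_tannakian_category
begin

text \<open>The decomposable tensor
  \<open>1 \<otimes> f 0 \<otimes> ... \<otimes> f (k - 1)\<close>, bracketed to the left like
  \<open>tensor_power\<close>.\<close>

primrec pure :: "'o \<Rightarrow> nat \<Rightarrow> (nat \<Rightarrow> 'v) \<Rightarrow> 'v" where
  "pure V 0 f = FUnit F"
| "pure V (Suc k) f = tens (tensor_power C V k) V (pure V k f) (f k)"

lemma pure_cong: "(\<And>i. i < k \<Longrightarrow> f i = g i) \<Longrightarrow> pure V k f = pure V k g"
  by (induction k) auto

context
  fixes V assumes V: "V \<in> Ob C"
begin

lemma pure_mem: "(\<And>i. i < k \<Longrightarrow> f i \<in> FOb F V) \<Longrightarrow> pure V k f \<in> FOb F (tensor_power C V k)"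
  by (induction k) (auto simp: FUnit_mem tens_mem[OF tensor_power_Ob[OF V] V])

text \<open>Here the factors come from a spanning set, which need not be closed under scaling.
  Unlike in \<open>tens_induct\<close>, a scalar cannot be absorbed and has its own case.\<close>

lemma pure_span_induct:
  assumes \<B>: "V.span \<B> = FOb F V"
    and "z \<in> FOb F (tensor_power C V k)"
    and "\<And>f :: nat \<Rightarrow> 'v. (\<And>i. i < k \<Longrightarrow> f i \<in> \<B>) \<Longrightarrow> P (pure V k f)" and "P 0"
    and "\<And>c z. z \<in> FOb F (tensor_power C V k) \<Longrightarrow> P z \<Longrightarrow> P (c *\<^sub>v z)"
    and "\<And>z z'. z \<in> FOb F (tensor_power C V k) \<Longrightarrow> z' \<in> FOb F (tensor_power C V k) \<Longrightarrow> P z \<Longrightarrow> P z' \<Longrightarrow> P (z + z')"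
  shows "P z"
  using assms(2-)
proof (induction k arbitrary: z P)
  case 0
  obtain c where c: "z = c *\<^sub>v FUnit F" using Unit_scalar 0 by auto
  have "P (pure V 0 (\<lambda>_. 0))" by (rule 0(2)) simp
  then have "P (c *\<^sub>v FUnit F)" using 0(4)[of "FUnit F" c] FUnit_mem by simp
  then show ?case using c by simp
next
  case (Suc k)
  let ?T = "tensor_power C V k"
  note T = tensor_power_Ob[OF V, of k]
  have P: "P (tens ?T V x y)" if x: "x \<in> FOb F ?T" and y: "y \<in> \<B>" for x y
  proof (rule Suc.IH[OF x, where P = "\<lambda>x. P (tens ?T V x y)"])
    fix f :: "nat \<Rightarrow> 'v" assume f: "\<And>i. i < k \<Longrightarrow> f i \<in> \<B>"
    \<comment> \<open>The last factor \<open>y\<close> becomes the value at the new index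
      \<open>k\<close>, so that the product is again a pure tensor.\<close>
    define g where "g = f(k := y)"
    have "pure V k g = pure V k f" by (rule pure_cong) (simp add: g_def)
    moreover have "g k = y" "\<And>i. i < Suc k \<Longrightarrow> g i \<in> \<B>" using f y by (auto simp: g_def less_Suc_eq)
    ultimately show "P (tens ?T V (pure V k f) y)" using Suc.prems(2)[of g] by simp
  next
    have yV: "y \<in> FOb F V" using y \<B> V.span_base by blast
    show "P (tens ?T V 0 y)" using Suc.prems(3) tens_0_left[OF T V yV] by simp
    fix c z assume "z \<in> FOb F ?T" "P (tens ?T V z y)"
    then show "P (tens ?T V (c *\<^sub>v z) y)"
      using Suc.prems(4)[of "tens ?T V z y" c] yV by (simp add: tens_scale_left[OF T V] tens_mem[OF T V])
  next
    have yV: "y \<in> FOb F V" using y \<B> V.span_base by blast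
    fix z z' assume "z \<in> FOb F ?T" "P (tens ?T V z y)" "z' \<in> FOb F ?T" "P (tens ?T V z' y)"
    then show "P (tens ?T V (z + z') y)"
      using Suc.prems(5)[of "tens ?T V z y" "tens ?T V z' y"] yV by (simp add: tens_plus_left[OF T V] tens_mem[OF T V])
  qed
  have z: "z \<in> FOb F (?T \<otimes>\<^sub>o V)" using Suc.prems by simp
  show "P z"
    using T V z
  proof (induction rule: tens_induct)
    case (tens x y)
    have "y \<in> V.span \<B>" using tens(2) \<B> by simp
    then have "y \<in> FOb F V \<and> P (tens ?T V x y)"
    proof (induction rule: V.span_induct_alt)
      case base
      show "0 \<in> FOb F V \<and> P (tens ?T V x 0)" using FOb_0[OF V] Suc.prems(3) tens_0_right[OF T V tens(1)] by simp
    next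
      case (step c b y)
      have b: "b \<in> FOb F V" using step(1) \<B> V.span_base by blast
      have m: "c *\<^sub>v b \<in> FOb F V" "y \<in> FOb F V" using FOb_scale[OF V b] step by auto
      have "P (c *\<^sub>v tens ?T V x b)"
        using Suc.prems(4)[of "tens ?T V x b" c] P[OF tens(1) step(1)] tens_mem[OF T V tens(1) b] by simp
      then have "P (c *\<^sub>v tens ?T V x b + tens ?T V x y)"
        using Suc.prems(5)[of "c *\<^sub>v tens ?T V x b" "tens ?T V x y"] step(2) tens_mem[OF T V tens(1)] b m
          FOb_scale[OF TOb[OF T V]] by simp
      then show "c *\<^sub>v b + y \<in> FOb F V \<and> P (tens ?T V x (c *\<^sub>v b + y))"
        using tens_plus_right[OF T V tens(1) m] tens_scale_right[OF T V tens(1) b] FOb_plus[OF V m] by simp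
    qed
    then show ?case by simp
  next
    case zero
    then show ?case using Suc.prems by simp
  next
    case (add z z')
    then show ?case using Suc.prems by simp
  qed
qed

lemma pure_induct [consumes 1, case_names pure zero scale add]:
  assumes z: "z \<in> FOb F (tensor_power C V k)"
    and pure: "\<And>f :: nat \<Rightarrow> 'v. (\<And>i. f i \<in> FOb F V) \<Longrightarrow> P (pure V k f)" and "P 0"
    and "\<And>c z. z \<in> FOb F (tensor_power C V k) \<Longrightarrow> P z \<Longrightarrow> P (c *\<^sub>v z)"
    and "\<And>z z'. z \<in> FOb F (tensor_power C V k) \<Longrightarrow> z' \<in> FOb F (tensor_power C V k) \<Longrightarrow> P z \<Longrightarrow> P z' \<Longrightarrow> P (z + z')"
  shows "P z"
proof (rule pure_span_induct[of "FOb F V", OF _ z])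
  show "V.span (FOb F V) = FOb F V" using V.span_eq_iff FOb_subspace[OF V] by blast
  fix f :: "nat \<Rightarrow> 'v" assume f: "\<And>i. i < k \<Longrightarrow> f i \<in> FOb F V"
  define g where "g i = (if i < k then f i else 0)" for i
  have "pure V k f = pure V k g" by (rule pure_cong) (simp add: g_def)
  moreover have "P (pure V k g)" by (rule pure) (simp add: g_def f FOb_0[OF V])
  ultimately show "P (pure V k f)" by simp
qed (use assms in blast)+

lemma adjacent_swap_hom: "adjacent_swap C V k i \<in> homs C (tensor_power C V k) (tensor_power C V k)"
proof (induction k)
  case 0
  then show ?case by (simp add: Ident_hom Unit)
next
  case (Suc k)
  note T = tensor_power_Ob[OF V]
  show ?case
  proof (cases "Suc i = k")
    case True
    have "inv_arr C (Assoc C (tensor_power C V i) V V) \<cdot>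
       (Ident C (tensor_power C V i) \<otimes>\<^sub>a Braid C V V) \<cdot>
       Assoc C (tensor_power C V i) V V \<in> homs C ((tensor_power C V i \<otimes>\<^sub>o V) \<otimes>\<^sub>o V) ((tensor_power C V i \<otimes>\<^sub>o V) \<otimes>\<^sub>o V)"
      by (rule Comp_hom[OF Comp_hom[OF Assoc_hom[OF T V V] TArr_hom[OF Ident_hom[OF T] Braid_hom[OF V V]]]
            inv_arr_Assoc(1)[OF T V V]])
    then show ?thesis using True by auto
  next
    case False
    then show ?thesis using Suc TArr_hom[OF Suc Ident_hom[OF V]] Ident_hom[OF T[of "Suc k"]] by auto
  qed
qed

lemma adjacent_swap_pure:
  assumes "Suc i < k" and "\<And>j. j < k \<Longrightarrow> f j \<in> FOb F V"
  shows "FArr F (adjacent_swap C V k i) (pure V k f) = pure V k (f \<circ> Transposition.transpose i (Suc i))"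
  using assms
proof (induction k)
  case (Suc k)
  note T = tensor_power_Ob[OF V]
  show ?case
  proof (cases "Suc i < k")
    case True
    then show ?thesis
      using Suc FTensor_natural[OF adjacent_swap_hom Ident_hom[OF V] pure_mem, of k f "f k" i]
      by (simp add: FArr_Ident[OF V] transpose_def)
  next
    case False
    then have k: "k = Suc i" using Suc by simp
    let ?P = "tensor_power C V i" and ?x = "pure V i f"
    have x: "?x \<in> FOb F ?P" "f i \<in> FOb F V" "f (Suc i) \<in> FOb F V" using pure_mem Suc.prems k by auto
    note h1 = Assoc_hom[OF T[of i] V V] and h2 = TArr_hom[OF Ident_hom[OF T[of i]] Braid_hom[OF V V]]
      and h3 = inv_arr_Assoc(1)[OF T[of i] V V]
    have c: "pure V i (f \<circ> Transposition.transpose i (Suc i)) = ?x"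
      by (rule pure_cong) (simp add: transpose_def)
    have "FArr F (inv_arr C (Assoc C ?P V V) \<cdot> (Ident C ?P \<otimes>\<^sub>a Braid C V V) \<cdot> Assoc C ?P V V)
        (tens (?P \<otimes>\<^sub>o V) V (tens ?P V ?x (f i)) (f (Suc i))) =
        tens (?P \<otimes>\<^sub>o V) V (tens ?P V ?x (f (Suc i))) (f i)"
      using x V T by (simp add: FArr_Comp[OF Comp_hom[OF h1 h2] h3] FArr_Comp[OF h1 h2] tens_mem TOb FTensor_Assoc
          FTensor_natural[OF Ident_hom[OF T[of i]] Braid_hom[OF V V]] FArr_Ident FTensor_Braid inv_arr_Assoc(2))
    then show "FArr F (adjacent_swap C V (Suc k) i) (pure V (Suc k) f) =
        pure V (Suc k) (f \<circ> Transposition.transpose i (Suc i))"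
      using k c by (simp del: comp_apply) (simp add: comp_apply)
  qed
qed simp

lemma swaps_arrow_hom: "swaps_arrow C V k w \<in> homs C (tensor_power C V k) (tensor_power C V k)"
  unfolding swaps_arrow_def
  by (induction w) (auto intro: Comp_hom adjacent_swap_hom Ident_hom tensor_power_Ob[OF V])

text \<open>A permutation moves the factor at place \<open>i\<close> to place
  \<open>\<sigma> i\<close>; hence place \<open>j\<close> receives the label of place
  \<open>inv \<sigma> j\<close>, and labels are composed with the inverse.\<close>

lemma swaps_arrow_pure:
  assumes "\<forall>i \<in> set w. Suc i < k" and f: "\<And>j. j < k \<Longrightarrow> f j \<in> FOb F V"
  shows "FArr F (swaps_arrow C V k w) (pure V k f) = pure V k (f \<circ> inv (swaps_perm w))"
  using assms(1)
proof (induction w)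
  case Nil
  show "FArr F (swaps_arrow C V k []) (pure V k f) = pure V k (f \<circ> inv (swaps_perm []))"
    using FArr_Ident[OF tensor_power_Ob[OF V] pure_mem[OF f], of k] by (simp add: swaps_arrow_def swaps_perm_Nil)
next
  case (Cons i w)
  have p: "swaps_perm w permutes {..<k}" using swaps_perm_permutes[of w k] Cons.prems by auto
  have fi: "(f \<circ> inv (swaps_perm w)) j \<in> FOb F V" if "j < k" for j
    using f permutes_in_image[OF permutes_inv[OF p], of j] that by simp
  have "inv (swaps_perm (i # w)) = inv (swaps_perm w) \<circ> Transposition.transpose i (Suc i)"
    using o_inv_distrib[OF bij_transpose permutes_bij[OF p]] by (simp add: swaps_perm_Cons)
  moreover have "FArr F (swaps_arrow C V k (i # w)) (pure V k f) =
      FArr F (adjacent_swap C V k i) (FArr F (swaps_arrow C V k w) (pure V k f))"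
    using FArr_Comp[OF swaps_arrow_hom[of k w] adjacent_swap_hom[of k i] pure_mem[OF f]] by (simp add: swaps_arrow_def)
  ultimately show ?case
    using Cons adjacent_swap_pure[of i k "f \<circ> inv (swaps_perm w)"] fi by (simp add: comp_def)
qed

lemma perm_arrow_hom: "perm_arrow C V k \<sigma> \<in> homs C (tensor_power C V k) (tensor_power C V k)"
  unfolding perm_arrow_def by (rule swaps_arrow_hom)

lemma perm_arrow_pure:
  assumes "\<sigma> permutes {..<k}" and "\<And>j. j < k \<Longrightarrow> f j \<in> FOb F V"
  shows "FArr F (perm_arrow C V k \<sigma>) (pure V k f) = pure V k (f \<circ> inv \<sigma>)"
proof -
  let ?w = "SOME w. (\<forall>i \<in> set w. Suc i < k) \<and> swaps_perm w = \<sigma>"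
  have "(\<forall>i \<in> set ?w. Suc i < k) \<and> swaps_perm ?w = \<sigma>" using someI_ex[OF ex_swaps_perm[OF assms(1)]] .
  then show ?thesis unfolding perm_arrow_def using swaps_arrow_pure[of ?w k f] assms(2) by simp
qed

text \<open>The words chosen for \<open>\<sigma>\<close>, \<open>\<tau>\<close> and
  \<open>\<sigma> \<circ> \<tau>\<close> are unrelated. On pure tensors, however, each arrow depends
  on its permutation alone, and this takes the place of the coherence theorem.\<close>

lemma perm_arrow_comp:
  assumes \<sigma>: "\<sigma> permutes {..<k}" and \<tau>: "\<tau> permutes {..<k}" and z: "z \<in> FOb F (tensor_power C V k)"
  shows "FArr F (perm_arrow C V k \<sigma>) (FArr F (perm_arrow C V k \<tau>) z) = FArr F (perm_arrow C V k (\<sigma> \<circ> \<tau>)) z"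
  using z
proof (induction rule: pure_induct)
  case (pure f)
  have "inv (\<sigma> \<circ> \<tau>) = inv \<tau> \<circ> inv \<sigma>" using o_inv_distrib permutes_bij \<sigma> \<tau> by blast
  moreover have "f j \<in> FOb F V" "(f \<circ> inv \<tau>) j \<in> FOb F V" for j using pure by simp_all
  ultimately show "FArr F (perm_arrow C V k \<sigma>) (FArr F (perm_arrow C V k \<tau>) (pure V k f)) =
      FArr F (perm_arrow C V k (\<sigma> \<circ> \<tau>)) (pure V k f)"
    by (simp only: perm_arrow_pure[OF \<tau>] perm_arrow_pure[OF \<sigma>] perm_arrow_pure[OF permutes_compose[OF \<tau> \<sigma>]] comp_assoc)
next
  case zero
  then show ?case by (simp add: FArr_0[OF perm_arrow_hom])
next
  case (scale c z)
  then show ?case by (simp add: FArr_scale[OF perm_arrow_hom] FArr_mem[OF perm_arrow_hom])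
next
  case (add z z')
  then show ?case by (simp add: FArr_plus[OF perm_arrow_hom] FArr_mem[OF perm_arrow_hom])
qed

text \<open>With coordinate functionals as \<open>\<phi> i\<close>, this reads off coefficients of
  pure tensors without a basis of the tensor power.\<close>

lemma functional_pure:
  assumes "\<And>i. i < k \<Longrightarrow> functional (\<phi> i)"
  shows "\<exists>\<gamma>. functional \<gamma> \<and> (\<forall>f. (\<forall>i<k. f i \<in> FOb F V) \<longrightarrow> \<gamma> (pure V k f) = (\<Prod>i<k. \<phi> i (f i)))"
  using assms
proof (induction k)
  case 0
  have "V.independent {FUnit F}" using FUnit by (simp add: is_basis_def)
  then obtain \<gamma> where "functional \<gamma>" "\<gamma> (FUnit F) = 1"
    using VE.linear_independent_extend[of "{FUnit F}" "\<lambda>_. 1"] by auto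
  then show ?case by auto
next
  case (Suc k)
  then obtain \<gamma> where \<gamma>: "functional \<gamma>"
    "\<And>f. \<forall>i<k. f i \<in> FOb F V \<Longrightarrow> \<gamma> (pure V k f) = (\<Prod>i<k. \<phi> i (f i))" by auto
  obtain \<delta> where \<delta>: "functional \<delta>" "\<And>x y. x \<in> FOb F (tensor_power C V k) \<Longrightarrow> y \<in> FOb F V \<Longrightarrow>
      \<delta> (tens (tensor_power C V k) V x y) = \<gamma> x * \<phi> k y"
    using functional_tens[OF tensor_power_Ob[OF V] V \<gamma>(1) Suc.prems[of k]] by blast
  have "\<delta> (pure V (Suc k) f) = (\<Prod>i<Suc k. \<phi> i (f i))" if "\<forall>i<Suc k. f i \<in> FOb F V" for f
    using that \<delta>(2)[OF pure_mem, of f "f k"] \<gamma>(2)[of f] by simp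
  then show ?case using \<delta>(1) by blast
qed

end

lemma dual_basis_functional:
  assumes "V.independent B" "b \<in> B"
  shows "\<exists>\<phi>. functional \<phi> \<and> (\<forall>b' \<in> B. \<phi> b' = (if b' = b then 1 else 0))"
  using VE.linear_independent_extend[OF assms(1), of "\<lambda>b'. if b' = b then 1 else 0"] by blast

end

section \<open>Averaging over a symmetric group\<close>

locale tannakian_char_0 = neutral_tannakian_category C F
  for C :: "('o, 'a, 'e::field_char_0, 'm) tensor_category_scheme" (structure)
    and F :: "('o, 'a, 'e, 'v::ab_group_add, 'n) fibre_functor_scheme"
begin

text \<open>The Reynolds operator, a projector onto the invariants. The group has order
  \<open>fact k\<close>, which is invertible in characteristic 0.\<close>

lemma average_arrow:
  fixes k :: nat
  defines "G \<equiv> {\<sigma>. \<sigma> permutes {..<k}}"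
  assumes a: "\<And>\<sigma>. \<sigma> permutes {..<k} \<Longrightarrow> a \<sigma> \<in> homs C H H" and H: "H \<in> Ob C"
    and act: "\<And>\<sigma> \<tau> x. \<sigma> permutes {..<k} \<Longrightarrow> \<tau> permutes {..<k} \<Longrightarrow> x \<in> FOb F H \<Longrightarrow>
      FArr F (a \<tau>) (FArr F (a \<sigma>) x) = FArr F (a (\<tau> \<circ> \<sigma>)) x"
  shows "\<exists>e \<in> homs C H H. (\<forall>x \<in> FOb F H. FArr F e x = inverse (fact k) *\<^sub>v (\<Sum>\<sigma>\<in>G. FArr F (a \<sigma>) x)) \<and>
    (\<forall>x \<in> FOb F H. \<forall>\<tau> \<in> G. FArr F (a \<tau>) (FArr F e x) = FArr F e x) \<and>
    (\<forall>x \<in> FOb F H. (\<forall>\<tau> \<in> G. FArr F (a \<tau>) x = x) \<longrightarrow> FArr F e x = x)"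
proof -
  have fin: "finite G" unfolding G_def by (simp add: finite_permutations)
  have card: "card G = fact k" unfolding G_def using card_permutations[of "{..<k}" k] by simp
  have aG: "\<And>\<sigma>. \<sigma> \<in> G \<Longrightarrow> a \<sigma> \<in> homs C H H" using a by (simp add: G_def)
  obtain s where s: "s \<in> homs C H H" "\<And>x. x \<in> FOb F H \<Longrightarrow> FArr F s x = (\<Sum>\<sigma>\<in>G. FArr F (a \<sigma>) x)"
    using arrow_sum[of G H H a] fin H aG by blast
  let ?e = "Scale C (inverse (fact k)) s"
  have e: "?e \<in> homs C H H" by (rule Scale_hom[OF s(1)])
  have Fe: "FArr F ?e x = inverse (fact k) *\<^sub>v (\<Sum>\<sigma>\<in>G. FArr F (a \<sigma>) x)" if "x \<in> FOb F H" for x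
    using FArr_Scale[OF s(1) that] s(2)[OF that] by simp
  have "FArr F (a \<tau>) (FArr F ?e x) = FArr F ?e x" if x: "x \<in> FOb F H" and \<tau>: "\<tau> \<in> G" for x \<tau>
  proof -
    have \<tau>': "\<tau> permutes {..<k}" using \<tau> by (simp add: G_def)
    have m: "\<forall>\<sigma> \<in> G. FArr F (a \<sigma>) x \<in> FOb F H" using FArr_mem aG x by blast
    have "FArr F (a \<tau>) (FArr F ?e x) = inverse (fact k) *\<^sub>v (\<Sum>\<sigma>\<in>G. FArr F (a \<tau>) (FArr F (a \<sigma>) x))"
      using Fe[OF x] FArr_scale[OF a[OF \<tau>'] FOb_sum[OF H m]] FArr_sum[OF a[OF \<tau>'] m] by simp
    \<comment> \<open>Left multiplication by \<open>\<tau>\<close> only permutes the summands, hence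
      the average is invariant.\<close>
    also have "(\<Sum>\<sigma>\<in>G. FArr F (a \<tau>) (FArr F (a \<sigma>) x)) = (\<Sum>\<sigma>\<in>G. FArr F (a (\<tau> \<circ> \<sigma>)) x)"
      using act[OF _ \<tau>' x] by (intro sum.cong) (auto simp: G_def)
    also have "\<dots> = (\<Sum>\<sigma>\<in>G. FArr F (a \<sigma>) x)"
      unfolding G_def using setum_permutations_compose_left[OF \<tau>', of "\<lambda>\<sigma>. FArr F (a \<sigma>) x"] by simp
    finally show ?thesis using Fe[OF x] by simp
  qed
  moreover have "FArr F ?e x = x" if x: "x \<in> FOb F H" and inv: "\<forall>\<tau> \<in> G. FArr F (a \<tau>) x = x" for x
  proof -
    have "FArr F ?e x = inverse (fact k) *\<^sub>v (\<Sum>\<sigma>\<in>G. x)" using Fe[OF x] inv by simp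
    also have "(\<Sum>\<sigma>\<in>G. x) = of_nat (card G) *\<^sub>v x" using V.sum_constant_scale[of x G] by simp
    finally show ?thesis using card by simp
  qed
  ultimately show ?thesis using e Fe by blast
qed

end

section \<open>Hom objects\<close>

text \<open>A finite basis \<open>B\<close> of a space \<open>M\<close> of functions, with its
  coordinate functionals \<open>\<kappa>\<close>. Sums and multiples are written pointwise because
  \<open>linear_into_hom\<close> is phrased in that way.\<close>

locale function_coordinates =
  fixes M B :: "('g \<Rightarrow> 'e::field) set" and \<kappa> :: "('g \<Rightarrow> 'e) \<Rightarrow> ('g \<Rightarrow> 'e) \<Rightarrow> 'e"
  assumes finite_B: "finite B" and B_sub: "B \<subseteq> M"
    and zero_mem: "(\<lambda>_. 0) \<in> M"
    and add_mem: "x \<in> M \<Longrightarrow> y \<in> M \<Longrightarrow> (\<lambda>g. x g + y g) \<in> M"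
    and scale_mem: "x \<in> M \<Longrightarrow> (\<lambda>g. c * x g) \<in> M"
    and expand: "x \<in> M \<Longrightarrow> x = (\<lambda>g. \<Sum>b\<in>B. \<kappa> b x * b g)"
    and coord_basis: "b \<in> B \<Longrightarrow> b' \<in> B \<Longrightarrow> \<kappa> b b' = (if b = b' then 1 else 0)"
    and coord_add: "x \<in> M \<Longrightarrow> y \<in> M \<Longrightarrow> \<kappa> b (\<lambda>g. x g + y g) = \<kappa> b x + \<kappa> b y"
    and coord_scale: "x \<in> M \<Longrightarrow> \<kappa> b (\<lambda>g. c * x g) = c * \<kappa> b x"

text \<open>Functions supported on the finite set \<open>G\<close> lie in the span of its indicator
  functions, so every basis of \<open>M\<close> is finite.\<close>

lemma ex_function_coordinates:
  fixes M :: "('g \<Rightarrow> 'e::field) set"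
  assumes G: "finite G" and supp: "\<And>x g. x \<in> M \<Longrightarrow> g \<notin> G \<Longrightarrow> x g = 0"
    and zero: "(\<lambda>_. 0) \<in> M"
    and add: "\<And>x y. x \<in> M \<Longrightarrow> y \<in> M \<Longrightarrow> (\<lambda>g. x g + y g) \<in> M"
    and scale: "\<And>c x. x \<in> M \<Longrightarrow> (\<lambda>g. c * x g) \<in> M"
  shows "\<exists>B \<kappa>. function_coordinates M B \<kappa>"
proof -
  let ?s = "\<lambda>c (x :: 'g \<Rightarrow> 'e) g. c * x g"
  interpret fs: vector_space ?s
    by unfold_locales (auto simp: fun_eq_iff algebra_simps)
  have plus: "x + y = (\<lambda>g. x g + y g)" for x y :: "'g \<Rightarrow> 'e" by (simp add: fun_eq_iff)
  have M: "fs.subspace M" unfolding fs.subspace_def using zero add scale by (auto simp: plus zero_fun_def)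
  obtain B where B: "B \<subseteq> M" "fs.independent B" "M \<subseteq> fs.span B"
    by (rule fs.basis_exists[of M])
  have MB: "fs.span B = M" by (rule subset_antisym[OF fs.span_minimal[OF B(1) M] B(3)])
  let ?\<delta> = "\<lambda>g h. if h = g then 1 else 0 :: 'e"
  have sum_apply: "(\<Sum>i\<in>I. f i) g = (\<Sum>i\<in>I. f i g)" for I and f :: "'i \<Rightarrow> 'g \<Rightarrow> 'e" and g
    by (induction I rule: infinite_finite_induct) auto
  have "x \<in> fs.span (?\<delta> ` G)" if "x \<in> M" for x
  proof -
    have "x = (\<Sum>g\<in>G. ?s (x g) (?\<delta> g))"
    proof
      fix h
      have "(\<Sum>g\<in>G. ?s (x g) (?\<delta> g)) h = (\<Sum>g\<in>G. if g = h then x g else 0)"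
        unfolding sum_apply by (rule sum.cong) auto
      also have "\<dots> = x h" using G supp[OF that, of h] by auto
      finally show "x h = (\<Sum>g\<in>G. ?s (x g) (?\<delta> g)) h" by simp
    qed
    also have "\<dots> \<in> fs.span (?\<delta> ` G)" by (intro fs.span_sum fs.span_scale fs.span_base) auto
    finally show ?thesis .
  qed
  then have "B \<subseteq> fs.span (?\<delta> ` G)" using B(1) by (meson subset_iff)
  then have fin: "finite B" using fs.independent_span_bound[OF finite_imageI[OF G] B(2)] by simp
  have "function_coordinates M B (\<lambda>b x. fs.representation B x b)"
  proof
    fix x assume x: "x \<in> M"
    show "x = (\<lambda>g. \<Sum>b\<in>B. fs.representation B x b * b g)"
    proof
      fix g
      have "x = (\<Sum>b\<in>B. ?s (fs.representation B x b) b)"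
        using fs.sum_representation_eq[OF B(2) _ fin, of x] x MB by auto
      then have "x g = (\<Sum>b\<in>B. ?s (fs.representation B x b) b) g" by simp
      then show "x g = (\<Sum>b\<in>B. fs.representation B x b * b g)" by (simp add: sum_apply)
    qed
  next
    fix x y b assume "x \<in> M" "y \<in> M"
    then have "fs.representation B (x + y) b = fs.representation B x b + fs.representation B y b"
      using fs.representation_add[OF B(2), of y x] MB by simp
    then show "fs.representation B (\<lambda>g. x g + y g) b = fs.representation B x b + fs.representation B y b"
      unfolding plus .
  next
    fix x b c assume "x \<in> M"
    then show "fs.representation B (\<lambda>g. c * x g) b = c * fs.representation B x b"
      using fs.representation_scale[OF B(2), of x c] MB by simp
  next
    fix b b' assume "b \<in> B" "b' \<in> B"
    then show "fs.representation B b' b = (if b = b' then 1 else 0)"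
      using fs.representation_basis[OF B(2)] by auto
  qed (use fin B zero add scale in auto)
  then show ?thesis by blast
qed

section \<open>The group algebra and the Specht module\<close>

lemma group_algebra_mult_add:
  "group_algebra_mult k (\<lambda>g. x g + x' g) y = (\<lambda>g. group_algebra_mult k x y g + group_algebra_mult k x' y g)"
  by (auto simp: group_algebra_mult_def fun_eq_iff distrib_right sum.distrib)

lemma group_algebra_mult_scale:
  "group_algebra_mult k (\<lambda>g. c * x g) y = (\<lambda>g. c * group_algebra_mult k x y g)"
  by (auto simp: group_algebra_mult_def fun_eq_iff sum_distrib_left mult.assoc)

lemma permutes_comp_iff:
  assumes "\<sigma> permutes S" shows "(\<sigma> \<circ> \<pi>) permutes S \<longleftrightarrow> \<pi> permutes S"
proof
  assume "(\<sigma> \<circ> \<pi>) permutes S"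
  then have "(inv \<sigma> \<circ> (\<sigma> \<circ> \<pi>)) permutes S" using permutes_compose permutes_inv[OF assms] by blast
  then show "\<pi> permutes S" using permutes_inv_o(2)[OF assms] by (simp add: comp_assoc[symmetric])
qed (use assms permutes_compose in blast)

lemma left_translate_inv:
  assumes "\<sigma> permutes S" shows "left_translate (inv \<sigma>) x = (\<lambda>\<pi>. x (\<sigma> \<circ> \<pi>))"
  by (simp add: left_translate_def permutes_inv_inv[OF assms])

text \<open>Left translations commute with right multiplications;
  \<open>\<sigma> \<circ> \<rho>\<close> is substituted for the summation index. Hence the Specht
  module is stable under translation.\<close>

lemma left_translate_group_algebra_mult:
  assumes \<sigma>: "\<sigma> permutes {..<k}"
  shows "left_translate (inv \<sigma>) (group_algebra_mult k x y) = group_algebra_mult k (left_translate (inv \<sigma>) x) y"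
proof
  fix \<pi> :: "nat \<Rightarrow> nat"
  show "left_translate (inv \<sigma>) (group_algebra_mult k x y) \<pi> = group_algebra_mult k (left_translate (inv \<sigma>) x) y \<pi>"
  proof (cases "\<pi> permutes {..<k}")
    case True
    have "(\<Sum>\<rho> | \<rho> permutes {..<k}. x \<rho> * y (inv \<rho> \<circ> (\<sigma> \<circ> \<pi>))) =
        (\<Sum>\<rho> | \<rho> permutes {..<k}. x (\<sigma> \<circ> \<rho>) * y (inv (\<sigma> \<circ> \<rho>) \<circ> (\<sigma> \<circ> \<pi>)))"
      by (rule setum_permutations_compose_left[OF \<sigma>])
    also have "\<dots> = (\<Sum>\<rho> | \<rho> permutes {..<k}. x (\<sigma> \<circ> \<rho>) * y (inv \<rho> \<circ> \<pi>))"
    proof (rule sum.cong[OF refl])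
      fix \<rho> assume "\<rho> \<in> {\<rho>. \<rho> permutes {..<k}}"
      then have "inv (\<sigma> \<circ> \<rho>) = inv \<rho> \<circ> inv \<sigma>" using o_inv_distrib permutes_bij \<sigma> by blast
      then have "inv (\<sigma> \<circ> \<rho>) \<circ> (\<sigma> \<circ> \<pi>) = inv \<rho> \<circ> (inv \<sigma> \<circ> \<sigma>) \<circ> \<pi>" by (simp add: comp_assoc)
      then show "x (\<sigma> \<circ> \<rho>) * y (inv (\<sigma> \<circ> \<rho>) \<circ> (\<sigma> \<circ> \<pi>)) = x (\<sigma> \<circ> \<rho>) * y (inv \<rho> \<circ> \<pi>)"
        using permutes_inv_o(2)[OF \<sigma>] by simp
    qed
    finally show ?thesis using True permutes_comp_iff[OF \<sigma>]
      by (simp add: left_translate_inv[OF \<sigma>] group_algebra_mult_def)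
  next
    case False
    then show ?thesis using permutes_comp_iff[OF \<sigma>]
      by (simp add: left_translate_inv[OF \<sigma>] group_algebra_mult_def)
  qed
qed

lemma specht_module_translate:
  assumes \<sigma>: "\<sigma> permutes {..<sum_list u}" and m: "m \<in> specht_module u"
  shows "left_translate (inv \<sigma>) m \<in> specht_module u"
proof -
  obtain x where x: "x \<in> group_algebra (sum_list u)" "m = group_algebra_mult (sum_list u) x (young_symmetrizer u)"
    using m by (auto simp: specht_module_def)
  have "left_translate (inv \<sigma>) x \<in> group_algebra (sum_list u)"
    using x(1) permutes_comp_iff[OF \<sigma>] by (auto simp: group_algebra_def left_translate_inv[OF \<sigma>])
  then show ?thesis unfolding x(2) left_translate_group_algebra_mult[OF \<sigma>]
    unfolding specht_module_def by blast
qed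

text \<open>It is its own product with the unit of the group algebra, the indicator function of
  \<open>id\<close>.\<close>

lemma young_symmetrizer_in_specht_module: "young_symmetrizer u \<in> specht_module u"
proof -
  let ?k = "sum_list u"
  let ?c = "young_symmetrizer u :: (nat \<Rightarrow> nat) \<Rightarrow> 'a"
  let ?\<delta> = "\<lambda>\<sigma>. if \<sigma> = id then 1 else 0 :: 'a"
  have "group_algebra_mult ?k ?\<delta> ?c = ?c"
  proof
    fix \<pi>
    show "group_algebra_mult ?k ?\<delta> ?c \<pi> = ?c \<pi>"
    proof (cases "\<pi> permutes {..<?k}")
      case True
      have "(\<Sum>\<sigma> | \<sigma> permutes {..<?k}. ?\<delta> \<sigma> * ?c (inv \<sigma> \<circ> \<pi>)) =
          (\<Sum>\<sigma> | \<sigma> permutes {..<?k}. if \<sigma> = id then ?c \<pi> else 0)"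
        by (rule sum.cong) (auto simp: inv_id)
      also have "\<dots> = ?c \<pi>" by (simp add: sum.delta finite_permutations permutes_id)
      finally show ?thesis using True by (simp add: group_algebra_mult_def)
    next
      case False
      then show ?thesis by (simp add: young_symmetrizer_def group_algebra_mult_def)
    qed
  qed
  moreover have "?\<delta> \<in> group_algebra ?k" by (auto simp: group_algebra_def permutes_id)
  ultimately show ?thesis unfolding specht_module_def by (metis imageI)
qed

lemma specht_module_coordinates: "\<exists>B \<kappa>. function_coordinates (specht_module u :: ((nat \<Rightarrow> nat) \<Rightarrow> 'e::field) set) B \<kappa>"
proof (rule ex_function_coordinates[OF finite_permutations[OF finite_lessThan, of "sum_list u"]])
  let ?A = "group_algebra (sum_list u) :: ((nat \<Rightarrow> nat) \<Rightarrow> 'e) set" and ?m = "group_algebra_mult (sum_list u)"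
  have A: "(\<lambda>_. 0) \<in> ?A" "\<And>x y. x \<in> ?A \<Longrightarrow> y \<in> ?A \<Longrightarrow> (\<lambda>g. x g + y g) \<in> ?A" "\<And>c x. x \<in> ?A \<Longrightarrow> (\<lambda>g. c * x g) \<in> ?A"
    by (auto simp: group_algebra_def)
  show "x g = 0" if "x \<in> specht_module u" "g \<notin> {\<sigma>. \<sigma> permutes {..<sum_list u}}" for x :: "(nat \<Rightarrow> nat) \<Rightarrow> 'e" and g
    using that by (auto simp: specht_module_def group_algebra_mult_def)
  have "?m (\<lambda>_. 0) (young_symmetrizer u) = (\<lambda>_. 0 :: 'e)" by (auto simp: group_algebra_mult_def fun_eq_iff)
  then show "(\<lambda>_. 0 :: 'e) \<in> specht_module u" using A(1) unfolding specht_module_def by (metis imageI)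
  show "(\<lambda>g. x g + y g) \<in> specht_module u" if "x \<in> specht_module u" "y \<in> specht_module u" for x y :: "(nat \<Rightarrow> nat) \<Rightarrow> 'e"
    using that A(2) unfolding specht_module_def by (auto simp: group_algebra_mult_add[symmetric])
  show "(\<lambda>g. c * x g) \<in> specht_module u" if "x \<in> specht_module u" for c and x :: "(nat \<Rightarrow> nat) \<Rightarrow> 'e"
    using that A(3) unfolding specht_module_def by (auto simp: group_algebra_mult_scale[symmetric])
qed

section \<open>Construction and coordinates of hom objects\<close>

context neutral_tannakian_category
begin

text \<open>The direct sum of copies of \<open>X\<close> indexed by \<open>B\<close>, with the
  biproduct relations stated on fibres. For a basis \<open>B\<close> of \<open>M\<close> it will
  represent the linear maps from \<open>M\<close> to \<open>X\<close>.\<close>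

lemma finite_biproduct:
  assumes X: "X \<in> Ob C" and "finite B"
  shows "\<exists>H j p. H \<in> Ob C \<and> (\<forall>b \<in> B. j b \<in> homs C X H \<and> p b \<in> homs C H X) \<and>
    (\<forall>h \<in> FOb F H. (\<Sum>b\<in>B. FArr F (j b) (FArr F (p b) h)) = h) \<and>
    (\<forall>b \<in> B. \<forall>b' \<in> B. \<forall>x \<in> FOb F X. FArr F (p b) (FArr F (j b') x) = (if b = b' then x else 0))"
  using assms(2)
proof (induction B)
  case empty
  obtain Z where Z: "is_zero_object C Z" using zero_object by blast
  then have "Z \<in> Ob C" by (simp add: is_zero_object_def)
  then show ?case using Z zero_object_iff by (intro exI[of _ Z]) auto
next
  case (insert b\<^sub>0 B)
  then obtain H j p where H: "H \<in> Ob C" "\<And>b. b \<in> B \<Longrightarrow> j b \<in> homs C X H" "\<And>b. b \<in> B \<Longrightarrow> p b \<in> homs C H X"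
    and id: "\<And>h. h \<in> FOb F H \<Longrightarrow> (\<Sum>b\<in>B. FArr F (j b) (FArr F (p b) h)) = h"
    and \<delta>: "\<And>b b' x. b \<in> B \<Longrightarrow> b' \<in> B \<Longrightarrow> x \<in> FOb F X \<Longrightarrow>
      FArr F (p b) (FArr F (j b') x) = (if b = b' then x else 0)" by blast
  obtain K i\<^sub>1 i\<^sub>2 p\<^sub>1 p\<^sub>2 where K: "i\<^sub>1 \<in> homs C X K" "i\<^sub>2 \<in> homs C H K" "p\<^sub>1 \<in> homs C K X" "p\<^sub>2 \<in> homs C K H"
    "p\<^sub>1 \<cdot> i\<^sub>1 = Ident C X" "p\<^sub>2 \<cdot> i\<^sub>2 = Ident C H" "p\<^sub>1 \<cdot> i\<^sub>2 = Zero C H X" "p\<^sub>2 \<cdot> i\<^sub>1 = Zero C X H"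
    "Add C (i\<^sub>1 \<cdot> p\<^sub>1) (i\<^sub>2 \<cdot> p\<^sub>2) = Ident C K"
    using biproducts[OF X H(1)] unfolding is_biproduct_def by blast
  have KO: "K \<in> Ob C" using hom_Ob K(1) by blast
  have e: "FArr F p\<^sub>1 (FArr F i\<^sub>1 x) = x" "FArr F p\<^sub>2 (FArr F i\<^sub>1 x) = 0" if "x \<in> FOb F X" for x
    using FArr_Comp[OF K(1,3) that] FArr_Comp[OF K(1,4) that] K FArr_Ident[OF X that] FArr_Zero[OF X H(1) that] by auto
  have e': "FArr F p\<^sub>1 (FArr F i\<^sub>2 x) = 0" "FArr F p\<^sub>2 (FArr F i\<^sub>2 x) = x" if "x \<in> FOb F H" for x
    using FArr_Comp[OF K(2,3) that] FArr_Comp[OF K(2,4) that] K FArr_Ident[OF H(1) that] FArr_Zero[OF H(1) X that] by auto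
  have e'': "FArr F i\<^sub>1 (FArr F p\<^sub>1 z) + FArr F i\<^sub>2 (FArr F p\<^sub>2 z) = z" if z: "z \<in> FOb F K" for z
    using FArr_Add[OF Comp_hom[OF K(3,1)] Comp_hom[OF K(4,2)] z] FArr_Comp[OF K(3,1) z] FArr_Comp[OF K(4,2) z]
      K(9) FArr_Ident[OF KO z] by simp
  define j' where "j' b = (if b = b\<^sub>0 then i\<^sub>1 else i\<^sub>2 \<cdot> j b)" for b
  define p' where "p' b = (if b = b\<^sub>0 then p\<^sub>1 else p b \<cdot> p\<^sub>2)" for b
  have j'0: "j' b\<^sub>0 = i\<^sub>1" "p' b\<^sub>0 = p\<^sub>1" by (auto simp: j'_def p'_def)
  have j'1: "j' b = i\<^sub>2 \<cdot> j b" "p' b = p b \<cdot> p\<^sub>2" if "b \<in> B" for b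
    using that insert(2) by (auto simp: j'_def p'_def)
  have homs: "j' b \<in> homs C X K" "p' b \<in> homs C K X" if "b \<in> insert b\<^sub>0 B" for b
    using that j'0 j'1 K(1,3) Comp_hom[OF H(2) K(2)] Comp_hom[OF K(4) H(3)] by auto
  have Fj: "FArr F (j' b) x = FArr F i\<^sub>2 (FArr F (j b) x)" if "b \<in> B" "x \<in> FOb F X" for b x
    using FArr_Comp[OF H(2)[OF that(1)] K(2) that(2)] j'1 that by simp
  have Fp: "FArr F (p' b) z = FArr F (p b) (FArr F p\<^sub>2 z)" if "b \<in> B" "z \<in> FOb F K" for b z
    using FArr_Comp[OF K(4) H(3)[OF that(1)] that(2)] j'1 that by simp
  have sum: "(\<Sum>b\<in>insert b\<^sub>0 B. FArr F (j' b) (FArr F (p' b) z)) = z" if z: "z \<in> FOb F K" for z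
  proof -
    have m: "FArr F p\<^sub>2 z \<in> FOb F H" using FArr_mem[OF K(4) z] .
    have m': "FArr F (p b) (FArr F p\<^sub>2 z) \<in> FOb F X" if "b \<in> B" for b using FArr_mem[OF H(3)[OF that] m] .
    have m'': "\<forall>b \<in> B. FArr F (j b) (FArr F (p b) (FArr F p\<^sub>2 z)) \<in> FOb F H"
      using FArr_mem[OF H(2) m'] by blast
    have "(\<Sum>b\<in>B. FArr F (j' b) (FArr F (p' b) z)) = (\<Sum>b\<in>B. FArr F i\<^sub>2 (FArr F (j b) (FArr F (p b) (FArr F p\<^sub>2 z))))"
      using Fj m' Fp z by (intro sum.cong) auto
    also have "\<dots> = FArr F i\<^sub>2 (FArr F p\<^sub>2 z)" using FArr_sum[OF K(2) m''] id[OF m] by simp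
    finally show ?thesis using insert(1,2) e''[OF z] j'0 by simp
  qed
  have delta: "FArr F (p' b) (FArr F (j' b') x) = (if b = b' then x else 0)"
    if "b \<in> insert b\<^sub>0 B" "b' \<in> insert b\<^sub>0 B" and x: "x \<in> FOb F X" for b b' x
  proof -
    have m: "FArr F (j' b') x \<in> FOb F K" using FArr_mem homs that by blast
    have m': "FArr F (j b') x \<in> FOb F H" if "b' \<in> B" using FArr_mem[OF H(2)[OF that] x] .
    show ?thesis
      using that insert(2) m m' FArr_0[OF H(3)]
      by (cases "b \<in> B"; cases "b' \<in> B") (auto simp: j'0 e e' Fj Fp \<delta>)
  qed
  show ?case
    by (rule exI[of _ K], rule exI[of _ j'], rule exI[of _ p'], intro conjI ballI KO homs sum delta)
qed

lemma FArr_linear_into_hom: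
  assumes "function_coordinates M B \<kappa>" and \<phi>: "linear_into_hom C M A X \<phi>" and m: "m \<in> M" and x: "x \<in> FOb F A"
  shows "FArr F (\<phi> m) x = (\<Sum>b\<in>B. \<kappa> b m *\<^sub>v FArr F (\<phi> b) x)"
proof -
  interpret function_coordinates M B \<kappa> by fact
  have hom: "\<And>m. m \<in> M \<Longrightarrow> \<phi> m \<in> homs C A X"
    and add: "\<And>m m'. m \<in> M \<Longrightarrow> m' \<in> M \<Longrightarrow> \<phi> (\<lambda>g. m g + m' g) = Add C (\<phi> m) (\<phi> m')"
    and scale: "\<And>c m. m \<in> M \<Longrightarrow> \<phi> (\<lambda>g. c * m g) = Scale C c (\<phi> m)"
    using \<phi> by (auto simp: linear_into_hom_def)
  have "(\<lambda>g. \<Sum>b\<in>I. c b * b g) \<in> M \<and> FArr F (\<phi> (\<lambda>g. \<Sum>b\<in>I. c b * b g)) x = (\<Sum>b\<in>I. c b *\<^sub>v FArr F (\<phi> b) x)"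
    if "finite I" "I \<subseteq> B" for I c
    using that
  proof (induction I)
    case empty
    have "\<phi> (\<lambda>_. 0) = Scale C 0 (\<phi> (\<lambda>_. 0))" using scale[OF zero_mem, of 0] by simp
    then have "FArr F (\<phi> (\<lambda>_. 0)) x = 0" using FArr_Scale[OF hom[OF zero_mem] x, of 0] by simp
    then show "(\<lambda>g. \<Sum>b\<in>{}. c b * b g) \<in> M \<and> FArr F (\<phi> (\<lambda>g. \<Sum>b\<in>{}. c b * b g)) x = (\<Sum>b\<in>{}. c b *\<^sub>v FArr F (\<phi> b) x)"
      using zero_mem by simp
  next
    case (insert b I)
    let ?r = "\<lambda>g. \<Sum>b\<in>I. c b * b g" and ?b = "\<lambda>g. c b * b g"
    have b: "b \<in> M" "?b \<in> M" using insert.prems B_sub scale_mem by auto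
    have r: "?r \<in> M" "FArr F (\<phi> ?r) x = (\<Sum>b\<in>I. c b *\<^sub>v FArr F (\<phi> b) x)" using insert by auto
    have eq: "(\<lambda>g. \<Sum>b\<in>insert b I. c b * b g) = (\<lambda>g. ?b g + ?r g)" using insert(1,2) by (simp add: fun_eq_iff)
    show "(\<lambda>g. \<Sum>b\<in>insert b I. c b * b g) \<in> M \<and>
        FArr F (\<phi> (\<lambda>g. \<Sum>b\<in>insert b I. c b * b g)) x = (\<Sum>b\<in>insert b I. c b *\<^sub>v FArr F (\<phi> b) x)"
      unfolding eq add[OF b(2) r(1)] scale[OF b(1)]
      using add_mem[OF b(2) r(1)] FArr_Add[OF Scale_hom[OF hom[OF b(1)]] hom[OF r(1)] x] r(2) insert(1,2)
        FArr_Scale[OF hom[OF b(1)] x] by simp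
  qed
  from this[OF finite_B subset_refl, of "\<lambda>b. \<kappa> b m"] show ?thesis using expand[OF m] by simp
qed

text \<open>A linear map from \<open>M\<close> is given by its values on the basis \<open>B\<close>.
  So \<open>H\<close> is a sum of copies of \<open>X\<close>, evaluation at \<open>m\<close> is the
  combination of the projections with the coordinates of \<open>m\<close>, and \<open>\<phi>\<close>
  is represented by the sum of the \<open>j b \<cdot> \<phi> b\<close>.\<close>

lemma hom_object_exists:
  assumes "function_coordinates M B \<kappa>" and X: "X \<in> Ob C"
  shows "\<exists>H \<epsilon>. is_hom_object C M X H \<epsilon>"
proof -
  interpret function_coordinates M B \<kappa> by fact
  obtain H j p where H: "H \<in> Ob C" "\<And>b. b \<in> B \<Longrightarrow> j b \<in> homs C X H" "\<And>b. b \<in> B \<Longrightarrow> p b \<in> homs C H X"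
    and id: "\<And>h. h \<in> FOb F H \<Longrightarrow> (\<Sum>b\<in>B. FArr F (j b) (FArr F (p b) h)) = h"
    and \<delta>: "\<And>b b' x. b \<in> B \<Longrightarrow> b' \<in> B \<Longrightarrow> x \<in> FOb F X \<Longrightarrow>
      FArr F (p b) (FArr F (j b') x) = (if b = b' then x else 0)" using finite_biproduct[OF X finite_B] by blast
  have "\<exists>f \<in> homs C H X. \<forall>h \<in> FOb F H. FArr F f h = (\<Sum>b\<in>B. \<kappa> b m *\<^sub>v FArr F (p b) h)" for m
    using arrow_sum[of B H X "\<lambda>b. Scale C (\<kappa> b m) (p b)"] finite_B H X Scale_hom FArr_Scale[OF H(3)] by simp
  then obtain \<epsilon> where \<epsilon>: "\<And>m. \<epsilon> m \<in> homs C H X"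
    and F\<epsilon>: "\<And>m h. h \<in> FOb F H \<Longrightarrow> FArr F (\<epsilon> m) h = (\<Sum>b\<in>B. \<kappa> b m *\<^sub>v FArr F (p b) h)" by metis
  have F\<epsilon>b: "FArr F (\<epsilon> b) h = FArr F (p b) h" if b: "b \<in> B" and h: "h \<in> FOb F H" for b h
  proof -
    have "FArr F (\<epsilon> b) h = (\<Sum>b'\<in>B. if b' = b then FArr F (p b') h else 0)"
      unfolding F\<epsilon>[OF h] using coord_basis b by (intro sum.cong) auto
    then show ?thesis using b finite_B by simp
  qed
  have lin: "linear_into_hom C M H X \<epsilon>"
    unfolding linear_into_hom_def
  proof (intro conjI ballI allI \<epsilon>)
    fix x y assume "x \<in> M" "y \<in> M"
    then show "\<epsilon> (\<lambda>g. x g + y g) = Add C (\<epsilon> x) (\<epsilon> y)"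
      by (intro FArr_faithful[OF \<epsilon> Add_hom[OF \<epsilon> \<epsilon>]])
        (simp add: FArr_Add[OF \<epsilon> \<epsilon>] F\<epsilon> coord_add V.scale_left_distrib sum.distrib)
  next
    fix c x assume "x \<in> M"
    then show "\<epsilon> (\<lambda>g. c * x g) = Scale C c (\<epsilon> x)"
      by (intro FArr_faithful[OF \<epsilon> Scale_hom[OF \<epsilon>]])
        (simp add: FArr_Scale[OF \<epsilon>] F\<epsilon> coord_scale V.scale_sum_right)
  qed
  have "\<exists>!h. h \<in> homs C T H \<and> (\<forall>m \<in> M. \<epsilon> m \<cdot> h = \<phi> m)"
    if T: "T \<in> Ob C" and \<phi>: "linear_into_hom C M T X \<phi>" for T \<phi>
  proof -
    have \<phi>h: "\<And>m. m \<in> M \<Longrightarrow> \<phi> m \<in> homs C T X" using \<phi> by (auto simp: linear_into_hom_def)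
    have jh: "j b \<cdot> \<phi> b \<in> homs C T H" if "b \<in> B" for b using Comp_hom[OF \<phi>h H(2)] that B_sub by blast
    obtain h where h: "h \<in> homs C T H"
      "\<And>x. x \<in> FOb F T \<Longrightarrow> FArr F h x = (\<Sum>b\<in>B. FArr F (j b \<cdot> \<phi> b) x)"
      using arrow_sum[of B T H "\<lambda>b. j b \<cdot> \<phi> b"] finite_B T H(1) jh by blast
    have \<phi>m: "FArr F (\<phi> b) x \<in> FOb F X" if "b \<in> B" "x \<in> FOb F T" for b x using FArr_mem \<phi>h B_sub that by blast
    have Fh: "FArr F h x = (\<Sum>b\<in>B. FArr F (j b) (FArr F (\<phi> b) x))" if x: "x \<in> FOb F T" for x
      using h(2)[OF x] FArr_Comp[OF \<phi>h H(2) x] B_sub by (auto intro: sum.cong)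
    have ph: "FArr F (p b) (FArr F h x) = FArr F (\<phi> b) x" if b: "b \<in> B" and x: "x \<in> FOb F T" for b x
    proof -
      have "FArr F (p b) (FArr F h x) = (\<Sum>b'\<in>B. FArr F (p b) (FArr F (j b') (FArr F (\<phi> b') x)))"
        unfolding Fh[OF x] using FArr_mem[OF H(2) \<phi>m[OF _ x]] by (intro FArr_sum[OF H(3)[OF b]]) blast
      also have "\<dots> = (\<Sum>b'\<in>B. if b' = b then FArr F (\<phi> b') x else 0)"
        using \<delta>[OF b _ \<phi>m[OF _ x]] by (intro sum.cong) auto
      also have "\<dots> = FArr F (\<phi> b) x" using finite_B b by simp
      finally show ?thesis .
    qed
    have "\<epsilon> m \<cdot> h = \<phi> m" if m: "m \<in> M" for m
    proof (rule FArr_faithful[OF Comp_hom[OF h(1) \<epsilon>] \<phi>h[OF m]])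
      fix x assume x: "x \<in> FOb F T"
      have "FArr F (\<epsilon> m \<cdot> h) x = (\<Sum>b\<in>B. \<kappa> b m *\<^sub>v FArr F (p b) (FArr F h x))"
        using FArr_Comp[OF h(1) \<epsilon> x] F\<epsilon>[OF FArr_mem[OF h(1) x]] by simp
      then show "FArr F (\<epsilon> m \<cdot> h) x = FArr F (\<phi> m) x"
        using ph[OF _ x] FArr_linear_into_hom[OF assms(1) \<phi> m x] by simp
    qed
    moreover have "h' = h" if h': "h' \<in> homs C T H" and e: "\<forall>m \<in> M. \<epsilon> m \<cdot> h' = \<phi> m" for h'
    proof (rule FArr_faithful[OF h' h(1)])
      fix x assume x: "x \<in> FOb F T"
      have hx: "FArr F h' x \<in> FOb F H" by (rule FArr_mem[OF h' x])
      have "FArr F (p b) (FArr F h' x) = FArr F (\<phi> b) x" if b: "b \<in> B" for b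
        using e b B_sub FArr_Comp[OF h' \<epsilon> x, of b] F\<epsilon>b[OF b hx] by auto
      then show "FArr F h' x = FArr F h x" using id[OF hx] Fh[OF x] by simp
    qed
    ultimately show ?thesis using h(1) by blast
  qed
  then show ?thesis unfolding is_hom_object_def using X H(1) lin by blast
qed

text \<open>A hom object is known only by its universal property, whichever way it was chosen. The
  arrow \<open>q b\<close> that represents \<open>m \<mapsto> \<kappa> b m\<close> times the
  identity is the inclusion of the copy of \<open>X\<close> at \<open>b\<close>, so \<open>H\<close>
  is a sum of copies of \<open>X\<close> after all.\<close>

lemma hom_object_coordinates:
  assumes "function_coordinates M B \<kappa>" and H: "is_hom_object C M X H \<epsilon>"
  shows "\<exists>q. (\<forall>b \<in> B. q b \<in> homs C X H \<and> (\<forall>m \<in> M. \<forall>x \<in> FOb F X. FArr F (\<epsilon> m) (FArr F (q b) x) = \<kappa> b m *\<^sub>v x)) \<and>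
    (\<forall>h \<in> FOb F H. (\<Sum>b\<in>B. FArr F (q b) (FArr F (\<epsilon> b) h)) = h)"
proof -
  interpret function_coordinates M B \<kappa> by fact
  have X: "X \<in> Ob C" and HO: "H \<in> Ob C" and \<epsilon>: "linear_into_hom C M H X \<epsilon>"
    and univ: "\<And>T \<phi>. T \<in> Ob C \<Longrightarrow> linear_into_hom C M T X \<phi> \<Longrightarrow>
      \<exists>!h. h \<in> homs C T H \<and> (\<forall>m \<in> M. \<epsilon> m \<cdot> h = \<phi> m)"
    using H by (auto simp: is_hom_object_def)
  have \<epsilon>h: "\<And>m. m \<in> M \<Longrightarrow> \<epsilon> m \<in> homs C H X" using \<epsilon> by (auto simp: linear_into_hom_def)
  note I = Ident_hom[OF X]
  have "linear_into_hom C M X X (\<lambda>m. Scale C (\<kappa> b m) (Ident C X))" for b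
    using I by (auto simp: linear_into_hom_def Scale_hom coord_add coord_scale Scale_add Scale_Scale)
  then have "\<exists>q. q \<in> homs C X H \<and> (\<forall>m \<in> M. \<epsilon> m \<cdot> q = Scale C (\<kappa> b m) (Ident C X))" for b
    using univ[OF X] by blast
  then obtain q where q: "\<And>b. q b \<in> homs C X H" "\<And>b m. m \<in> M \<Longrightarrow> \<epsilon> m \<cdot> q b = Scale C (\<kappa> b m) (Ident C X)"
    by metis
  have Fq: "FArr F (\<epsilon> m) (FArr F (q b) x) = \<kappa> b m *\<^sub>v x" if "m \<in> M" "x \<in> FOb F X" for b m x
    using FArr_Comp[OF q(1) \<epsilon>h[OF that(1)] that(2)] q(2)[OF that(1)] FArr_Scale[OF I that(2)] FArr_Ident[OF X that(2)]
    by simp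
  have q\<epsilon>: "q b \<cdot> \<epsilon> b \<in> homs C H H" if "b \<in> B" for b using Comp_hom[OF \<epsilon>h q(1)] that B_sub by blast
  obtain e where e: "e \<in> homs C H H" "\<And>h. h \<in> FOb F H \<Longrightarrow> FArr F e h = (\<Sum>b\<in>B. FArr F (q b \<cdot> \<epsilon> b) h)"
    using arrow_sum[of B H H "\<lambda>b. q b \<cdot> \<epsilon> b"] finite_B HO q\<epsilon> by blast
  have Fe: "FArr F e h = (\<Sum>b\<in>B. FArr F (q b) (FArr F (\<epsilon> b) h))" if "h \<in> FOb F H" for h
    using e(2)[OF that] FArr_Comp[OF \<epsilon>h q(1) that] B_sub by (auto intro: sum.cong)
  have \<epsilon>m: "FArr F (\<epsilon> b) h \<in> FOb F X" if "b \<in> B" "h \<in> FOb F H" for b h using FArr_mem \<epsilon>h B_sub that by blast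
  have "\<epsilon> m \<cdot> e = \<epsilon> m" if m: "m \<in> M" for m
  proof (rule FArr_faithful[OF Comp_hom[OF e(1) \<epsilon>h[OF m]] \<epsilon>h[OF m]])
    fix h assume h: "h \<in> FOb F H"
    have "FArr F (\<epsilon> m \<cdot> e) h = (\<Sum>b\<in>B. FArr F (\<epsilon> m) (FArr F (q b) (FArr F (\<epsilon> b) h)))"
      unfolding FArr_Comp[OF e(1) \<epsilon>h[OF m] h] Fe[OF h]
      using FArr_mem[OF q(1) \<epsilon>m[OF _ h]] by (intro FArr_sum[OF \<epsilon>h[OF m]]) blast
    also have "\<dots> = (\<Sum>b\<in>B. \<kappa> b m *\<^sub>v FArr F (\<epsilon> b) h)"
      using Fq[OF m \<epsilon>m[OF _ h]] by (intro sum.cong) auto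
    also have "\<dots> = FArr F (\<epsilon> m) h" using FArr_linear_into_hom[OF assms(1) \<epsilon> m h] by simp
    finally show "FArr F (\<epsilon> m \<cdot> e) h = FArr F (\<epsilon> m) h" .
  qed
  moreover have "\<epsilon> m \<cdot> Ident C H = \<epsilon> m" if "m \<in> M" for m using Comp_Ident_right[OF \<epsilon>h[OF that]] .
  \<comment> \<open>Both arrows represent \<open>\<epsilon>\<close> itself, and the representing
    arrow is unique.\<close>
  ultimately have "e = Ident C H" using univ[OF HO \<epsilon>] e(1) Ident_hom[OF HO] by blast
  then have "(\<Sum>b\<in>B. FArr F (q b) (FArr F (\<epsilon> b) h)) = h" if "h \<in> FOb F H" for h
    using Fe[OF that] FArr_Ident[OF HO that] by simp
  then show ?thesis using q(1) Fq by blast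
qed

end

section \<open>Schur objects\<close>

lemma left_translate_add: "left_translate \<sigma> (\<lambda>g. x g + y g) = (\<lambda>g. left_translate \<sigma> x g + left_translate \<sigma> y g)"
  and left_translate_scale: "left_translate \<sigma> (\<lambda>g. c * x g) = (\<lambda>g. c * left_translate \<sigma> x g)"
  by (simp_all add: left_translate_def)

context neutral_tannakian_category
begin

definition algebra_action :: "'o \<Rightarrow> nat \<Rightarrow> ((nat \<Rightarrow> nat) \<Rightarrow> 'e) \<Rightarrow> 'v \<Rightarrow> 'v" where
  "algebra_action V k m t = (\<Sum>\<sigma> | \<sigma> permutes {..<k}. m \<sigma> *\<^sub>v FArr F (perm_arrow C V k \<sigma>) t)"

lemma algebra_action_mem:
  "V \<in> Ob C \<Longrightarrow> t \<in> FOb F (tensor_power C V k) \<Longrightarrow> algebra_action V k m t \<in> FOb F (tensor_power C V k)"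
  unfolding algebra_action_def
  by (intro FOb_sum ballI FOb_scale tensor_power_Ob FArr_mem[OF perm_arrow_hom])

text \<open>For fixed \<open>t\<close> the map \<open>m \<mapsto> m t\<close> is equivariant. These
  maps are the elements of the Schur object on which all later tests are made.\<close>

lemma algebra_action_translate:
  assumes V: "V \<in> Ob C" and \<sigma>: "\<sigma> permutes {..<k}" and t: "t \<in> FOb F (tensor_power C V k)"
  shows "FArr F (perm_arrow C V k \<sigma>) (algebra_action V k (left_translate (inv \<sigma>) m) t) = algebra_action V k m t"
proof -
  note P = perm_arrow_hom[OF V, of k]
  have "FArr F (perm_arrow C V k \<sigma>) (algebra_action V k (left_translate (inv \<sigma>) m) t) =
      (\<Sum>\<pi> | \<pi> permutes {..<k}. m (\<sigma> \<circ> \<pi>) *\<^sub>v FArr F (perm_arrow C V k \<sigma>) (FArr F (perm_arrow C V k \<pi>) t))"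
    unfolding algebra_action_def left_translate_inv[OF \<sigma>]
    using FArr_mem[OF P t] FOb_scale[OF tensor_power_Ob[OF V]]
    by (simp add: FArr_sum[OF P] FArr_scale[OF P])
  also have "\<dots> = (\<Sum>\<pi> | \<pi> permutes {..<k}. m (\<sigma> \<circ> \<pi>) *\<^sub>v FArr F (perm_arrow C V k (\<sigma> \<circ> \<pi>)) t)"
    using perm_arrow_comp[OF V \<sigma> _ t] by (intro sum.cong) auto
  also have "\<dots> = algebra_action V k m t" unfolding algebra_action_def
    by (rule setum_permutations_compose_left[OF \<sigma>, symmetric])
  finally show ?thesis .
qed

lemma hom_object_joint_mono:
  assumes "function_coordinates M B \<kappa>" and H: "is_hom_object C M X H \<epsilon>"
    and h: "h \<in> FOb F H" "h' \<in> FOb F H" and eq: "\<And>m. m \<in> M \<Longrightarrow> FArr F (\<epsilon> m) h = FArr F (\<epsilon> m) h'"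
  shows "h = h'"
proof -
  interpret function_coordinates M B \<kappa> by fact
  obtain q where "\<And>h. h \<in> FOb F H \<Longrightarrow> (\<Sum>b\<in>B. FArr F (q b) (FArr F (\<epsilon> b) h)) = h"
    using hom_object_coordinates[OF assms(1) H] by blast
  then have "h = (\<Sum>b\<in>B. FArr F (q b) (FArr F (\<epsilon> b) h))" "h' = (\<Sum>b\<in>B. FArr F (q b) (FArr F (\<epsilon> b) h'))"
    using h by simp_all
  moreover have "(\<Sum>b\<in>B. FArr F (q b) (FArr F (\<epsilon> b) h)) = (\<Sum>b\<in>B. FArr F (q b) (FArr F (\<epsilon> b) h'))"
    using eq B_sub by (intro sum.cong) auto
  ultimately show ?thesis by simp
qed

text \<open>The clauses of \<open>is_schur_object\<close> on \<open>H\<close> and its action,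
  separated from the clause on invariants so that the action can be averaged first.\<close>

definition schur_action ::
  "nat list \<Rightarrow> 'o \<Rightarrow> 'o \<Rightarrow> (((nat \<Rightarrow> nat) \<Rightarrow> 'e) \<Rightarrow> 'a) \<Rightarrow> ((nat \<Rightarrow> nat) \<Rightarrow> 'a) \<Rightarrow> bool" where
  "schur_action u V H \<epsilon> a \<longleftrightarrow> is_hom_object C (specht_module u) (tensor_power C V (sum_list u)) H \<epsilon> \<and>
    (\<forall>\<sigma>. \<sigma> permutes {..<sum_list u} \<longrightarrow> a \<sigma> \<in> homs C H H \<and>
      (\<forall>m \<in> specht_module u.
        \<epsilon> m \<cdot> a \<sigma> = perm_arrow C V (sum_list u) \<sigma> \<cdot> \<epsilon> (left_translate (inv \<sigma>) m)))"

lemma is_schur_object_iff: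
  "is_schur_object C u V S \<longleftrightarrow> (\<exists>H \<epsilon> a \<iota>. schur_action u V H \<epsilon> a \<and>
    is_invariants C {\<sigma>. \<sigma> permutes {..<sum_list u}} a H S \<iota>)"
  unfolding is_schur_object_def schur_action_def by blast

lemma hom_object_arrow:
  assumes "is_hom_object C M X H \<epsilon>" "m \<in> M" shows "\<epsilon> m \<in> homs C H X"
  using assms by (auto simp: is_hom_object_def linear_into_hom_def)

lemma schur_action_FArr:
  assumes V: "V \<in> Ob C" and act: "schur_action u V H \<epsilon> a" and \<sigma>: "\<sigma> permutes {..<sum_list u}"
    and m: "m \<in> specht_module u" and h: "h \<in> FOb F H"
  shows "FArr F (\<epsilon> m) (FArr F (a \<sigma>) h) =
    FArr F (perm_arrow C V (sum_list u) \<sigma>) (FArr F (\<epsilon> (left_translate (inv \<sigma>) m)) h)"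
proof -
  have H: "is_hom_object C (specht_module u) (tensor_power C V (sum_list u)) H \<epsilon>"
    and a: "a \<sigma> \<in> homs C H H"
    and eq: "\<epsilon> m \<cdot> a \<sigma> = perm_arrow C V (sum_list u) \<sigma> \<cdot> \<epsilon> (left_translate (inv \<sigma>) m)"
    using act \<sigma> m by (auto simp: schur_action_def)
  show ?thesis
    using FArr_Comp[OF a hom_object_arrow[OF H m] h] eq
      FArr_Comp[OF hom_object_arrow[OF H specht_module_translate[OF \<sigma> m]] perm_arrow_hom[OF V] h] by simp
qed

text \<open>\<open>schur_action\<close> prescribes each \<open>a \<sigma>\<close> only through its
  composites with \<open>\<epsilon>\<close>. The group law follows because the
  \<open>\<epsilon> m\<close> are jointly injective on fibres and both translations and permutation
  arrows compose.\<close>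

lemma schur_action_comp:
  assumes V: "V \<in> Ob C" and act: "schur_action u V H \<epsilon> a"
    and \<sigma>: "\<sigma> permutes {..<sum_list u}" and \<tau>: "\<tau> permutes {..<sum_list u}" and h: "h \<in> FOb F H"
  shows "FArr F (a \<tau>) (FArr F (a \<sigma>) h) = FArr F (a (\<tau> \<circ> \<sigma>)) h"
proof -
  let ?k = "sum_list u"
  have H: "is_hom_object C (specht_module u) (tensor_power C V (sum_list u)) H \<epsilon>"
    and a: "\<And>\<sigma>. \<sigma> permutes {..<?k} \<Longrightarrow> a \<sigma> \<in> homs C H H"
    using act by (auto simp: schur_action_def)
  obtain B \<kappa> where B: "function_coordinates (specht_module u :: ((nat \<Rightarrow> nat) \<Rightarrow> 'e) set) B \<kappa>"
    using specht_module_coordinates by blast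
  have \<tau>\<sigma>: "(\<tau> \<circ> \<sigma>) permutes {..<?k}" using permutes_compose[OF \<sigma> \<tau>] .
  show ?thesis
  proof (rule hom_object_joint_mono[OF B H FArr_mem[OF a[OF \<tau>] FArr_mem[OF a[OF \<sigma>] h]] FArr_mem[OF a[OF \<tau>\<sigma>] h]])
    fix m :: "(nat \<Rightarrow> nat) \<Rightarrow> 'e" assume m: "m \<in> specht_module u"
    have m': "left_translate (inv \<tau>) m \<in> specht_module u" by (rule specht_module_translate[OF \<tau> m])
    have tr: "left_translate (inv \<sigma>) (left_translate (inv \<tau>) m) = left_translate (inv (\<tau> \<circ> \<sigma>)) m"
      unfolding left_translate_inv[OF \<sigma>] left_translate_inv[OF \<tau>] left_translate_inv[OF \<tau>\<sigma>]
      by (simp add: comp_assoc)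
    have e: "FArr F (\<epsilon> (left_translate (inv (\<tau> \<circ> \<sigma>)) m)) h \<in> FOb F (tensor_power C V ?k)"
      by (rule FArr_mem[OF hom_object_arrow[OF H specht_module_translate[OF \<tau>\<sigma> m]] h])
    show "FArr F (\<epsilon> m) (FArr F (a \<tau>) (FArr F (a \<sigma>) h)) = FArr F (\<epsilon> m) (FArr F (a (\<tau> \<circ> \<sigma>)) h)"
      unfolding schur_action_FArr[OF V act \<tau> m FArr_mem[OF a[OF \<sigma>] h]] schur_action_FArr[OF V act \<sigma> m' h]
        schur_action_FArr[OF V act \<tau>\<sigma> m h] tr
      by (rule perm_arrow_comp[OF V \<tau> \<sigma> e])
  qed
qed

lemma schur_action_exists:
  assumes V: "V \<in> Ob C"
  shows "\<exists>H \<epsilon> a. schur_action u V H \<epsilon> a"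
proof -
  let ?k = "sum_list u" and ?M = "specht_module u :: ((nat \<Rightarrow> nat) \<Rightarrow> 'e) set"
  obtain B \<kappa> where B: "function_coordinates ?M B \<kappa>" using specht_module_coordinates by blast
  obtain H \<epsilon> where H: "is_hom_object C ?M (tensor_power C V ?k) H \<epsilon>"
    using hom_object_exists[OF B tensor_power_Ob[OF V]] by blast
  have HO: "H \<in> Ob C" and \<epsilon>: "linear_into_hom C ?M H (tensor_power C V ?k) \<epsilon>"
    and univ: "\<And>T \<phi>. T \<in> Ob C \<Longrightarrow> linear_into_hom C ?M T (tensor_power C V ?k) \<phi> \<Longrightarrow>
      \<exists>!h. h \<in> homs C T H \<and> (\<forall>m \<in> ?M. \<epsilon> m \<cdot> h = \<phi> m)"
    using H by (auto simp: is_hom_object_def)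
  have "\<exists>h. h \<in> homs C H H \<and> (\<forall>m \<in> ?M. \<epsilon> m \<cdot> h = perm_arrow C V ?k \<sigma> \<cdot> \<epsilon> (left_translate (inv \<sigma>) m))"
    if \<sigma>: "\<sigma> permutes {..<?k}" for \<sigma>
  proof -
    note P = perm_arrow_hom[OF V, of ?k \<sigma>] and tr = specht_module_translate[OF \<sigma>]
    note e = hom_object_arrow[OF H tr]
    have "linear_into_hom C ?M H (tensor_power C V ?k) (\<lambda>m. perm_arrow C V ?k \<sigma> \<cdot> \<epsilon> (left_translate (inv \<sigma>) m))"
      unfolding linear_into_hom_def
    proof (intro conjI ballI allI)
      fix x assume x: "x \<in> ?M"
      show "perm_arrow C V ?k \<sigma> \<cdot> \<epsilon> (left_translate (inv \<sigma>) x) \<in> homs C H (tensor_power C V ?k)"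
        by (rule Comp_hom[OF e[OF x] P])
      show "perm_arrow C V ?k \<sigma> \<cdot> \<epsilon> (left_translate (inv \<sigma>) (\<lambda>g. c * x g)) =
          Scale C c (perm_arrow C V ?k \<sigma> \<cdot> \<epsilon> (left_translate (inv \<sigma>) x))" for c
        using \<epsilon> tr[OF x] Comp_Scale_right[OF e[OF x] P] by (simp add: linear_into_hom_def left_translate_scale)
      fix y assume y: "y \<in> ?M"
      show "perm_arrow C V ?k \<sigma> \<cdot> \<epsilon> (left_translate (inv \<sigma>) (\<lambda>g. x g + y g)) =
          Add C (perm_arrow C V ?k \<sigma> \<cdot> \<epsilon> (left_translate (inv \<sigma>) x)) (perm_arrow C V ?k \<sigma> \<cdot> \<epsilon> (left_translate (inv \<sigma>) y))"
        using \<epsilon> tr[OF x] tr[OF y] Comp_Add_right[OF e[OF x] e[OF y] P] by (simp add: linear_into_hom_def left_translate_add)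
    qed
    then show ?thesis using univ[OF HO] by blast
  qed
  then obtain a where "\<And>\<sigma>. \<sigma> permutes {..<?k} \<Longrightarrow> a \<sigma> \<in> homs C H H \<and>
      (\<forall>m \<in> ?M. \<epsilon> m \<cdot> a \<sigma> = perm_arrow C V ?k \<sigma> \<cdot> \<epsilon> (left_translate (inv \<sigma>) m))"
    by metis
  then show ?thesis unfolding schur_action_def using H by blast
qed

end

section \<open>Existence and fibres of Schur objects\<close>

context tannakian_char_0
begin

text \<open>The invariants are the image of the averaging projector. Their existence justifies the
  choice made by \<open>schur\<close>.\<close>

lemma schur_is_schur_object:
  assumes V: "V \<in> Ob C" shows "is_schur_object C u V (schur C u V)"
proof -
  let ?k = "sum_list u" and ?G = "{\<sigma>. \<sigma> permutes {..<sum_list u}}"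
  obtain H \<epsilon> a where act: "schur_action u V H \<epsilon> a" using schur_action_exists[OF V] by blast
  have H: "H \<in> Ob C" and a: "\<And>\<sigma>. \<sigma> permutes {..<?k} \<Longrightarrow> a \<sigma> \<in> homs C H H"
    using act by (auto simp: schur_action_def is_hom_object_def)
  obtain e where e: "e \<in> homs C H H"
    and inv: "\<And>x \<tau>. x \<in> FOb F H \<Longrightarrow> \<tau> \<in> ?G \<Longrightarrow> FArr F (a \<tau>) (FArr F e x) = FArr F e x"
    and efix: "\<And>x. x \<in> FOb F H \<Longrightarrow> (\<forall>\<tau> \<in> ?G. FArr F (a \<tau>) x = x) \<Longrightarrow> FArr F e x = x"
    using average_arrow[of ?k a H, OF a H schur_action_comp[OF V act]] by blast
  obtain S \<iota> r where S: "\<iota> \<in> homs C S H" "r \<in> homs C H S" "\<And>y. y \<in> FOb F S \<Longrightarrow> FArr F r (FArr F \<iota> y) = y"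
    "\<And>x. x \<in> FOb F H \<Longrightarrow> FArr F \<iota> (FArr F r x) = FArr F e x"
    using split_idempotent[OF e] efix inv FArr_mem[OF e] by blast
  have "is_invariants C ?G a H S \<iota>"
    unfolding is_invariants_def
  proof (intro conjI ballI allI impI)
    show "S \<in> Ob C" "\<iota> \<in> homs C S H" using S(1) hom_Ob by auto
    fix \<sigma> assume \<sigma>: "\<sigma> \<in> ?G"
    then have as: "a \<sigma> \<in> homs C H H" using a by simp
    show "a \<sigma> \<cdot> \<iota> = \<iota>"
    proof (rule FArr_faithful[OF Comp_hom[OF S(1) as] S(1)])
      fix y assume y: "y \<in> FOb F S"
      have m: "FArr F \<iota> y \<in> FOb F H" using FArr_mem[OF S(1) y] .
      have "FArr F \<iota> y = FArr F e (FArr F \<iota> y)" using S(3)[OF y] S(4)[OF m] by simp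
      then show "FArr F (a \<sigma> \<cdot> \<iota>) y = FArr F \<iota> y"
        using FArr_Comp[OF S(1) as y] inv[OF m \<sigma>] by simp
    qed
  next
    fix T h assume h: "h \<in> homs C T H" and hi: "\<forall>g \<in> ?G. a g \<cdot> h = h"
    have "\<iota> \<cdot> (r \<cdot> h) = h"
    proof (rule FArr_faithful[OF Comp_hom[OF Comp_hom[OF h S(2)] S(1)] h])
      fix x assume x: "x \<in> FOb F T"
      have m: "FArr F h x \<in> FOb F H" using FArr_mem[OF h x] .
      have "FArr F (a \<tau>) (FArr F h x) = FArr F h x" if "\<tau> \<in> ?G" for \<tau>
        using hi that FArr_Comp[OF h a x, of \<tau>] by simp
      then have "FArr F e (FArr F h x) = FArr F h x" using efix[OF m] by blast
      then show "FArr F (\<iota> \<cdot> (r \<cdot> h)) x = FArr F h x"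
        using FArr_Comp[OF Comp_hom[OF h S(2)] S(1) x] FArr_Comp[OF h S(2) x] S(4)[OF m] by simp
    qed
    moreover have "h' = r \<cdot> h" if h': "h' \<in> homs C T S" and eq: "\<iota> \<cdot> h' = h" for h'
    proof (rule FArr_faithful[OF h' Comp_hom[OF h S(2)]])
      fix x assume x: "x \<in> FOb F T"
      show "FArr F h' x = FArr F (r \<cdot> h) x"
        using eq FArr_Comp[OF h S(2) x] FArr_Comp[OF h' S(1) x] S(3)[OF FArr_mem[OF h' x]] by simp
    qed
    ultimately show "\<exists>!h'. h' \<in> homs C T S \<and> \<iota> \<cdot> h' = h" using Comp_hom[OF h S(2)] by blast
  qed
  then have "is_schur_object C u V S" unfolding is_schur_object_iff using act by blast
  then show ?thesis unfolding schur_def by (rule someI)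
qed

text \<open>The arrows \<open>s b\<close> and \<open>p b\<close> pass between \<open>S\<close> and
  the tensor power: a coordinate of the inclusion into \<open>H\<close>, and the projection to
  invariants from one summand of \<open>H\<close>. The clauses about them let later arguments
  compute in the tensor power alone.\<close>

lemma schur_object_fibre:
  assumes V: "V \<in> Ob C" and S: "is_schur_object C u V S"
  defines "k \<equiv> sum_list u"
  defines "X \<equiv> tensor_power C V k"
  obtains B s p where "finite B" and "\<And>b. b \<in> B \<Longrightarrow> s b \<in> homs C S X" and "\<And>b. b \<in> B \<Longrightarrow> p b \<in> homs C X S"
    and "\<And>x. x \<in> FOb F S \<Longrightarrow> \<forall>b \<in> B. FArr F (s b) x = 0 \<Longrightarrow> x = 0"
    and "\<And>t. t \<in> FOb F X \<Longrightarrow> \<exists>x \<in> FOb F S. \<forall>b \<in> B. FArr F (s b) x = algebra_action V k b t"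
    and "\<And>L t. linear_on (FScale F) (FOb F X) (FOb F X) L \<Longrightarrow> t \<in> FOb F X \<Longrightarrow>
      \<forall>b \<in> B. FArr F (p b) (L (algebra_action V k b t)) = 0 \<Longrightarrow>
      (\<Sum>\<sigma> | \<sigma> permutes {..<k}. FArr F (perm_arrow C V k \<sigma>)
        (L (algebra_action V k (left_translate (inv \<sigma>) (young_symmetrizer u)) t))) = 0"
proof -
  let ?G = "{\<sigma>. \<sigma> permutes {..<k}}" and ?M = "specht_module u :: ((nat \<Rightarrow> nat) \<Rightarrow> 'e) set"
  obtain H \<epsilon> a \<iota> where act: "schur_action u V H \<epsilon> a" and inv: "is_invariants C ?G a H S \<iota>"
    using S unfolding is_schur_object_iff k_def by blast
  have HO: "is_hom_object C ?M X H \<epsilon>" and a: "\<And>\<sigma>. \<sigma> permutes {..<k} \<Longrightarrow> a \<sigma> \<in> homs C H H"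
    using act by (auto simp: schur_action_def k_def X_def)
  have H: "H \<in> Ob C" and X: "X \<in> Ob C" using HO by (auto simp: is_hom_object_def)
  note \<epsilon>h = hom_object_arrow[OF HO]
  have \<epsilon>lin: "linear_into_hom C ?M H X \<epsilon>" using HO by (auto simp: is_hom_object_def)
  obtain B \<kappa> where B: "function_coordinates ?M B \<kappa>" using specht_module_coordinates by blast
  interpret function_coordinates ?M B \<kappa> by (rule B)
  obtain q where q: "\<And>b. b \<in> B \<Longrightarrow> q b \<in> homs C X H"
    and \<epsilon>q: "\<And>b m x. b \<in> B \<Longrightarrow> m \<in> ?M \<Longrightarrow> x \<in> FOb F X \<Longrightarrow> FArr F (\<epsilon> m) (FArr F (q b) x) = \<kappa> b m *\<^sub>v x"
    and q\<epsilon>: "\<And>h. h \<in> FOb F H \<Longrightarrow> (\<Sum>b\<in>B. FArr F (q b) (FArr F (\<epsilon> b) h)) = h"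
    using hom_object_coordinates[OF B HO] by blast
  obtain e where e: "e \<in> homs C H H"
    and Fe: "\<And>x. x \<in> FOb F H \<Longrightarrow> FArr F e x = inverse (fact k) *\<^sub>v (\<Sum>\<sigma>\<in>?G. FArr F (a \<sigma>) x)"
    and einv: "\<And>x \<tau>. x \<in> FOb F H \<Longrightarrow> \<tau> \<in> ?G \<Longrightarrow> FArr F (a \<tau>) (FArr F e x) = FArr F e x"
    and efix: "\<And>x. x \<in> FOb F H \<Longrightarrow> (\<forall>\<tau> \<in> ?G. FArr F (a \<tau>) x = x) \<Longrightarrow> FArr F e x = x"
    using average_arrow[of k a H, OF a H schur_action_comp[OF V act, folded k_def]] by blast
  have SO: "S \<in> Ob C" and \<iota>: "\<iota> \<in> homs C S H" and \<iota>inv: "\<And>\<sigma>. \<sigma> \<in> ?G \<Longrightarrow> a \<sigma> \<cdot> \<iota> = \<iota>"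
    and univ: "\<And>T h. h \<in> homs C T H \<Longrightarrow> (\<forall>g \<in> ?G. a g \<cdot> h = h) \<Longrightarrow>
      \<exists>!h'. h' \<in> homs C T S \<and> \<iota> \<cdot> h' = h"
    using inv by (auto simp: is_invariants_def)
  have "a \<sigma> \<cdot> e = e" if \<sigma>: "\<sigma> \<in> ?G" for \<sigma>
  proof -
    have as: "a \<sigma> \<in> homs C H H" using a \<sigma> by simp
    show ?thesis
      using einv[OF _ \<sigma>] FArr_Comp[OF e as] by (intro FArr_faithful[OF Comp_hom[OF e as] e]) simp
  qed
  \<comment> \<open>The averaging projector has invariant image and so factors through
    \<open>\<iota>\<close>; the factor \<open>\<pi>\<close> turns out to be a retraction of
    \<open>\<iota>\<close>.\<close>
  then obtain \<pi> where \<pi>: "\<pi> \<in> homs C H S" "\<iota> \<cdot> \<pi> = e" using univ[OF e] by blast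
  have F\<pi>: "FArr F \<iota> (FArr F \<pi> h) = FArr F e h" if "h \<in> FOb F H" for h
    using FArr_Comp[OF \<pi>(1) \<iota> that] \<pi>(2) by simp
  have F\<iota>: "FArr F e (FArr F \<iota> x) = FArr F \<iota> x" if x: "x \<in> FOb F S" for x
    using efix[OF FArr_mem[OF \<iota> x]] FArr_Comp[OF \<iota> a x] \<iota>inv by force
  have \<pi>\<iota>: "\<pi> \<cdot> \<iota> \<in> homs C S S" by (rule Comp_hom[OF \<iota> \<pi>(1)])
  have "\<iota> \<cdot> (\<pi> \<cdot> \<iota>) = \<iota>"
    using FArr_Comp[OF \<pi>\<iota> \<iota>] FArr_Comp[OF \<iota> \<pi>(1)] F\<pi>[OF FArr_mem[OF \<iota>]] F\<iota>
    by (intro FArr_faithful[OF Comp_hom[OF \<pi>\<iota> \<iota>] \<iota>]) simp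
  moreover have "\<iota> \<cdot> Ident C S = \<iota>" by (rule Comp_Ident_right[OF \<iota>])
  ultimately have "\<pi> \<cdot> \<iota> = Ident C S" using univ[OF \<iota>] \<iota>inv \<pi>\<iota> Ident_hom[OF SO] by blast
  then have F\<pi>\<iota>: "FArr F \<pi> (FArr F \<iota> x) = x" if "x \<in> FOb F S" for x
    using FArr_Comp[OF \<iota> \<pi>(1) that] FArr_Ident[OF SO that] by simp
  have bM: "b \<in> ?M" if "b \<in> B" for b using B_sub that by blast
  note s = Comp_hom[OF \<iota> \<epsilon>h[OF bM]] and p = Comp_hom[OF q \<pi>(1)]
  have Fs: "FArr F (\<epsilon> b \<cdot> \<iota>) x = FArr F (\<epsilon> b) (FArr F \<iota> x)" if "b \<in> B" "x \<in> FOb F S" for b x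
    using FArr_Comp[OF \<iota> \<epsilon>h[OF bM] that(2)] that(1) by simp
  have qm: "FArr F (q b) x \<in> FOb F H" if "b \<in> B" "x \<in> FOb F X" for b x using FArr_mem[OF q] that by blast
  have \<epsilon>sum: "FArr F (\<epsilon> m) (\<Sum>b\<in>B. FArr F (q b) (y b)) = (\<Sum>b\<in>B. \<kappa> b m *\<^sub>v y b)"
    if m: "m \<in> ?M" and y: "\<And>b. b \<in> B \<Longrightarrow> y b \<in> FOb F X" for m y
  proof -
    have "FArr F (\<epsilon> m) (\<Sum>b\<in>B. FArr F (q b) (y b)) = (\<Sum>b\<in>B. FArr F (\<epsilon> m) (FArr F (q b) (y b)))"
      using qm y by (intro FArr_sum[OF \<epsilon>h[OF m]]) blast
    then show ?thesis using \<epsilon>q[OF _ m y] by simp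
  qed
  have hm: "(\<Sum>b\<in>B. FArr F (q b) (y b)) \<in> FOb F H" if "\<And>b. b \<in> B \<Longrightarrow> y b \<in> FOb F X" for y
    using qm that by (intro FOb_sum H) blast
  have am: "algebra_action V k m t \<in> FOb F X" if "t \<in> FOb F X" for m t
    using algebra_action_mem[OF V] that unfolding X_def by blast
  have asum: "(\<Sum>b\<in>B. \<kappa> b m *\<^sub>v algebra_action V k b t) = algebra_action V k m t" if m: "m \<in> ?M" for m t
  proof -
    have "algebra_action V k m t = (\<Sum>\<sigma>\<in>?G. (\<Sum>b\<in>B. \<kappa> b m * b \<sigma>) *\<^sub>v FArr F (perm_arrow C V k \<sigma>) t)"
      unfolding algebra_action_def by (subst expand[OF m]) simp
    also have "\<dots> = (\<Sum>\<sigma>\<in>?G. \<Sum>b\<in>B. \<kappa> b m *\<^sub>v (b \<sigma> *\<^sub>v FArr F (perm_arrow C V k \<sigma>) t))"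
      by (simp add: V.scale_sum_left)
    also have "\<dots> = (\<Sum>b\<in>B. \<kappa> b m *\<^sub>v algebra_action V k b t)"
      unfolding algebra_action_def V.scale_sum_right by (rule sum.swap)
    finally show ?thesis by simp
  qed
  show thesis
  proof (rule that[of B "\<lambda>b. \<epsilon> b \<cdot> \<iota>" "\<lambda>b. \<pi> \<cdot> q b"])
    show "finite B" by (rule finite_B)
    show "\<And>b. b \<in> B \<Longrightarrow> \<epsilon> b \<cdot> \<iota> \<in> homs C S X" by (rule s)
    show "\<And>b. b \<in> B \<Longrightarrow> \<pi> \<cdot> q b \<in> homs C X S" by (rule p)
  next
    fix x assume x: "x \<in> FOb F S" and z: "\<forall>b \<in> B. FArr F (\<epsilon> b \<cdot> \<iota>) x = 0"
    then have "\<And>b. b \<in> B \<Longrightarrow> FArr F (\<epsilon> b) (FArr F \<iota> x) = 0" using Fs[OF _ x] by simp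
    then have "FArr F \<iota> x = 0" using q\<epsilon>[OF FArr_mem[OF \<iota> x]] FArr_0[OF q] by simp
    then show "x = 0" using F\<pi>\<iota>[OF x] FArr_0[OF \<pi>(1)] by simp
  next
    fix t assume t: "t \<in> FOb F X"
    \<comment> \<open>This \<open>h\<close> encodes the equivariant map
      \<open>m \<mapsto> m t\<close>, an invariant of \<open>H\<close>, so it comes from
      \<open>S\<close>.\<close>
    define h where "h = (\<Sum>b\<in>B. FArr F (q b) (algebra_action V k b t))"
    have h: "h \<in> FOb F H" unfolding h_def using am[OF t] by (intro hm)
    have \<epsilon>hm: "FArr F (\<epsilon> m) h = algebra_action V k m t" if "m \<in> ?M" for m
      unfolding h_def using \<epsilon>sum[OF that am[OF t]] asum[OF that] by simp
    have "FArr F (a \<sigma>) h = h" if "\<sigma> \<in> ?G" for \<sigma>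
    proof (rule hom_object_joint_mono[OF B HO FArr_mem[OF a h] h])
      show \<sigma>: "\<sigma> permutes {..<k}" using that by simp
      fix m assume m: "m \<in> ?M"
      show "FArr F (\<epsilon> m) (FArr F (a \<sigma>) h) = FArr F (\<epsilon> m) h"
        using schur_action_FArr[OF V act \<sigma>[unfolded k_def] m h] \<epsilon>hm[OF m]
          \<epsilon>hm[OF specht_module_translate[OF \<sigma>[unfolded k_def] m]] algebra_action_translate[OF V \<sigma>, of t m] t
        by (simp add: k_def X_def)
    qed
    then have "FArr F e h = h" using efix[OF h] by blast
    then have \<iota>h: "FArr F \<iota> (FArr F \<pi> h) = h" using F\<pi>[OF h] by simp
    show "\<exists>x \<in> FOb F S. \<forall>b \<in> B. FArr F (\<epsilon> b \<cdot> \<iota>) x = algebra_action V k b t"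
      using FArr_mem[OF \<pi>(1) h] Fs \<iota>h \<epsilon>hm bM by (intro bexI[of _ "FArr F \<pi> h"]) auto
  next
    fix L t assume L: "linear_on (FScale F) (FOb F X) (FOb F X) L" and t: "t \<in> FOb F X"
      and z: "\<forall>b \<in> B. FArr F (\<pi> \<cdot> q b) (L (algebra_action V k b t)) = 0"
    have Lm: "\<And>x. x \<in> FOb F X \<Longrightarrow> L x \<in> FOb F X" and Lscale: "\<And>c x. x \<in> FOb F X \<Longrightarrow> L (c *\<^sub>v x) = c *\<^sub>v L x"
      using L unfolding linear_on_def by blast+
    let ?y = "\<lambda>b. L (algebra_action V k b t)"
    have y: "?y b \<in> FOb F X" for b using Lm am[OF t] by blast
    \<comment> \<open>Now \<open>h\<close> encodes \<open>m \<mapsto> L (m t)\<close>, which need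
      not be equivariant; the assumption on the \<open>p b\<close> says that its projection to the
      invariants vanishes.\<close>
    define h where "h = (\<Sum>b\<in>B. FArr F (q b) (?y b))"
    have h: "h \<in> FOb F H" unfolding h_def using y by (intro hm)
    have \<epsilon>hm: "FArr F (\<epsilon> m) h = L (algebra_action V k m t)" if "m \<in> ?M" for m
    proof -
      have "FArr F (\<epsilon> m) h = (\<Sum>b\<in>B. \<kappa> b m *\<^sub>v ?y b)" unfolding h_def by (rule \<epsilon>sum[OF that y])
      also have "\<dots> = L (\<Sum>b\<in>B. \<kappa> b m *\<^sub>v algebra_action V k b t)"
        using am[OF t] FOb_scale[OF X] Lscale by (simp add: linear_on_sum[OF L X])
      finally show ?thesis using asum[OF that] by simp
    qed
    have "FArr F \<pi> h = (\<Sum>b\<in>B. FArr F \<pi> (FArr F (q b) (?y b)))"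
      unfolding h_def using qm y by (intro FArr_sum[OF \<pi>(1)]) blast
    also have "\<dots> = 0" using z FArr_Comp[OF q \<pi>(1) y] by simp
    finally have "FArr F e h = 0" using F\<pi>[OF h] FArr_0[OF \<iota>] by simp
    then have a0: "(\<Sum>\<sigma>\<in>?G. FArr F (a \<sigma>) h) = 0" using Fe[OF h] by simp
    \<comment> \<open>The vanishing average is evaluated at the generator of the Specht
      module.\<close>
    let ?c = "young_symmetrizer u :: (nat \<Rightarrow> nat) \<Rightarrow> 'e"
    have c: "?c \<in> ?M" by (rule young_symmetrizer_in_specht_module)
    have "0 = FArr F (\<epsilon> ?c) (\<Sum>\<sigma>\<in>?G. FArr F (a \<sigma>) h)" using a0 FArr_0[OF \<epsilon>h[OF c]] by simp
    also have "\<dots> = (\<Sum>\<sigma>\<in>?G. FArr F (\<epsilon> ?c) (FArr F (a \<sigma>) h))"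
      using FArr_mem[OF a h] by (intro FArr_sum[OF \<epsilon>h[OF c]]) blast
    also have "\<dots> = (\<Sum>\<sigma>\<in>?G. FArr F (perm_arrow C V k \<sigma>) (L (algebra_action V k (left_translate (inv \<sigma>) ?c) t)))"
    proof (rule sum.cong[OF refl])
      fix \<sigma> assume "\<sigma> \<in> ?G"
      then have \<sigma>: "\<sigma> permutes {..<sum_list u}" by (simp add: k_def)
      show "FArr F (\<epsilon> ?c) (FArr F (a \<sigma>) h) =
          FArr F (perm_arrow C V k \<sigma>) (L (algebra_action V k (left_translate (inv \<sigma>) ?c) t))"
        using schur_action_FArr[OF V act \<sigma> c h] \<epsilon>hm[OF specht_module_translate[OF \<sigma> c]] by (simp add: k_def)
    qed
    finally show "(\<Sum>\<sigma>\<in>?G. FArr F (perm_arrow C V k \<sigma>) (L (algebra_action V k (left_translate (inv \<sigma>) ?c) t))) = 0"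
      by simp
  qed
qed

end

section \<open>The Young symmetrizer\<close>

lemma sum_list_take_Suc: "i < length u \<Longrightarrow> sum_list (take (Suc i) u) = sum_list (take i u) + (u ! i :: nat)"
  by (simp add: take_Suc_conv_app_nth)

lemma sum_list_take_mono: "i \<le> j \<Longrightarrow> sum_list (take i u) \<le> (sum_list (take j u) :: nat)"
proof (induction j rule: dec_induct)
  case (step n)
  then show ?case by (cases "n < length u") (simp_all add: sum_list_take_Suc)
qed simp

lemma tableau_row_iff:
  "b \<in> tableau_row u i \<longleftrightarrow> sum_list (take i u) \<le> b \<and> b < sum_list (take i u) + u ! i"
  unfolding tableau_row_def by (auto simp: le_iff_add)

lemma tableau_row_unique:
  assumes "i < length u" "j < length u" "b \<in> tableau_row u i" "b \<in> tableau_row u j"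
  shows "i = j"
proof -
  have *: False if "i < j" "i < length u" "b \<in> tableau_row u i" "b \<in> tableau_row u j" for i j
    using that sum_list_take_mono[of "Suc i" j u] by (auto simp: tableau_row_iff sum_list_take_Suc)
  show ?thesis using *[of i j] *[of j i] assms by (meson linorder_neqE_nat)
qed

lemma tableau_row_less: "i < length u \<Longrightarrow> b \<in> tableau_row u i \<Longrightarrow> b < sum_list u"
  using sum_list_take_mono[of "Suc i" "length u" u] by (auto simp: tableau_row_iff sum_list_take_Suc)

lemma ex_tableau_row:
  assumes "b < sum_list u" shows "\<exists>i < length u. b \<in> tableau_row u i"
proof -
  define i where "i = (LEAST i. b < sum_list (take (Suc i) u))"
  have ne: "u \<noteq> []" using assms by auto
  then have len: "b < sum_list (take (Suc (length u - 1)) u)" using assms by simp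
  have i: "b < sum_list (take (Suc i) u)" unfolding i_def by (rule LeastI[of _ "length u - 1"]) (rule len)
  have "i \<le> length u - 1" unfolding i_def by (rule Least_le) (rule len)
  then have il: "i < length u" using ne by (cases u) auto
  have "sum_list (take i u) \<le> b"
  proof (cases i)
    case (Suc j)
    then have "\<not> b < sum_list (take (Suc j) u)" using not_less_Least[of j "\<lambda>i. b < sum_list (take (Suc i) u)"] unfolding i_def by simp
    then show ?thesis using Suc by simp
  qed simp
  then show ?thesis using i il by (auto simp: tableau_row_iff sum_list_take_Suc)
qed

definition row_index :: "nat list \<Rightarrow> nat \<Rightarrow> nat" where
  "row_index u b = (THE i. i < length u \<and> b \<in> tableau_row u i)"

lemma row_index:
  assumes "b < sum_list u" shows "row_index u b < length u" "b \<in> tableau_row u (row_index u b)"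
proof -
  have "\<exists>!i. i < length u \<and> b \<in> tableau_row u i"
    using ex_tableau_row[OF assms] tableau_row_unique by blast
  then show "row_index u b < length u" "b \<in> tableau_row u (row_index u b)"
    using theI'[of "\<lambda>i. i < length u \<and> b \<in> tableau_row u i"] unfolding row_index_def by blast+
qed

lemma row_index_eq: "i < length u \<Longrightarrow> b \<in> tableau_row u i \<Longrightarrow> row_index u b = i"
  using row_index tableau_row_less tableau_row_unique by blast

text \<open>Stability of rows becomes invariance of a labelling of boxes; the inverse matches the
  way permutations act on the labels of a tensor.\<close>

lemma row_group_iff:
  "\<pi> \<in> row_group u \<longleftrightarrow> \<pi> permutes {..<sum_list u} \<and> (\<forall>b < sum_list u. row_index u (inv \<pi> b) = row_index u b)"
proof (intro iffI conjI allI impI)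
  assume \<pi>: "\<pi> \<in> row_group u"
  then show p: "\<pi> permutes {..<sum_list u}" by (simp add: row_group_def)
  fix b assume b: "b < sum_list u"
  note r = row_index[OF b]
  have "b \<in> \<pi> ` tableau_row u (row_index u b)" using \<pi> r by (auto simp: row_group_def)
  then have "inv \<pi> b \<in> tableau_row u (row_index u b)" using permutes_inverses(2)[OF p] by auto
  then show "row_index u (inv \<pi> b) = row_index u b" using row_index_eq r by blast
next
  assume "\<pi> permutes {..<sum_list u} \<and> (\<forall>b < sum_list u. row_index u (inv \<pi> b) = row_index u b)"
  then have p: "\<pi> permutes {..<sum_list u}" and r: "\<And>b. b < sum_list u \<Longrightarrow> row_index u (inv \<pi> b) = row_index u b"
    by auto
  have "\<pi> ` tableau_row u i = tableau_row u i" if i: "i < length u" for i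
  proof
    show "\<pi> ` tableau_row u i \<subseteq> tableau_row u i"
    proof
      fix y assume "y \<in> \<pi> ` tableau_row u i"
      then obtain x where x: "x \<in> tableau_row u i" "y = \<pi> x" by auto
      have "y < sum_list u" using tableau_row_less[OF i x(1)] permutes_in_image[OF p, of x] x by simp
      then show "y \<in> tableau_row u i"
        using r[of y] x permutes_inverses(2)[OF p, of x] row_index_eq[OF i x(1)] row_index by metis
    qed
    show "tableau_row u i \<subseteq> \<pi> ` tableau_row u i"
    proof
      fix y assume y: "y \<in> tableau_row u i"
      have yl: "y < sum_list u" using tableau_row_less[OF i y] .
      then have "inv \<pi> y < sum_list u" using permutes_in_image[OF permutes_inv[OF p], of y] by simp
      then have "inv \<pi> y \<in> tableau_row u i" using r[OF yl] row_index_eq[OF i y] row_index by metis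
      then show "y \<in> \<pi> ` tableau_row u i" using permutes_inverses(1)[OF p, of y] by (metis imageI)
    qed
  qed
  then show "\<pi> \<in> row_group u" using p by (simp add: row_group_def)
qed

lemma row_group_inv_comp:
  assumes "\<sigma> \<in> row_group u" "\<pi> \<in> row_group u" shows "inv \<sigma> \<circ> \<pi> \<in> row_group u"
proof -
  have p: "\<sigma> permutes {..<sum_list u}" "\<pi> permutes {..<sum_list u}" using assms by (auto simp: row_group_def)
  have "inv \<sigma> ` tableau_row u i = tableau_row u i" if "i < length u" for i
  proof -
    have "inv \<sigma> ` (\<sigma> ` tableau_row u i) = tableau_row u i"
      using permutes_inv_o(2)[OF p(1)] by (simp add: image_comp)
    then show ?thesis using assms(1) that by (simp add: row_group_def)
  qed
  then show ?thesis using assms permutes_compose[OF p(2) permutes_inv[OF p(1)]]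
    by (simp only: row_group_def mem_Collect_eq image_comp[symmetric]) simp
qed

lemma id_in_row_group: "id \<in> row_group u" and id_in_column_group: "id \<in> column_group u"
  by (auto simp: row_group_def column_group_def permutes_id)

text \<open>A box is determined by its row and its column.\<close>

lemma row_group_column_group:
  assumes "\<sigma> \<in> row_group u" "\<sigma> \<in> column_group u" shows "\<sigma> = id"
proof
  fix b
  have p: "\<sigma> permutes {..<sum_list u}" using assms by (simp add: row_group_def)
  show "\<sigma> b = id b"
  proof (cases "b < sum_list u")
    case True
    let ?i = "row_index u b"
    note r = row_index[OF True]
    obtain j where j: "b = sum_list (take ?i u) + j" "j < u ! ?i" using r(2) unfolding tableau_row_def by blast
    have "b \<in> tableau_column u j" unfolding tableau_column_def using j r(1) by blast
    then have "\<sigma> b \<in> tableau_column u j" using assms(2) by (auto simp: column_group_def)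
    then obtain i where i: "\<sigma> b = sum_list (take i u) + j" "i < length u" "j < u ! i"
      unfolding tableau_column_def by blast
    then have "\<sigma> b \<in> tableau_row u i" by (simp add: tableau_row_iff)
    moreover have "\<sigma> b \<in> tableau_row u ?i" using assms(1) r by (auto simp: row_group_def)
    ultimately have "i = ?i" using tableau_row_unique i(2) r(1) by blast
    then show ?thesis using i(1) j(1) by simp
  next
    case False
    then show ?thesis using permutes_not_in[OF p] by simp
  qed
qed

text \<open>In the convolution only \<open>\<sigma> = \<pi>\<close> contributes: otherwise
  \<open>inv \<sigma> \<circ> \<pi>\<close> would be a nontrivial permutation in both the row and
  the column group.\<close>

lemma young_symmetrizer_row_group:
  assumes "\<pi> \<in> row_group u" shows "young_symmetrizer u \<pi> = (1 :: 'e::field)"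
proof -
  let ?k = "sum_list u"
  have p: "\<pi> permutes {..<?k}" using assms by (simp add: row_group_def)
  have "young_symmetrizer u \<pi> = (\<Sum>\<sigma> | \<sigma> permutes {..<?k}. (if \<sigma> \<in> row_group u then 1 else 0) *
      (if inv \<sigma> \<circ> \<pi> \<in> column_group u then of_int (sign (inv \<sigma> \<circ> \<pi>)) else 0 :: 'e))"
    using p by (simp add: young_symmetrizer_def group_algebra_mult_def)
  also have "\<dots> = (\<Sum>\<sigma> | \<sigma> permutes {..<?k}. if \<sigma> = \<pi> then 1 else 0)"
  proof (rule sum.cong[OF refl])
    fix \<sigma> assume "\<sigma> \<in> {\<sigma>. \<sigma> permutes {..<?k}}"
    then have s: "\<sigma> permutes {..<?k}" by simp
    show "(if \<sigma> \<in> row_group u then 1 else 0) *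
      (if inv \<sigma> \<circ> \<pi> \<in> column_group u then of_int (sign (inv \<sigma> \<circ> \<pi>)) else 0 :: 'e) = (if \<sigma> = \<pi> then 1 else 0)"
    proof (cases "\<sigma> = \<pi>")
      case True
      then show ?thesis using assms permutes_inv_o(2)[OF p] id_in_column_group by (simp add: sign_id)
    next
      case False
      have "inv \<sigma> \<circ> \<pi> \<notin> column_group u" if "\<sigma> \<in> row_group u"
      proof
        assume "inv \<sigma> \<circ> \<pi> \<in> column_group u"
        then have "inv \<sigma> \<circ> \<pi> = id" using row_group_column_group row_group_inv_comp[OF that assms] by blast
        then have "\<sigma> \<circ> (inv \<sigma> \<circ> \<pi>) = \<sigma>" by simp
        then show False using permutes_inv_o(1)[OF s] False by (simp add: comp_assoc[symmetric])
      qed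
      then show ?thesis using False by auto
    qed
  qed
  also have "\<dots> = 1" using p by (simp add: finite_permutations)
  finally show ?thesis .
qed

text \<open>Permuting places does not change how often each label occurs, so agreement at all places
  but one forces agreement at the last.\<close>

lemma permutes_agree_except_one:
  fixes k :: nat
  assumes p: "\<rho> permutes {..<k}" and b\<^sub>0: "b\<^sub>0 < k" and eq: "\<And>b. b < k \<Longrightarrow> b \<noteq> b\<^sub>0 \<Longrightarrow> f (\<rho> b) = f b"
  shows "f (\<rho> b\<^sub>0) = f b\<^sub>0"
proof (rule ccontr)
  assume ne: "f (\<rho> b\<^sub>0) \<noteq> f b\<^sub>0"
  let ?A = "{b \<in> {..<k}. f b = f b\<^sub>0}" and ?A' = "{b \<in> {..<k}. f (\<rho> b) = f b\<^sub>0}"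
  have "\<rho> ` ?A' = ?A"
  proof
    show "\<rho> ` ?A' \<subseteq> ?A" using permutes_in_image[OF p] by auto
    show "?A \<subseteq> \<rho> ` ?A'"
    proof
      fix b assume b: "b \<in> ?A"
      then have "inv \<rho> b \<in> ?A'" using permutes_in_image[OF permutes_inv[OF p], of b] permutes_inverses(1)[OF p] by simp
      then show "b \<in> \<rho> ` ?A'" using permutes_inverses(1)[OF p, of b] by (metis imageI)
    qed
  qed
  then have "card ?A = card ?A'" using card_image[OF permutes_inj_on[OF p], of ?A'] by simp
  moreover have "?A' \<subset> ?A"
  proof
    show "?A' \<subseteq> ?A"
    proof
      fix b assume b: "b \<in> ?A'"
      then have "b \<noteq> b\<^sub>0" using ne by blast
      then have "f (\<rho> b) = f b" using b by (intro eq) simp_all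
      then show "b \<in> ?A" using b by auto
    qed
    show "?A' \<noteq> ?A" using ne b\<^sub>0 by blast
  qed
  moreover have "finite ?A" by (rule finite_subset[of _ "{..<k}"]) auto
  ultimately show False using psubset_card_mono[of ?A ?A'] by linarith
qed

text \<open>The coefficient of the tensor with labelling \<open>g\<close> in \<open>\<Sum>\<sigma>. \<sigma> L\<^sub>l \<sigma>\<^sup>-\<^sup>1 c T\<close>, where \<open>c\<close> is the Young
  symmetrizer, \<open>T\<close> a tensor of basis vectors and \<open>L\<^sub>l\<close> the matrix \<open>x\<close> acting on the factor \<open>l\<close>.\<close>

definition derivation_coefficient ::
  "nat list \<Rightarrow> nat \<Rightarrow> ('b \<Rightarrow> 'b \<Rightarrow> 'e::field) \<Rightarrow> (nat \<Rightarrow> 'b) \<Rightarrow> (nat \<Rightarrow> 'b) \<Rightarrow> 'e" where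
  "derivation_coefficient u l x T g = (\<Sum>\<sigma> | \<sigma> permutes {..<sum_list u}. \<Sum>\<pi> | \<pi> permutes {..<sum_list u}.
    young_symmetrizer u \<pi> * (if \<forall>b < sum_list u. b \<noteq> \<sigma> l \<longrightarrow> T (inv \<pi> b) = g b
      then x (g (\<sigma> l)) (T (inv \<pi> (\<sigma> l))) else 0))"

text \<open>Distinct rows carry distinct labels, so \<open>\<pi>\<close> preserves the labelling
  \<open>T\<close> exactly if it lies in the row group. Where the labels match, \<open>S\<close>
  makes the permuted \<open>T\<close> agree with \<open>T\<close> off one place, and counting labels
  gives the remaining place. Only row permutations survive; there the Young symmetrizer is 1, so no
  signs of column permutations enter. \<open>Q\<close> singles out the \<open>\<sigma>\<close> that
  contribute.\<close>

lemma derivation_coefficient_eq: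
  fixes t :: "nat \<Rightarrow> 'b" and x :: "'b \<Rightarrow> 'b \<Rightarrow> 'e::field"
  assumes l: "l < sum_list u" and t: "inj_on t {..<length u}"
  defines "T \<equiv> t \<circ> row_index u"
  assumes S: "\<And>\<sigma> \<pi>. \<sigma> permutes {..<sum_list u} \<Longrightarrow> \<pi> permutes {..<sum_list u} \<Longrightarrow>
      \<forall>b < sum_list u. b \<noteq> \<sigma> l \<longrightarrow> T (inv \<pi> b) = g b \<Longrightarrow> Q \<sigma> \<and> (\<forall>b < sum_list u. b \<noteq> \<sigma> l \<longrightarrow> g b = T b)"
    and Q: "\<And>\<sigma>. Q \<sigma> \<Longrightarrow> \<forall>b < sum_list u. b \<noteq> \<sigma> l \<longrightarrow> g b = T b"
  shows "derivation_coefficient u l x T g =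
    of_nat (card (row_group u)) * (\<Sum>\<sigma> | \<sigma> permutes {..<sum_list u} \<and> Q \<sigma>. x (g (\<sigma> l)) (T (\<sigma> l)))"
proof -
  let ?k = "sum_list u" and ?G = "{\<sigma>. \<sigma> permutes {..<sum_list u}}"
  have fin: "finite ?G" by (simp add: finite_permutations)
  have RG: "row_group u \<subseteq> ?G" by (auto simp: row_group_def)
  have R: "\<pi> \<in> row_group u \<longleftrightarrow> (\<forall>b < ?k. T (inv \<pi> b) = T b)" if \<pi>: "\<pi> permutes {..<?k}" for \<pi>
  proof -
    have "inv \<pi> b < ?k" if "b < ?k" for b using permutes_in_image[OF permutes_inv[OF \<pi>], of b] that by simp
    then have "T (inv \<pi> b) = T b \<longleftrightarrow> row_index u (inv \<pi> b) = row_index u b" if "b < ?k" for b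
      using inj_on_eq_iff[OF t] row_index(1) that by (simp add: T_def)
    then show ?thesis using \<pi> by (auto simp: row_group_iff)
  qed
  have eq: "young_symmetrizer u \<pi> * (if \<forall>b < ?k. b \<noteq> \<sigma> l \<longrightarrow> T (inv \<pi> b) = g b
      then x (g (\<sigma> l)) (T (inv \<pi> (\<sigma> l))) else 0) =
      (if \<pi> \<in> row_group u then (if Q \<sigma> then x (g (\<sigma> l)) (T (\<sigma> l)) else 0) else 0)"
    if \<sigma>: "\<sigma> \<in> ?G" and \<pi>: "\<pi> \<in> ?G" for \<sigma> \<pi>
  proof (cases "\<forall>b < ?k. b \<noteq> \<sigma> l \<longrightarrow> T (inv \<pi> b) = g b")
    case True
    have "\<sigma> permutes {..<?k}" "\<pi> permutes {..<?k}" using \<sigma> \<pi> by simp_all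
    then have q: "Q \<sigma>" "\<forall>b < ?k. b \<noteq> \<sigma> l \<longrightarrow> g b = T b" using S[of \<sigma> \<pi>] True by simp_all
    have \<sigma>l: "\<sigma> l < ?k" using permutes_in_image[of \<sigma> "{..<?k}" l] \<sigma> l by simp
    have "T (inv \<pi> (\<sigma> l)) = T (\<sigma> l)"
    proof (rule permutes_agree_except_one[of "inv \<pi>" ?k])
      show "inv \<pi> permutes {..<?k}" using \<pi> permutes_inv by blast
      show "T (inv \<pi> b) = T b" if "b < ?k" "b \<noteq> \<sigma> l" for b using True q(2) that by simp
    qed (rule \<sigma>l)
    moreover have "T (inv \<pi> b) = T b" if "b < ?k" "b \<noteq> \<sigma> l" for b using True q(2) that by simp
    ultimately have "\<forall>b < ?k. T (inv \<pi> b) = T b" by blast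
    then have "\<pi> \<in> row_group u" using R[of \<pi>] \<pi> by blast
    with \<open>T (inv \<pi> (\<sigma> l)) = T (\<sigma> l)\<close> show ?thesis using True q by (simp add: young_symmetrizer_row_group)
  next
    case False
    have "\<pi> \<notin> row_group u" if "Q \<sigma>"
    proof
      assume "\<pi> \<in> row_group u"
      then have "\<forall>b < ?k. T (inv \<pi> b) = T b" using R \<pi> by blast
      then show False using False Q[OF that] by simp
    qed
    then show ?thesis unfolding if_not_P[OF False] by simp
  qed
  have "derivation_coefficient u l x T g =
      (\<Sum>\<sigma>\<in>?G. \<Sum>\<pi>\<in>?G. if \<pi> \<in> row_group u then (if Q \<sigma> then x (g (\<sigma> l)) (T (\<sigma> l)) else 0) else 0)"
    unfolding derivation_coefficient_def by (intro sum.cong refl eq)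
  also have "\<dots> = (\<Sum>\<sigma>\<in>?G. of_nat (card (row_group u)) * (if Q \<sigma> then x (g (\<sigma> l)) (T (\<sigma> l)) else 0))"
    using fin RG by (simp add: sum.inter_restrict[symmetric] Int_absorb1)
  also have "\<dots> = of_nat (card (row_group u)) * (\<Sum>\<sigma>\<in>?G. if Q \<sigma> then x (g (\<sigma> l)) (T (\<sigma> l)) else 0)"
    by (simp add: sum_distrib_left)
  also have "(\<Sum>\<sigma>\<in>?G. if Q \<sigma> then x (g (\<sigma> l)) (T (\<sigma> l)) else 0) =
      (\<Sum>\<sigma> | \<sigma> permutes {..<sum_list u} \<and> Q \<sigma>. x (g (\<sigma> l)) (T (\<sigma> l)))"
    using sum.inter_filter[OF fin, of "\<lambda>\<sigma>. x (g (\<sigma> l)) (T (\<sigma> l))" Q] by simp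
  finally show ?thesis .
qed

text \<open>\<open>j\<close> labels the first row and \<open>i\<close> labels no row. The other
  \<open>r - 1\<close> rows draw on \<open>card \<B> - 2\<close> vectors, which suffice because
  \<open>r < card \<B>\<close>.\<close>

lemma ex_row_labelling:
  assumes "finite \<B>" "r < card \<B>" "i \<in> \<B>" "j \<in> \<B>" "i \<noteq> j" "0 < r"
  shows "\<exists>t :: nat \<Rightarrow> 'b. inj_on t {..<r} \<and> t ` {..<r} \<subseteq> \<B> - {i} \<and> t 0 = j"
proof -
  have c: "card (\<B> - {i, j}) = card \<B> - 2" using assms by (simp add: card_Diff_subset)
  have "card {1..<r} \<le> card (\<B> - {i, j})" using c assms by simp
  then obtain t where t: "inj_on t {1..<r}" "t ` {1..<r} \<subseteq> \<B> - {i, j}"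
    using card_le_inj[of "{1..<r}" "\<B> - {i, j}"] assms(1) by auto
  let ?t = "t(0 := j)"
  have r: "{..<r} = insert 0 {1..<r}" using assms by auto
  have im: "?t ` {1..<r} = t ` {1..<r}" by auto
  have "inj_on ?t {1..<r}" using t(1) by (auto simp: inj_on_def)
  then have "inj_on ?t {..<r}" unfolding r inj_on_insert im using t(2) by auto
  moreover have "?t ` {..<r} \<subseteq> \<B> - {i}" unfolding r image_insert im using t(2) assms by auto
  ultimately show ?thesis by (intro exI[of _ ?t]) simp
qed

text \<open>Relabelling one box by a vector absent from \<open>T\<close> isolates an off-diagonal
  entry, while the coefficient of \<open>T\<close> itself is a weighted trace. Moving the first row
  to the free label shows that the diagonal is constant, and then the weighted trace is a positive
  multiple of its entry.\<close>

lemma derivation_coefficients_vanish: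
  fixes x :: "'b \<Rightarrow> 'b \<Rightarrow> 'e::field_char_0"
  assumes \<B>: "finite \<B>" "length u < card \<B>" and u: "u \<noteq> []" "\<forall>m \<in> set u. 0 < m" and l: "l < sum_list u"
    and vanish: "\<And>t g. inj_on t {..<length u} \<Longrightarrow> t ` {..<length u} \<subseteq> \<B> \<Longrightarrow> (\<And>b. b < sum_list u \<Longrightarrow> g b \<in> \<B>) \<Longrightarrow>
      derivation_coefficient u l x (t \<circ> row_index u) g = 0"
    and ij: "i \<in> \<B>" "j \<in> \<B>"
  shows "x i j = 0"
proof -
  let ?k = "sum_list u" and ?G = "{\<sigma>. \<sigma> permutes {..<sum_list u}}"
  have fin: "finite ?G" by (simp add: finite_permutations)
  have len: "0 < length u" using u by simp
  have row0: "0 \<in> tableau_row u 0" using u by (cases u) (auto simp: tableau_row_iff)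
  have r0: "row_index u 0 = 0" using row_index_eq[OF len row0] .
  have k0: "0 < ?k" using l by simp
  have "finite (row_group u)" using fin by (rule finite_subset[rotated]) (auto simp: row_group_def)
  then have cR: "of_nat (card (row_group u)) \<noteq> (0 :: 'e)" using id_in_row_group[of u] by auto
  \<comment> \<open>A permutation carrying \<open>l\<close> to box \<open>0\<close>: it shows that
    the numbers of permutations multiplying \<open>x i j\<close> and \<open>x i i - x j j\<close>
    are not zero.\<close>
  have tr: "Transposition.transpose l 0 permutes {..<?k}" by (rule permutes_swap_id) (use l k0 in auto)
  have offdiag: "x i j = 0" and diag: "x i i = x j j" if ij: "i \<in> \<B>" "j \<in> \<B>" "i \<noteq> j" for i j
  proof -
    obtain t where t: "inj_on t {..<length u}" "t ` {..<length u} \<subseteq> \<B> - {i}" "t 0 = j"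
      using ex_row_labelling[OF \<B> ij len] by blast
    define T where "T = t \<circ> row_index u"
    have Tm: "T b \<in> \<B> - {i}" if "b < ?k" for b using t(2) row_index(1)[OF that] by (auto simp: T_def)
    have T0: "T 0 = j" using r0 t(3) by (simp add: T_def)
    \<comment> \<open>The label \<open>i\<close> does not occur in \<open>T\<close>, so only a
      matrix acting at box \<open>0\<close> can produce it.\<close>
    define g where "g = T(0 := i)"
    let ?Q = "\<lambda>\<sigma> :: nat \<Rightarrow> nat. \<sigma> l = 0"
    have "derivation_coefficient u l x (t \<circ> row_index u) g = 0"
      by (rule vanish[OF t(1)]) (use t(2) Tm ij in \<open>auto simp: g_def\<close>)
    moreover have "derivation_coefficient u l x (t \<circ> row_index u) g =
        of_nat (card (row_group u)) * (\<Sum>\<sigma> | \<sigma> permutes {..<?k} \<and> \<sigma> l = 0. x (g (\<sigma> l)) ((t \<circ> row_index u) (\<sigma> l)))"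
    proof (rule derivation_coefficient_eq[OF l t(1)])
      show "\<forall>b < ?k. b \<noteq> \<sigma> l \<longrightarrow> g b = (t \<circ> row_index u) b" if "\<sigma> l = 0" for \<sigma> :: "nat \<Rightarrow> nat"
        using that by (simp add: g_def T_def)
      fix \<sigma> \<pi> assume \<sigma>: "\<sigma> permutes {..<?k}" and \<pi>: "\<pi> permutes {..<?k}"
        and eq: "\<forall>b < ?k. b \<noteq> \<sigma> l \<longrightarrow> (t \<circ> row_index u) (inv \<pi> b) = g b"
      have "inv \<pi> 0 < ?k" using permutes_in_image[OF permutes_inv[OF \<pi>], of 0] k0 by simp
      then have "T (inv \<pi> 0) \<noteq> i" using Tm by blast
      moreover have "g 0 = i" by (simp add: g_def)
      ultimately have "\<sigma> l = 0" using eq k0 unfolding T_def[symmetric] by fastforce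
      then show "\<sigma> l = 0 \<and> (\<forall>b < ?k. b \<noteq> \<sigma> l \<longrightarrow> g b = (t \<circ> row_index u) b)" by (simp add: g_def T_def)
    qed
    moreover have "(\<Sum>\<sigma> | \<sigma> permutes {..<?k} \<and> \<sigma> l = 0. x (g (\<sigma> l)) ((t \<circ> row_index u) (\<sigma> l))) =
        of_nat (card {\<sigma>. \<sigma> permutes {..<?k} \<and> \<sigma> l = 0}) * x i j"
      using T0 by (simp add: g_def T_def)
    moreover have "card {\<sigma>. \<sigma> permutes {..<?k} \<and> \<sigma> l = 0} \<noteq> 0"
    proof -
      have "Transposition.transpose l 0 \<in> {\<sigma>. \<sigma> permutes {..<?k} \<and> \<sigma> l = 0}" using tr by simp
      then have "{\<sigma>. \<sigma> permutes {..<?k} \<and> \<sigma> l = 0} \<noteq> {}" by (rule ex_in_conv[THEN iffD1, OF exI])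
      moreover have "finite {\<sigma>. \<sigma> permutes {..<?k} \<and> \<sigma> l = 0}" using fin by (rule finite_subset[rotated]) auto
      ultimately show ?thesis by (simp only: card_eq_0_iff not_False_eq_True simp_thms)
    qed
    ultimately show "x i j = 0" using cR by simp
    \<comment> \<open>With \<open>g = T\<close> every \<open>\<sigma>\<close> contributes, and the
      coefficient is a trace weighted by how often each label occurs.\<close>
    have trace: "(\<Sum>\<sigma>\<in>?G. x ((t \<circ> row_index u) (\<sigma> l)) ((t \<circ> row_index u) (\<sigma> l))) = 0"
      if t: "inj_on t {..<length u}" "t ` {..<length u} \<subseteq> \<B>" for t
    proof -
      have "derivation_coefficient u l x (t \<circ> row_index u) (t \<circ> row_index u) = 0"
        by (rule vanish[OF t]) (use t row_index(1) in auto)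
      moreover have "derivation_coefficient u l x (t \<circ> row_index u) (t \<circ> row_index u) =
          of_nat (card (row_group u)) * (\<Sum>\<sigma> | \<sigma> permutes {..<?k} \<and> True.
            x ((t \<circ> row_index u) (\<sigma> l)) ((t \<circ> row_index u) (\<sigma> l)))"
        by (rule derivation_coefficient_eq[OF l t(1)]) auto
      ultimately show ?thesis using cR by simp
    qed
    \<comment> \<open>The two labellings differ only in the first row, so their weighted traces
      differ by a multiple of \<open>x i i - x j j\<close>.\<close>
    let ?t' = "t(0 := i)"
    have t': "inj_on ?t' {..<length u}" "?t' ` {..<length u} \<subseteq> \<B>"
      using t ij by (auto simp: inj_on_def)
    let ?N = "{\<sigma> \<in> ?G. row_index u (\<sigma> l) = 0}"
    have "0 = (\<Sum>\<sigma>\<in>?G. x ((?t' \<circ> row_index u) (\<sigma> l)) ((?t' \<circ> row_index u) (\<sigma> l)) -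
        x ((t \<circ> row_index u) (\<sigma> l)) ((t \<circ> row_index u) (\<sigma> l)))"
      unfolding sum_subtractf using trace[OF t'] trace[OF t(1)] t(2) by auto
    also have "\<dots> = (\<Sum>\<sigma>\<in>?G. if row_index u (\<sigma> l) = 0 then x i i - x j j else 0)"
      using t(3) by (intro sum.cong) auto
    also have "\<dots> = of_nat (card ?N) * (x i i - x j j)"
      using sum.inter_filter[OF fin, of "\<lambda>_. x i i - x j j" "\<lambda>\<sigma>. row_index u (\<sigma> l) = 0"] by simp
    finally have "of_nat (card ?N) * (x i i - x j j) = 0" by simp
    moreover have "card ?N \<noteq> 0"
    proof -
      have "Transposition.transpose l 0 \<in> ?N" using tr r0 by simp
      then have "?N \<noteq> {}" by (rule ex_in_conv[THEN iffD1, OF exI])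
      moreover have "finite ?N" using fin by simp
      ultimately show ?thesis by (simp only: card_eq_0_iff not_False_eq_True simp_thms)
    qed
    ultimately show "x i i = x j j" by simp
  qed
  \<comment> \<open>All diagonal entries agree, so the weighted trace is the order of the symmetric
    group times \<open>x i i\<close>.\<close>
  have "x i i = 0"
  proof -
    have "card {..<length u} \<le> card \<B>" using \<B> by simp
    then obtain t where t: "inj_on t {..<length u}" "t ` {..<length u} \<subseteq> \<B>"
      using card_le_inj[of "{..<length u}" \<B>] \<B> by auto
    have "derivation_coefficient u l x (t \<circ> row_index u) (t \<circ> row_index u) = 0"
      by (rule vanish[OF t]) (use t row_index(1) in auto)
    moreover have "derivation_coefficient u l x (t \<circ> row_index u) (t \<circ> row_index u) =
        of_nat (card (row_group u)) * (\<Sum>\<sigma> | \<sigma> permutes {..<?k} \<and> True.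
          x ((t \<circ> row_index u) (\<sigma> l)) ((t \<circ> row_index u) (\<sigma> l)))"
      by (rule derivation_coefficient_eq[OF l t(1)]) auto
    moreover have "x ((t \<circ> row_index u) (\<sigma> l)) ((t \<circ> row_index u) (\<sigma> l)) = x i i" if "\<sigma> permutes {..<?k}" for \<sigma>
    proof -
      have "\<sigma> l < ?k" using permutes_in_image[OF that, of l] l by simp
      then have "(t \<circ> row_index u) (\<sigma> l) \<in> \<B>" using t(2) row_index(1) by auto
      then show ?thesis using diag[OF ij(1), of "(t \<circ> row_index u) (\<sigma> l)"] by (cases "(t \<circ> row_index u) (\<sigma> l) = i") auto
    qed
    ultimately have "of_nat (card ?G) * x i i = 0" using cR by simp
    moreover have "card ?G \<noteq> 0" using card_permutations[of "{..<?k}" ?k] by simp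
    ultimately show ?thesis by simp
  qed
  then show ?thesis using offdiag[OF ij] by (cases "i = j") auto
qed

section \<open>Derivations on tensor powers\<close>

context neutral_tannakian_category
begin

lemma dual_basis:
  assumes B: "is_basis (FScale F) (FOb F A) \<B>" and fin: "finite \<B>"
  obtains \<phi> where "\<And>i. i \<in> \<B> \<Longrightarrow> functional (\<phi> i)"
    and "\<And>i j. i \<in> \<B> \<Longrightarrow> j \<in> \<B> \<Longrightarrow> \<phi> i j = (if j = i then 1 else 0)"
    and "\<And>y. y \<in> FOb F A \<Longrightarrow> y = (\<Sum>i\<in>\<B>. \<phi> i y *\<^sub>v i)"
proof -
  have ind: "V.independent \<B>" and span: "V.span \<B> = FOb F A" using B by (auto simp: is_basis_def)
  have "\<exists>\<phi>. functional \<phi> \<and> (\<forall>j \<in> \<B>. \<phi> j = (if j = i then 1 else 0))" if "i \<in> \<B>" for i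
    by (rule dual_basis_functional[OF ind that])
  then obtain \<phi> where \<phi>: "\<And>i. i \<in> \<B> \<Longrightarrow> functional (\<phi> i)"
    "\<And>i j. i \<in> \<B> \<Longrightarrow> j \<in> \<B> \<Longrightarrow> \<phi> i j = (if j = i then 1 else 0)" by metis
  have "y = (\<Sum>i\<in>\<B>. \<phi> i y *\<^sub>v i)" if y: "y \<in> FOb F A" for y
  proof -
    obtain r where r: "y = (\<Sum>j\<in>\<B>. r j *\<^sub>v j)" using y V.span_finite[OF fin] span by auto
    have "\<phi> i y = r i" if i: "i \<in> \<B>" for i
    proof -
      have "\<phi> i y = (\<Sum>j\<in>\<B>. r j * (if j = i then 1 else 0))"
        unfolding r functional_simps[OF \<phi>(1)[OF i]] using \<phi>(2)[OF i] by (intro sum.cong) auto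
      also have "\<dots> = (\<Sum>j\<in>\<B>. if j = i then r j else 0)" by (intro sum.cong) auto
      finally show ?thesis using i fin by simp
    qed
    then have "(\<Sum>i\<in>\<B>. \<phi> i y *\<^sub>v i) = (\<Sum>i\<in>\<B>. r i *\<^sub>v i)" by (intro sum.cong) auto
    then show ?thesis using r by simp
  qed
  then show thesis using that \<phi> by blast
qed

lemma pure_labelled:
  assumes V: "V \<in> Ob C" and \<phi>: "\<And>i. i \<in> \<B> \<Longrightarrow> functional (\<phi> i)" and g: "\<And>b. b < k \<Longrightarrow> g b \<in> \<B>"
  shows "\<exists>\<gamma>. functional \<gamma> \<and> (\<forall>f. (\<forall>b<k. f b \<in> FOb F V) \<longrightarrow> \<gamma> (pure V k f) = (\<Prod>b<k. \<phi> (g b) (f b)))"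
  using functional_pure[OF V, of k "\<lambda>b. \<phi> (g b)"] \<phi> g by blast

lemma dual_nonzero:
  assumes "is_dual C V V'" "\<not> is_zero_object C V" shows "\<not> is_zero_object C V'"
proof
  assume z: "is_zero_object C V'"
  have O: "V \<in> Ob C" "V' \<in> Ob C" using assms(1) by (auto simp: is_dual_def)
  have z': "FOb F V' = {0}" using z zero_object_iff[OF O(2)] by simp
  obtain \<beta> :: "'v \<Rightarrow> 'v \<Rightarrow> 'e" and N :: nat and ys \<xi>s where
    mem: "\<And>i. i < N \<Longrightarrow> \<xi>s i \<in> FOb F V'"
    and id: "\<And>x. x \<in> FOb F V \<Longrightarrow> (\<Sum>i<N. \<beta> (\<xi>s i) x *\<^sub>v ys i) = x"
    and e: "\<And>A. A \<in> Ob C \<Longrightarrow> \<exists>e \<in> homs C ((A \<otimes>\<^sub>o V') \<otimes>\<^sub>o V) A. \<forall>a \<in> FOb F A. \<forall>\<xi> \<in> FOb F V'. \<forall>x \<in> FOb F V.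
      FArr F e (tens (A \<otimes>\<^sub>o V') V (tens A V' a \<xi>) x) = \<beta> \<xi> x *\<^sub>v a"
    by (rule dual_fibre[OF assms(1)]) blast
  \<comment> \<open>\<open>dual_fibre\<close> does not state that \<open>\<beta>\<close> is linear;
    that \<open>\<beta> 0 x = 0\<close> is read off from the contraction arrow with
    \<open>A = Unit C\<close>.\<close>
  obtain e where e: "e \<in> homs C ((Unit C \<otimes>\<^sub>o V') \<otimes>\<^sub>o V) (Unit C)" "\<And>\<xi> x. \<xi> \<in> FOb F V' \<Longrightarrow> x \<in> FOb F V \<Longrightarrow>
      FArr F e (tens (Unit C \<otimes>\<^sub>o V') V (tens (Unit C) V' (FUnit F) \<xi>) x) = \<beta> \<xi> x *\<^sub>v FUnit F"
    using e[OF Unit] FUnit_mem by blast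
  have "\<beta> 0 x = 0" if x: "x \<in> FOb F V" for x
    using e(2)[of 0 x] x z' tens_0_right[OF Unit O(2) FUnit_mem] tens_0_left[OF TOb[OF Unit O(2)] O(1) x]
      FArr_0[OF e(1)] FUnit_nonzero by simp
  moreover have "\<xi>s i = 0" if "i < N" for i using mem[OF that] z' by simp
  ultimately have "x = 0" if "x \<in> FOb F V" for x using id[OF that] that by simp
  then show False using assms(2) zero_object_iff[OF O(1)] FOb_0[OF O(1)] by blast
qed

text \<open>Lists of summands end in a zero object, so \<open>V\<close> is exhibited as its own
  biproduct with zero.\<close>

lemma direct_sum_singleton:
  assumes V: "V \<in> Ob C" shows "is_direct_sum C [V] V"
proof -
  obtain Z where Z: "is_zero_object C Z" using zero_object by blast
  have ZO: "Z \<in> Ob C" and FZ: "FOb F Z = {0}" using Z zero_object_iff by (auto simp: is_zero_object_def)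
  note I = Ident_hom[OF V] and i = Zero_hom[OF ZO V] and p = Zero_hom[OF V ZO]
  have 1: "Zero C V Z \<cdot> Zero C Z V = Ident C Z"
  proof (rule FArr_faithful[OF Comp_hom[OF i p] Ident_hom[OF ZO]])
    fix x assume "x \<in> FOb F Z"
    then show "FArr F (Zero C V Z \<cdot> Zero C Z V) x = FArr F (Ident C Z) x"
      using FZ FArr_0[OF Comp_hom[OF i p]] FArr_0[OF Ident_hom[OF ZO]] by simp
  qed
  have 2: "Add C (Ident C V \<cdot> Ident C V) (Zero C Z V \<cdot> Zero C V Z) = Ident C V"
  proof (rule FArr_faithful[OF Add_hom[OF Comp_hom[OF I I] Comp_hom[OF p i]] I])
    fix x assume x: "x \<in> FOb F V"
    show "FArr F (Add C (Ident C V \<cdot> Ident C V) (Zero C Z V \<cdot> Zero C V Z)) x = FArr F (Ident C V) x"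
      using FArr_Add[OF Comp_hom[OF I I] Comp_hom[OF p i] x] FArr_Comp[OF I I x] FArr_Comp[OF p i x]
        FArr_Zero[OF V ZO x] FArr_0[OF i] FArr_Ident[OF V x] by simp
  qed
  have "is_biproduct C V Z V"
    unfolding is_biproduct_def
    by (intro bexI[OF _ I] bexI[OF _ i] bexI[OF _ p] conjI 1 2 Comp_Ident_left[OF I] Comp_Ident_left[OF i]
        Comp_Ident_right[OF p])
  then show ?thesis using is_direct_sum.Cons[OF is_direct_sum.Nil[OF Z]] by simp
qed

end

context tannakian_char_0
begin

text \<open>\<open>L'\<close> is \<open>L\<close> acting on the last tensor factor; averaging its conjugates under the symmetric
  group gives, up to a scalar, the derivation of \<open>V\<^sup>\<otimes>\<^sup>k\<close> extending \<open>L\<close>.\<close>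

lemma derivation_faithful:
  assumes V: "V \<in> Ob C" and u: "u \<noteq> []" "\<forall>m \<in> set u. 0 < m" "length u < fdim F V" and k: "sum_list u = Suc k"
    and L: "linear_on (FScale F) (FOb F V) (FOb F V) L"
    and L': "linear_on (FScale F) (FOb F (tensor_power C V (Suc k))) (FOb F (tensor_power C V (Suc k))) L'"
    and pure: "\<And>f. (\<And>i. i < Suc k \<Longrightarrow> f i \<in> FOb F V) \<Longrightarrow> L' (pure V (Suc k) f) = pure V (Suc k) (f(k := L (f k)))"
    and vanish: "\<And>t. t \<in> FOb F (tensor_power C V (Suc k)) \<Longrightarrow> (\<Sum>\<sigma> | \<sigma> permutes {..<Suc k}.
      FArr F (perm_arrow C V (Suc k) \<sigma>)
        (L' (algebra_action V (Suc k) (left_translate (inv \<sigma>) (young_symmetrizer u)) t))) = 0"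
    and v: "v \<in> FOb F V"
  shows "L v = 0"
proof -
  let ?k = "Suc k" and ?G = "{\<sigma>. \<sigma> permutes {..<Suc k}}" and ?c = "young_symmetrizer u :: (nat \<Rightarrow> nat) \<Rightarrow> 'e"
  let ?X = "tensor_power C V (Suc k)"
  note X = tensor_power_Ob[OF V, of "Suc k"]
  obtain \<B> where \<B>: "is_basis (FScale F) (FOb F V) \<B>" "\<B> \<subseteq> FOb F V" "finite \<B>" "card \<B> = fdim F V"
    using ex_basis[OF V] by blast
  obtain \<phi> where \<phi>: "\<And>i. i \<in> \<B> \<Longrightarrow> functional (\<phi> i)"
    and \<delta>: "\<And>i j. i \<in> \<B> \<Longrightarrow> j \<in> \<B> \<Longrightarrow> \<phi> i j = (if j = i then 1 else 0)"
    and exp: "\<And>y. y \<in> FOb F V \<Longrightarrow> y = (\<Sum>i\<in>\<B>. \<phi> i y *\<^sub>v i)"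
    by (rule dual_basis[OF \<B>(1,3)]) blast
  have fin: "finite ?G" by (simp add: finite_permutations)
  have Lm: "\<And>x. x \<in> FOb F V \<Longrightarrow> L x \<in> FOb F V" and Lscale: "\<And>c x. x \<in> FOb F V \<Longrightarrow> L (c *\<^sub>v x) = c *\<^sub>v L x"
    using L unfolding linear_on_def by blast+
  have L'scale: "\<And>c x. x \<in> FOb F ?X \<Longrightarrow> L' (c *\<^sub>v x) = c *\<^sub>v L' x"
    using L' unfolding linear_on_def by blast
  \<comment> \<open>The labels after \<open>L\<close> has been applied at place
    \<open>\<sigma> k\<close> of the tensor with labels \<open>T\<close> permuted by
    \<open>\<pi>\<close>. Conjugating by \<open>\<sigma>\<close> moves the last place
    \<open>k\<close> to \<open>\<sigma> k\<close>.\<close>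
  define W where "W T \<sigma> \<pi> b = (if b = \<sigma> k then L (T (inv \<pi> (\<sigma> k))) else T (inv \<pi> b))"
    for T :: "nat \<Rightarrow> 'v" and \<sigma> \<pi> :: "nat \<Rightarrow> nat" and b
  have inv_less: "inv \<pi> b < ?k" if "\<pi> permutes {..<?k}" "b < ?k" for \<pi> b
    using permutes_in_image[OF permutes_inv[OF that(1)], of b] that(2) by simp
  have less: "\<pi> b < ?k" if "\<pi> permutes {..<?k}" "b < ?k" for \<pi> b
    using permutes_in_image[OF that(1), of b] that(2) by simp
  \<comment> \<open>The assumption \<open>vanish\<close> for one pure tensor, with all permutations
    carried out on labels and the inner sum reindexed by
    \<open>\<sigma> \<circ> \<pi>\<close>.\<close>
  have expand: "(\<Sum>\<sigma>\<in>?G. \<Sum>\<pi>\<in>?G. ?c \<pi> *\<^sub>v pure V ?k (W T \<sigma> \<pi>)) = 0"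
    if T: "\<And>b. b < ?k \<Longrightarrow> T b \<in> FOb F V" for T
  proof -
    have "FArr F (perm_arrow C V ?k \<sigma>) (L' (algebra_action V ?k (left_translate (inv \<sigma>) ?c) (pure V ?k T))) =
        (\<Sum>\<pi>\<in>?G. ?c \<pi> *\<^sub>v pure V ?k (W T \<sigma> \<pi>))" if "\<sigma> \<in> ?G" for \<sigma>
    proof -
      have \<sigma>: "\<sigma> permutes {..<?k}" using that by simp
      note P = perm_arrow_hom[OF V, of ?k \<sigma>]
      let ?f = "\<lambda>\<pi>. T \<circ> inv \<pi>"
      have f: "?f \<pi> b \<in> FOb F V" if "\<pi> \<in> ?G" "b < ?k" for \<pi> b using T inv_less that by simp
      let ?g = "\<lambda>\<pi>. (?f \<pi>)(k := L (?f \<pi> k))"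
      have g: "?g \<pi> b \<in> FOb F V" if "\<pi> \<in> ?G" "b < ?k" for \<pi> b using f[OF that] Lm f[OF that(1), of k] by auto
      have fm: "pure V ?k (?f \<pi>) \<in> FOb F ?X" and gm: "pure V ?k (?g \<pi>) \<in> FOb F ?X" if "\<pi> \<in> ?G" for \<pi>
        using pure_mem[OF V, of ?k "?f \<pi>"] pure_mem[OF V, of ?k "?g \<pi>"] f[OF that] g[OF that] by blast+
      have 1: "algebra_action V ?k (left_translate (inv \<sigma>) ?c) (pure V ?k T) =
          (\<Sum>\<pi>\<in>?G. ?c (\<sigma> \<circ> \<pi>) *\<^sub>v pure V ?k (?f \<pi>))"
        unfolding algebra_action_def left_translate_inv[OF \<sigma>]
        by (intro sum.cong refl arg_cong2[where f = scale] perm_arrow_pure[OF V] T) auto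
      have 2: "L' (\<Sum>\<pi>\<in>?G. ?c (\<sigma> \<circ> \<pi>) *\<^sub>v pure V ?k (?f \<pi>)) = (\<Sum>\<pi>\<in>?G. L' (?c (\<sigma> \<circ> \<pi>) *\<^sub>v pure V ?k (?f \<pi>)))"
        using fm FOb_scale[OF X] by (intro linear_on_sum[OF L' X]) blast
      have 3: "(\<Sum>\<pi>\<in>?G. L' (?c (\<sigma> \<circ> \<pi>) *\<^sub>v pure V ?k (?f \<pi>))) =
          (\<Sum>\<pi>\<in>?G. ?c (\<sigma> \<circ> \<pi>) *\<^sub>v pure V ?k (?g \<pi>))"
      proof (rule sum.cong[OF refl])
        fix \<pi> assume \<pi>: "\<pi> \<in> ?G"
        show "L' (?c (\<sigma> \<circ> \<pi>) *\<^sub>v pure V ?k (?f \<pi>)) = ?c (\<sigma> \<circ> \<pi>) *\<^sub>v pure V ?k (?g \<pi>)"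
          unfolding L'scale[OF fm[OF \<pi>]] by (rule arg_cong[OF pure[of "?f \<pi>", OF f[OF \<pi>]]])
      qed
      have 4: "FArr F (perm_arrow C V ?k \<sigma>) (\<Sum>\<pi>\<in>?G. ?c (\<sigma> \<circ> \<pi>) *\<^sub>v pure V ?k (?g \<pi>)) =
          (\<Sum>\<pi>\<in>?G. FArr F (perm_arrow C V ?k \<sigma>) (?c (\<sigma> \<circ> \<pi>) *\<^sub>v pure V ?k (?g \<pi>)))"
        using gm FOb_scale[OF X] by (intro FArr_sum[OF P]) blast
      have 5: "(\<Sum>\<pi>\<in>?G. FArr F (perm_arrow C V ?k \<sigma>) (?c (\<sigma> \<circ> \<pi>) *\<^sub>v pure V ?k (?g \<pi>))) =
          (\<Sum>\<pi>\<in>?G. ?c (\<sigma> \<circ> \<pi>) *\<^sub>v pure V ?k (W T \<sigma> (\<sigma> \<circ> \<pi>)))"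
      proof (rule sum.cong[OF refl])
        fix \<pi> assume \<pi>: "\<pi> \<in> ?G"
        have "inv (\<sigma> \<circ> \<pi>) = inv \<pi> \<circ> inv \<sigma>" using o_inv_distrib permutes_bij \<sigma> \<pi> by blast
        then have "?g \<pi> \<circ> inv \<sigma> = W T \<sigma> (\<sigma> \<circ> \<pi>)"
          using permutes_inverses[OF \<sigma>] by (auto simp: W_def fun_eq_iff)
        moreover have "FArr F (perm_arrow C V ?k \<sigma>) (pure V ?k (?g \<pi>)) = pure V ?k (?g \<pi> \<circ> inv \<sigma>)"
          by (rule perm_arrow_pure[OF V \<sigma> g[OF \<pi>]])
        ultimately show "FArr F (perm_arrow C V ?k \<sigma>) (?c (\<sigma> \<circ> \<pi>) *\<^sub>v pure V ?k (?g \<pi>)) =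
            ?c (\<sigma> \<circ> \<pi>) *\<^sub>v pure V ?k (W T \<sigma> (\<sigma> \<circ> \<pi>))"
          using FArr_scale[OF P gm[OF \<pi>]] by simp
      qed
      have 6: "(\<Sum>\<pi>\<in>?G. ?c (\<sigma> \<circ> \<pi>) *\<^sub>v pure V ?k (W T \<sigma> (\<sigma> \<circ> \<pi>))) =
          (\<Sum>\<pi>\<in>?G. ?c \<pi> *\<^sub>v pure V ?k (W T \<sigma> \<pi>))"
        by (rule setum_permutations_compose_left[OF \<sigma>, symmetric])
      show ?thesis unfolding 1 2 3 4 5 6 ..
    qed
    then have "(\<Sum>\<sigma>\<in>?G. \<Sum>\<pi>\<in>?G. ?c \<pi> *\<^sub>v pure V ?k (W T \<sigma> \<pi>)) = (\<Sum>\<sigma>\<in>?G.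
      FArr F (perm_arrow C V ?k \<sigma>) (L' (algebra_action V ?k (left_translate (inv \<sigma>) ?c) (pure V ?k T))))"
      by (intro sum.cong refl) (rule sym)
    also have "\<dots> = 0" by (rule vanish[OF pure_mem[OF V T]])
    finally show ?thesis .
  qed
  \<comment> \<open>These are the matrix entries of \<open>L\<close> in the basis
    \<open>\<B>\<close>; the factor on which it acts is the last one, \<open>l = k\<close>.\<close>
  have "\<phi> i (L j) = 0" if ij: "i \<in> \<B>" "j \<in> \<B>" for i j
  proof (rule derivation_coefficients_vanish[where x = "\<lambda>i j. \<phi> i (L j)" and l = k, OF \<B>(3) _ u(1,2) _ _ ij])
    show "length u < card \<B>" using u \<B> by simp
    show "k < sum_list u" using k by simp
    fix t :: "nat \<Rightarrow> 'v" and g assume t: "t ` {..<length u} \<subseteq> \<B>" and g: "\<And>b. b < sum_list u \<Longrightarrow> g b \<in> \<B>"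
    define T where "T = t \<circ> row_index u"
    have T: "T b \<in> \<B>" if "b < ?k" for b using t row_index(1)[of b u] that k by (auto simp: T_def)
    then have TV: "T b \<in> FOb F V" if "b < ?k" for b using \<B>(2) that by blast
    have WV: "W T \<sigma> \<pi> b \<in> FOb F V" if "\<sigma> \<in> ?G" "\<pi> \<in> ?G" "b < ?k" for \<sigma> \<pi> b
      using that TV Lm inv_less less by (auto simp: W_def)
    have g: "g b \<in> \<B>" if "b < ?k" for b using g that k by simp
    \<comment> \<open>This functional extracts the coefficient of the pure tensor labelled by
      \<open>g\<close>.\<close>
    obtain \<gamma> where \<gamma>: "functional \<gamma>"
      and \<gamma>p: "\<And>f. (\<forall>b<?k. f b \<in> FOb F V) \<Longrightarrow> \<gamma> (pure V ?k f) = (\<Prod>b<?k. \<phi> (g b) (f b))"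
      using pure_labelled[where \<phi> = \<phi> and \<B> = \<B> and k = ?k and g = g, OF V \<phi> g] by blast
    have summand: "\<gamma> (pure V ?k (W T \<sigma> \<pi>)) = (if \<forall>b < ?k. b \<noteq> \<sigma> k \<longrightarrow> T (inv \<pi> b) = g b
        then \<phi> (g (\<sigma> k)) (L (T (inv \<pi> (\<sigma> k)))) else 0)" if \<sigma>: "\<sigma> \<in> ?G" and \<pi>: "\<pi> \<in> ?G" for \<sigma> \<pi>
    proof -
      have \<sigma>k: "\<sigma> k \<in> {..<?k}" using less \<sigma> by simp
      have "\<gamma> (pure V ?k (W T \<sigma> \<pi>)) = (\<Prod>b<?k. \<phi> (g b) (W T \<sigma> \<pi> b))" using \<gamma>p WV[OF \<sigma> \<pi>] by blast
      also have "\<dots> = \<phi> (g (\<sigma> k)) (W T \<sigma> \<pi> (\<sigma> k)) * (\<Prod>b\<in>{..<?k} - {\<sigma> k}. \<phi> (g b) (W T \<sigma> \<pi> b))"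
        by (rule prod.remove[OF finite_lessThan \<sigma>k])
      also have "(\<Prod>b\<in>{..<?k} - {\<sigma> k}. \<phi> (g b) (W T \<sigma> \<pi> b)) =
          (\<Prod>b\<in>{..<?k} - {\<sigma> k}. if T (inv \<pi> b) = g b then 1 else 0)"
      proof (rule prod.cong[OF refl])
        fix b assume "b \<in> {..<?k} - {\<sigma> k}"
        then show "\<phi> (g b) (W T \<sigma> \<pi> b) = (if T (inv \<pi> b) = g b then 1 else 0)"
          using \<delta>[OF g T, of b "inv \<pi> b"] inv_less \<pi> by (simp add: W_def)
      qed
      also have "\<dots> = (if \<forall>b < ?k. b \<noteq> \<sigma> k \<longrightarrow> T (inv \<pi> b) = g b then 1 else 0)"
      proof (cases "\<forall>b < ?k. b \<noteq> \<sigma> k \<longrightarrow> T (inv \<pi> b) = g b")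
        case True
        then show ?thesis by (simp add: prod.neutral)
      next
        case False
        then obtain b where "b \<in> {..<?k} - {\<sigma> k}" "T (inv \<pi> b) \<noteq> g b" by auto
        then show ?thesis unfolding if_not_P[OF False] by (intro prod_zero) auto
      qed
      finally have eq: "\<gamma> (pure V ?k (W T \<sigma> \<pi>)) = \<phi> (g (\<sigma> k)) (W T \<sigma> \<pi> (\<sigma> k)) *
          (if \<forall>b < ?k. b \<noteq> \<sigma> k \<longrightarrow> T (inv \<pi> b) = g b then 1 else 0)" .
      have W: "W T \<sigma> \<pi> (\<sigma> k) = L (T (inv \<pi> (\<sigma> k)))" by (simp add: W_def)
      show ?thesis unfolding eq W by auto
    qed
    have "0 = \<gamma> (\<Sum>\<sigma>\<in>?G. \<Sum>\<pi>\<in>?G. ?c \<pi> *\<^sub>v pure V ?k (W T \<sigma> \<pi>))"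
      using expand[of T, OF TV] functional_simps(3)[OF \<gamma>] by simp
    also have "\<dots> = (\<Sum>\<sigma>\<in>?G. \<Sum>\<pi>\<in>?G. ?c \<pi> * \<gamma> (pure V ?k (W T \<sigma> \<pi>)))"
      by (simp only: functional_simps[OF \<gamma>])
    also have "\<dots> = derivation_coefficient u k (\<lambda>i j. \<phi> i (L j)) T g"
      unfolding derivation_coefficient_def k by (intro sum.cong refl arg_cong2[where f = "(*)"] summand)
    finally show "derivation_coefficient u k (\<lambda>i j. \<phi> i (L j)) (t \<circ> row_index u) g = 0" by (simp add: T_def)
  qed
  then have LB: "L j = 0" if "j \<in> \<B>" for j using exp[OF Lm, of j] that \<B>(2) by auto
  have "L v = (\<Sum>i\<in>\<B>. L (\<phi> i v *\<^sub>v i))"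
    using linear_on_sum[OF L V, of \<B> "\<lambda>i. \<phi> i v *\<^sub>v i"] FOb_scale[OF V] \<B>(2) exp[OF v] by (simp add: subset_iff)
  also have "\<dots> = 0" using Lscale \<B>(2) LB by (intro sum.neutral) auto
  finally show ?thesis .
qed

end

section \<open>Determinants and the main theorem\<close>

context neutral_tannakian_category
begin

lemma fdim_zero_object: "A \<in> Ob C \<Longrightarrow> is_zero_object C A \<Longrightarrow> fdim F A = 0"
  using fdim_eqI[of A "{}"] zero_object_iff[of A] V.independent_empty V.span_empty by (simp add: is_basis_def)

end

context tannakian_char_0
begin

text \<open>The object is the image of the antisymmetrizer.\<close>

lemma determinant_exists:
  assumes V: "V \<in> Ob C"
  shows "\<exists>L j y. j \<in> homs C L (tensor_power C V (fdim F V)) \<and> fdim F L = 1 \<and> y \<in> FOb F L \<and> FArr F j y \<noteq> 0"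
proof -
  let ?n = "fdim F V"
  let ?X = "tensor_power C V ?n" and ?G = "{\<sigma>. \<sigma> permutes {..<?n}}"
  note X = tensor_power_Ob[OF V, of ?n] and P = perm_arrow_hom[OF V, of ?n]
  obtain \<B> where \<B>: "is_basis (FScale F) (FOb F V) \<B>" "\<B> \<subseteq> FOb F V" "finite \<B>" "card \<B> = fdim F V"
    using ex_basis[OF V] by blast
  obtain \<phi> where \<phi>: "\<And>i. i \<in> \<B> \<Longrightarrow> functional (\<phi> i)"
    and \<delta>: "\<And>i j. i \<in> \<B> \<Longrightarrow> j \<in> \<B> \<Longrightarrow> \<phi> i j = (if j = i then 1 else 0)"
    by (rule dual_basis[OF \<B>(1,3)]) blast
  define s :: "(nat \<Rightarrow> nat) \<Rightarrow> 'e" where "s \<sigma> = of_int (sign \<sigma>)" for \<sigma>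
  \<comment> \<open>Twisting by the sign makes antisymmetric tensors the invariants, so the general
    average becomes the antisymmetrizer.\<close>
  define a where "a \<sigma> = Scale C (s \<sigma>) (perm_arrow C V ?n \<sigma>)" for \<sigma>
  have a: "a \<sigma> \<in> homs C ?X ?X" for \<sigma> unfolding a_def by (rule Scale_hom[OF P])
  have Fa: "FArr F (a \<sigma>) x = s \<sigma> *\<^sub>v FArr F (perm_arrow C V ?n \<sigma>) x" if "x \<in> FOb F ?X" for \<sigma> x
    unfolding a_def by (rule FArr_Scale[OF P that])
  have act: "FArr F (a \<tau>) (FArr F (a \<sigma>) x) = FArr F (a (\<tau> \<circ> \<sigma>)) x"
    if \<sigma>: "\<sigma> permutes {..<?n}" and \<tau>: "\<tau> permutes {..<?n}" and x: "x \<in> FOb F ?X" for \<sigma> \<tau> x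
  proof -
    have "sign (\<tau> \<circ> \<sigma>) = sign \<tau> * sign \<sigma>"
      using sign_compose permutation_permutes[of \<tau>] permutation_permutes[of \<sigma>] \<sigma> \<tau> finite_lessThan by blast
    then have "s (\<tau> \<circ> \<sigma>) = s \<tau> * s \<sigma>" by (simp add: s_def)
    then show ?thesis
      using Fa[OF x] Fa[OF FArr_mem[OF a x]] FArr_scale[OF P FArr_mem[OF P x]] perm_arrow_comp[OF V \<tau> \<sigma> x] by simp
  qed
  obtain e where e: "e \<in> homs C ?X ?X"
    and Fe: "\<And>x. x \<in> FOb F ?X \<Longrightarrow> FArr F e x = inverse (fact ?n) *\<^sub>v (\<Sum>\<sigma>\<in>?G. FArr F (a \<sigma>) x)"
    and einv: "\<And>x \<tau>. x \<in> FOb F ?X \<Longrightarrow> \<tau> \<in> ?G \<Longrightarrow> FArr F (a \<tau>) (FArr F e x) = FArr F e x"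
    and efix: "\<And>x. x \<in> FOb F ?X \<Longrightarrow> (\<forall>\<tau> \<in> ?G. FArr F (a \<tau>) x = x) \<Longrightarrow> FArr F e x = x"
    using average_arrow[of ?n a ?X, OF a X act] by blast
  \<comment> \<open>The average also absorbs the action on the right, so \<open>e\<close> sends
    tensors with permuted labels to multiples of one vector.\<close>
  have ea: "FArr F e (FArr F (a \<tau>) x) = FArr F e x" if \<tau>: "\<tau> permutes {..<?n}" and x: "x \<in> FOb F ?X" for \<tau> x
  proof -
    have "(\<Sum>\<sigma>\<in>?G. FArr F (a \<sigma>) (FArr F (a \<tau>) x)) = (\<Sum>\<sigma>\<in>?G. FArr F (a (\<sigma> \<circ> \<tau>)) x)"
      using act[OF \<tau> _ x] by (intro sum.cong) auto
    also have "\<dots> = (\<Sum>\<sigma>\<in>?G. FArr F (a \<sigma>) x)"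
      by (rule sum_permutations_compose_right[OF \<tau>, symmetric])
    finally show ?thesis using Fe[OF x] Fe[OF FArr_mem[OF a x]] by simp
  qed
  obtain L j r where L: "j \<in> homs C L ?X" "r \<in> homs C ?X L" "\<And>y. y \<in> FOb F L \<Longrightarrow> FArr F r (FArr F j y) = y"
    "\<And>x. x \<in> FOb F ?X \<Longrightarrow> FArr F j (FArr F r x) = FArr F e x"
    using split_idempotent[OF e] efix einv FArr_mem[OF e] by blast
  have LO: "L \<in> Ob C" using hom_Ob L(1) by blast
  obtain f\<^sub>0 where f\<^sub>0: "bij_betw f\<^sub>0 {..<?n} \<B>"
    using ex_bij_betw_nat_finite[OF \<B>(3)] \<B>(4) by (auto simp: lessThan_atLeast0)
  have f\<^sub>0B: "f\<^sub>0 b \<in> \<B>" if "b < ?n" for b using bij_betwE[OF f\<^sub>0] that by simp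
  have f\<^sub>0V: "f\<^sub>0 b \<in> FOb F V" if "b < ?n" for b using f\<^sub>0B[OF that] \<B>(2) by blast
  let ?z = "pure V ?n f\<^sub>0"
  have z: "?z \<in> FOb F ?X" by (rule pure_mem[OF V f\<^sub>0V])
  let ?w = "FArr F e ?z"
  \<comment> \<open>A labelling without repetition is a permutation of \<open>f\<^sub>0\<close>.
    With a repeated label, a transposition fixes the tensor but changes the sign of its
    antisymmetrization, which is then zero as 2 is invertible.\<close>
  have epure: "\<exists>c. FArr F e (pure V ?n f) = c *\<^sub>v ?w" if f: "\<And>b. b < ?n \<Longrightarrow> f b \<in> \<B>" for f
  proof -
    have fV: "f b \<in> FOb F V" if "b < ?n" for b using f[OF that] \<B>(2) by blast
    have fm: "pure V ?n f \<in> FOb F ?X" by (rule pure_mem[OF V fV])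
    show ?thesis
    proof (cases "inj_on f {..<?n}")
      case True
      have "f ` {..<?n} = \<B>"
        by (rule card_subset_eq[OF \<B>(3)]) (use f card_image[OF True] \<B>(4) in auto)
      then have bf: "bij_betw f {..<?n} \<B>" using True by (simp add: bij_betw_def)
      define \<rho> where "\<rho> b = (if b < ?n then inv_into {..<?n} f\<^sub>0 (f b) else b)" for b
      have "bij_betw (inv_into {..<?n} f\<^sub>0 \<circ> f) {..<?n} {..<?n}"
        using bij_betw_trans[OF bf bij_betw_inv_into[OF f\<^sub>0]] .
      then have "bij_betw \<rho> {..<?n} {..<?n}" by (rule bij_betw_cong[THEN iffD1, rotated]) (simp add: \<rho>_def)
      then have \<rho>: "\<rho> permutes {..<?n}" by (rule bij_imp_permutes) (simp add: \<rho>_def)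
      have "f b = f\<^sub>0 (\<rho> b)" if "b < ?n" for b
        using bij_betw_inv_into_right[OF f\<^sub>0 f[OF that]] that by (simp add: \<rho>_def)
      then have "pure V ?n f = pure V ?n (f\<^sub>0 \<circ> inv (inv \<rho>))"
        by (intro pure_cong) (simp add: permutes_inv_inv[OF \<rho>])
      also have "\<dots> = FArr F (perm_arrow C V ?n (inv \<rho>)) ?z"
        using perm_arrow_pure[OF V permutes_inv[OF \<rho>] f\<^sub>0V] by simp
      finally have "s (inv \<rho>) *\<^sub>v pure V ?n f = FArr F (a (inv \<rho>)) ?z" using Fa[OF z] by simp
      then have "s (inv \<rho>) *\<^sub>v FArr F e (pure V ?n f) = ?w"
        using ea[OF permutes_inv[OF \<rho>] z] FArr_scale[OF e fm, of "s (inv \<rho>)"] by simp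
      moreover have "s (inv \<rho>) * s (inv \<rho>) = 1" by (simp add: s_def sign_def)
      ultimately have "FArr F e (pure V ?n f) = s (inv \<rho>) *\<^sub>v ?w"
        by (metis V.scale_scale V.scale_one)
      then show ?thesis by blast
    next
      case False
      then obtain b b' where b: "b < ?n" "b' < ?n" "b \<noteq> b'" "f b = f b'" by (auto simp: inj_on_def)
      let ?\<tau> = "Transposition.transpose b b'"
      have \<tau>: "?\<tau> permutes {..<?n}" by (rule permutes_swap_id) (use b in auto)
      have "pure V ?n (f \<circ> inv ?\<tau>) = pure V ?n f"
        by (rule pure_cong) (use b(4) in \<open>auto simp: transpose_def\<close>)
      then have "FArr F (a ?\<tau>) (pure V ?n f) = (- 1) *\<^sub>v pure V ?n f"
        using Fa[OF fm] perm_arrow_pure[OF V \<tau> fV] b(3) by (simp add: s_def sign_swap_id)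
      then have "FArr F e (pure V ?n f) = (- 1) *\<^sub>v FArr F e (pure V ?n f)"
        using ea[OF \<tau> fm] FArr_scale[OF e fm, of "- 1"] by simp
      then have "FArr F e (pure V ?n f) + FArr F e (pure V ?n f) = 0" by (simp add: eq_neg_iff_add_eq_0)
      then have "(2 :: 'e) *\<^sub>v FArr F e (pure V ?n f) = 0"
        using V.scale_left_distrib[of 1 1 "FArr F e (pure V ?n f)"] by simp
      then have "FArr F e (pure V ?n f) = 0 *\<^sub>v ?w" by simp
      then show ?thesis by blast
    qed
  qed
  have espan: "\<exists>c. FArr F e x = c *\<^sub>v ?w" if x: "x \<in> FOb F ?X" for x
  proof (rule pure_span_induct[OF V _ x, of \<B> "\<lambda>x. \<exists>c. FArr F e x = c *\<^sub>v ?w"])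
    show "V.span \<B> = FOb F V" using \<B>(1) by (simp add: is_basis_def)
    show "\<exists>c. FArr F e 0 = c *\<^sub>v ?w" using FArr_0[OF e] V.scale_zero_left[of ?w] by metis
    show "\<exists>c. FArr F e (pure V ?n f) = c *\<^sub>v ?w" if "\<And>i. i < ?n \<Longrightarrow> f i \<in> \<B>" for f by (rule epure[OF that])
    show "\<exists>c'. FArr F e (c *\<^sub>v x) = c' *\<^sub>v ?w" if "x \<in> FOb F ?X" "\<exists>c. FArr F e x = c *\<^sub>v ?w" for c x
      using that FArr_scale[OF e that(1)] V.scale_scale by metis
    show "\<exists>c. FArr F e (x + x') = c *\<^sub>v ?w"
      if "x \<in> FOb F ?X" "x' \<in> FOb F ?X" "\<exists>c. FArr F e x = c *\<^sub>v ?w" "\<exists>c. FArr F e x' = c *\<^sub>v ?w" for x x'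
      using that FArr_plus[OF e that(1,2)] V.scale_left_distrib by metis
  qed
  \<comment> \<open>The coefficient of the tensor labelled by \<open>f\<^sub>0\<close> in its own
    antisymmetrization is \<open>1 / n!\<close>, because only the identity keeps all the distinct
    labels in place.\<close>
  have "?w \<noteq> 0"
  proof
    assume w0: "?w = 0"
    obtain \<gamma> where \<gamma>: "functional \<gamma>"
      and \<gamma>p: "\<And>f. (\<forall>b<?n. f b \<in> FOb F V) \<Longrightarrow> \<gamma> (pure V ?n f) = (\<Prod>b<?n. \<phi> (f\<^sub>0 b) (f b))"
      using pure_labelled[where \<phi> = \<phi> and \<B> = \<B> and k = ?n and g = f\<^sub>0, OF V \<phi> f\<^sub>0B] by blast
    have g: "\<gamma> (FArr F (a \<sigma>) ?z) = (if \<sigma> = id then 1 else 0)" if "\<sigma> \<in> ?G" for \<sigma>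
    proof -
      have \<sigma>: "\<sigma> permutes {..<?n}" using that by simp
      have less: "inv \<sigma> b < ?n" if "b < ?n" for b using permutes_in_image[OF permutes_inv[OF \<sigma>], of b] that by simp
      have "\<gamma> (FArr F (a \<sigma>) ?z) = s \<sigma> * \<gamma> (pure V ?n (f\<^sub>0 \<circ> inv \<sigma>))"
        using Fa[OF z] perm_arrow_pure[OF V \<sigma> f\<^sub>0V] functional_simps(2)[OF \<gamma>] by simp
      also have "\<gamma> (pure V ?n (f\<^sub>0 \<circ> inv \<sigma>)) = (\<Prod>b<?n. \<phi> (f\<^sub>0 b) ((f\<^sub>0 \<circ> inv \<sigma>) b))"
        by (rule \<gamma>p) (use f\<^sub>0V less in auto)
      also have "\<dots> = (\<Prod>b<?n. if inv \<sigma> b = b then 1 else 0)"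
      proof (rule prod.cong[OF refl])
        fix b assume "b \<in> {..<?n}"
        then have b: "b < ?n" by simp
        have "f\<^sub>0 (inv \<sigma> b) = f\<^sub>0 b \<longleftrightarrow> inv \<sigma> b = b"
          using inj_on_eq_iff[OF bij_betw_imp_inj_on[OF f\<^sub>0]] b less[OF b] by simp
        then show "\<phi> (f\<^sub>0 b) ((f\<^sub>0 \<circ> inv \<sigma>) b) = (if inv \<sigma> b = b then 1 else 0)"
          using \<delta>[OF f\<^sub>0B[OF b] f\<^sub>0B[OF less[OF b]]] by simp
      qed
      also have "s \<sigma> * \<dots> = (if \<sigma> = id then 1 else 0)"
      proof (cases "\<sigma> = id")
        case True
        then show ?thesis by (simp add: s_def sign_id)
      next
        case False
        then have "\<exists>b. \<sigma> b \<noteq> b" by (auto simp: fun_eq_iff)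
        then obtain b where "\<sigma> b \<noteq> b" by blast
        then have "\<sigma> b \<in> {..<?n}" "inv \<sigma> (\<sigma> b) \<noteq> \<sigma> b"
          using permutes_not_in[OF \<sigma>, of b] permutes_in_image[OF \<sigma>, of b] permutes_inverses(2)[OF \<sigma>, of b] by auto
        then have "(\<Prod>b<?n. if inv \<sigma> b = b then 1 else 0 :: 'e) = 0" by (intro prod_zero) auto
        then show ?thesis using False by simp
      qed
      finally show ?thesis .
    qed
    have "0 = \<gamma> ?w" using w0 functional_simps(3)[OF \<gamma>] by simp
    also have "\<dots> = inverse (fact ?n) * (\<Sum>\<sigma>\<in>?G. \<gamma> (FArr F (a \<sigma>) ?z))"
      unfolding Fe[OF z] functional_simps[OF \<gamma>] ..
    also have "(\<Sum>\<sigma>\<in>?G. \<gamma> (FArr F (a \<sigma>) ?z)) = (\<Sum>\<sigma>\<in>?G. if \<sigma> = id then 1 else 0)"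
      by (intro sum.cong refl g)
    also have "\<dots> = 1" by (simp add: finite_permutations permutes_id)
    finally show False by simp
  qed
  define y where "y = FArr F r ?z"
  have y: "y \<in> FOb F L" unfolding y_def by (rule FArr_mem[OF L(2) z])
  have jy: "FArr F j y = ?w" unfolding y_def by (rule L(4)[OF z])
  have "is_basis (FScale F) (FOb F L) {y}"
    unfolding is_basis_def
  proof
    have "y \<noteq> 0" using jy \<open>?w \<noteq> 0\<close> FArr_0[OF L(1)] by auto
    then show "V.independent {y}" by simp
    have "x \<in> V.span {y}" if x: "x \<in> FOb F L" for x
    proof -
      have jx: "FArr F j x \<in> FOb F ?X" by (rule FArr_mem[OF L(1) x])
      obtain c where "FArr F e (FArr F j x) = c *\<^sub>v ?w" using espan[OF jx] by blast
      then have "FArr F j x = FArr F j (c *\<^sub>v y)"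
        using L(4)[OF jx] L(3)[OF x] jy FArr_scale[OF L(1) y] by simp
      then have "FArr F r (FArr F j x) = FArr F r (FArr F j (c *\<^sub>v y))" by (rule arg_cong)
      then have "x = c *\<^sub>v y" unfolding L(3)[OF x] L(3)[OF FOb_scale[OF LO y]] .
      then show ?thesis using V.span_scale[OF V.span_base[of y "{y}"]] by simp
    qed
    moreover have "V.span {y} \<subseteq> FOb F L" using V.span_minimal[OF _ FOb_subspace[OF LO]] y by simp
    ultimately show "V.span {y} = FOb F L" by blast
  qed
  then have "fdim F L = 1" using fdim_eqI by force
  then show ?thesis using L(1) y jy \<open>?w \<noteq> 0\<close> by metis
qed

end

section \<open>Tensor powers and Schur objects in \<open>D\<close>\<close>

locale tannakian_pair_char_0 = tannakian_pair C F D + tannakian_char_0 C F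
  for C :: "('o, 'a, 'e::field_char_0, 'm) tensor_category_scheme" (structure)
    and F :: "('o, 'a, 'e, 'v::ab_group_add, 'n) fibre_functor_scheme"
    and D :: "'o set"
begin

lemma tensor_power_fdim_in_D:
  assumes V: "V \<in> Ob C" "tensors_into C D V"
  shows "tensor_power C V (fdim F V) \<in> D"
proof -
  obtain L j y where L: "j \<in> homs C L (tensor_power C V (fdim F V))" "fdim F L = 1" "y \<in> FOb F L" "FArr F j y \<noteq> 0"
    using determinant_exists[OF V(1)] by blast
  have "L \<in> D" using one_dimensional hom_Ob(1)[OF L(1)] L(2) by blast
  then show ?thesis
    using D_of_nonzero_arrow[OF tensor_power_Ob[OF V(1)] tensors_into_tensor_power[OF V] _ L(1,3,4)] by blast
qed

lemma schur_in_D: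
  assumes V: "V \<in> Ob C" and X: "tensor_power C V (sum_list v) \<in> D"
  shows "schur C v V \<in> D"
proof -
  let ?S = "schur C v V"
  have S: "is_schur_object C v V ?S" by (rule schur_is_schur_object[OF V])
  then have SO: "?S \<in> Ob C" by (auto simp: is_schur_object_def is_invariants_def)
  obtain B :: "((nat \<Rightarrow> nat) \<Rightarrow> 'e) set" and s where B: "finite B" "\<And>b. b \<in> B \<Longrightarrow> s b \<in> homs C ?S (tensor_power C V (sum_list v))"
    "\<And>x. x \<in> FOb F ?S \<Longrightarrow> \<forall>b \<in> B. FArr F (s b) x = 0 \<Longrightarrow> x = 0"
    by (rule schur_object_fibre[OF V S]) blast
  show ?thesis by (rule D_joint_subobject[OF SO B(1) X B(2,3)])
qed

text \<open>Both claims rest on \<open>derivation_faithful\<close>. For matrices acting on the last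
  factor it makes \<open>End V\<close> act faithfully, which puts \<open>End V\<close> into
  \<open>D\<close>; for the identity it shows that the Schur object maps nontrivially to the tensor
  power.\<close>

lemma schur_generates:
  assumes V: "V \<in> Ob C" and u: "u \<noteq> []" "\<forall>m \<in> set u. 0 < m" "length u < fdim F V" and S: "schur C u V \<in> D"
  shows "tensors_into C D V" and "tensor_power C V (sum_list u) \<in> D"
proof -
  let ?S = "schur C u V"
  have V0: "\<not> is_zero_object C V" using u(3) fdim_zero_object[OF V] by auto
  obtain k where k: "sum_list u = Suc k" using u(1,2) by (cases u) (auto simp: gr0_conv_Suc)
  have So: "is_schur_object C u V ?S" by (rule schur_is_schur_object[OF V])
  let ?P = "tensor_power C V k" and ?X = "tensor_power C V (Suc k)"
  note P = tensor_power_Ob[OF V, of k] and X = tensor_power_Ob[OF V, of "Suc k"]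
  obtain B s p where B: "finite B" and s: "\<And>b. b \<in> B \<Longrightarrow> s b \<in> homs C ?S ?X" and p: "\<And>b. b \<in> B \<Longrightarrow> p b \<in> homs C ?X ?S"
    and lift: "\<And>t. t \<in> FOb F ?X \<Longrightarrow> \<exists>x \<in> FOb F ?S. \<forall>b \<in> B. FArr F (s b) x = algebra_action V (Suc k) b t"
    and vanish: "\<And>L t. linear_on (FScale F) (FOb F ?X) (FOb F ?X) L \<Longrightarrow> t \<in> FOb F ?X \<Longrightarrow>
      \<forall>b \<in> B. FArr F (p b) (L (algebra_action V (Suc k) b t)) = 0 \<Longrightarrow>
      (\<Sum>\<sigma> | \<sigma> permutes {..<Suc k}. FArr F (perm_arrow C V (Suc k) \<sigma>)
        (L (algebra_action V (Suc k) (left_translate (inv \<sigma>) (young_symmetrizer u)) t))) = 0"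
    by (rule schur_object_fibre[OF V So, unfolded k]) blast
  note faithful = derivation_faithful[OF V u k]
  obtain V' where V': "is_dual C V V'" using duals V by blast
  have V'O: "V' \<in> Ob C" using V' by (simp add: is_dual_def)
  let ?Q = "V \<otimes>\<^sub>o V'"
  have Q: "?Q \<in> Ob C" by (rule TOb[OF V V'O])
  obtain L where L: "\<And>A. A \<in> FOb F ?Q \<Longrightarrow> linear_on (FScale F) (FOb F V) (FOb F V) (L A)"
    and inj: "\<And>A. A \<in> FOb F ?Q \<Longrightarrow> (\<And>v. v \<in> FOb F V \<Longrightarrow> L A v = 0) \<Longrightarrow> A = 0"
    and act: "\<And>W. W \<in> Ob C \<Longrightarrow> \<exists>g \<in> homs C (?Q \<otimes>\<^sub>o (W \<otimes>\<^sub>o V)) (W \<otimes>\<^sub>o V).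
      \<forall>A \<in> FOb F ?Q. \<forall>v \<in> FOb F V. \<forall>w \<in> FOb F W.
      FArr F g (tens ?Q (W \<otimes>\<^sub>o V) A (tens W V w v)) = tens W V w (L A v)"
    by (rule endomorphism_action[OF V']) blast
  obtain g where g: "g \<in> homs C (?Q \<otimes>\<^sub>o ?X) ?X"
    and Fg: "\<And>A v w. A \<in> FOb F ?Q \<Longrightarrow> v \<in> FOb F V \<Longrightarrow> w \<in> FOb F ?P \<Longrightarrow>
      FArr F g (tens ?Q ?X A (tens ?P V w v)) = tens ?P V w (L A v)"
    using act[OF P] by auto
  \<comment> \<open>For each \<open>b\<close> the action passes from the Schur object to the tensor
    power, applies the matrix to the last factor and returns. The return through \<open>p b\<close>
    averages over the symmetric group and so turns this one-factor action into the
    derivation.\<close>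
  have "?Q \<in> D"
  proof (rule D_joint_action[OF Q B, of "\<lambda>_. ?S" "\<lambda>_. ?S" "\<lambda>b. p b \<cdot> (g \<cdot> (Ident C ?Q \<otimes>\<^sub>a s b))"])
    show "?S \<in> D" "?S \<in> D" by (rule S)+
    fix b assume b: "b \<in> B"
    show "p b \<cdot> (g \<cdot> (Ident C ?Q \<otimes>\<^sub>a s b)) \<in> homs C (?Q \<otimes>\<^sub>o ?S) ?S"
      by (rule Comp_hom[OF Comp_hom[OF TArr_hom[OF Ident_hom[OF Q] s[OF b]] g] p[OF b]])
  next
    fix A assume A: "A \<in> FOb F ?Q"
      and z: "\<And>b x. b \<in> B \<Longrightarrow> x \<in> FOb F ?S \<Longrightarrow>
        FArr F (p b \<cdot> (g \<cdot> (Ident C ?Q \<otimes>\<^sub>a s b))) (tens ?Q ?S A x) = 0"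
    have z: "FArr F (p b) (FArr F g (tens ?Q ?X A (FArr F (s b) x))) = 0" if b: "b \<in> B" and x: "x \<in> FOb F ?S" for b x
    proof -
      note h1 = TArr_hom[OF Ident_hom[OF Q] s[OF b]]
      have t: "tens ?Q ?S A x \<in> FOb F (?Q \<otimes>\<^sub>o ?S)" by (rule tens_mem[OF Q D_Ob[OF S] A x])
      show ?thesis
        using z[OF b x] FArr_Comp[OF Comp_hom[OF h1 g] p[OF b] t] FArr_Comp[OF h1 g t]
          FTensor_natural[OF Ident_hom[OF Q] s[OF b] A x] FArr_Ident[OF Q A] by simp
    qed
    let ?L' = "\<lambda>t. FArr F g (tens ?Q ?X A t)"
    have tm: "tens ?Q ?X A t \<in> FOb F (?Q \<otimes>\<^sub>o ?X)" if "t \<in> FOb F ?X" for t by (rule tens_mem[OF Q X A that])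
    have L': "linear_on (FScale F) (FOb F ?X) (FOb F ?X) ?L'"
      unfolding linear_on_def
    proof (intro conjI ballI allI subsetI)
      fix y assume "y \<in> ?L' ` FOb F ?X"
      then show "y \<in> FOb F ?X" using FArr_mem[OF g tm] by blast
    next
      fix x y assume x: "x \<in> FOb F ?X" "y \<in> FOb F ?X"
      show "?L' (x + y) = ?L' x + ?L' y"
        unfolding tens_plus_right[OF Q X A x] by (rule FArr_plus[OF g tm[OF x(1)] tm[OF x(2)]])
    next
      fix c x assume x: "x \<in> FOb F ?X"
      show "?L' (c *\<^sub>v x) = c *\<^sub>v ?L' x"
        unfolding tens_scale_right[OF Q X A x] by (rule FArr_scale[OF g tm[OF x]])
    qed
    show "A = 0"
    proof (rule inj[OF A])
      fix v assume v: "v \<in> FOb F V"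
      show "L A v = 0"
      proof (rule faithful[OF L[OF A] L' _ _ v])
        fix f assume f: "\<And>i. i < Suc k \<Longrightarrow> f i \<in> FOb F V"
        have "pure V k (f(k := L A (f k))) = pure V k f" by (rule pure_cong) simp
        then show "?L' (pure V (Suc k) f) = pure V (Suc k) (f(k := L A (f k)))"
          using Fg[OF A f[of k] pure_mem[OF V, of k f]] f by simp
      next
        fix t assume t: "t \<in> FOb F ?X"
        obtain x where x: "x \<in> FOb F ?S" "\<And>b. b \<in> B \<Longrightarrow> FArr F (s b) x = algebra_action V (Suc k) b t"
          using lift[OF t] by blast
        have "\<forall>b \<in> B. FArr F (p b) (?L' (algebra_action V (Suc k) b t)) = 0"
        proof
          fix b assume b: "b \<in> B"
          show "FArr F (p b) (?L' (algebra_action V (Suc k) b t)) = 0" using z[OF b x(1)] unfolding x(2)[OF b] .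
        qed
        then show "(\<Sum>\<sigma> | \<sigma> permutes {..<Suc k}. FArr F (perm_arrow C V (Suc k) \<sigma>)
            (?L' (algebra_action V (Suc k) (left_translate (inv \<sigma>) (young_symmetrizer u)) t))) = 0"
          by (rule vanish[OF L' t])
      qed
    qed
  qed
  then show ti: "tensors_into C D V" using V'O dual_nonzero[OF V' V0] by (auto simp: tensors_into_def)
  have "\<exists>b \<in> B. \<exists>x \<in> FOb F ?S. FArr F (s b) x \<noteq> 0"
  proof (rule ccontr)
    assume *: "\<not> (\<exists>b \<in> B. \<exists>x \<in> FOb F ?S. FArr F (s b) x \<noteq> 0)"
    \<comment> \<open>If all \<open>s b\<close> vanished, the criterion with \<open>L\<close> and
      \<open>L'\<close> the identity would make every vector of \<open>V\<close> zero.\<close>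
    have id: "linear_on (FScale F) (FOb F A) (FOb F A) (\<lambda>x. x)" for A by (simp add: linear_on_def)
    have "v = 0" if v: "v \<in> FOb F V" for v
    proof (rule faithful[OF id id _ _ v])
      show "pure V (Suc k) f = pure V (Suc k) (f(k := f k))" for f by simp
      fix t assume t: "t \<in> FOb F ?X"
      obtain x where x: "x \<in> FOb F ?S" "\<And>b. b \<in> B \<Longrightarrow> FArr F (s b) x = algebra_action V (Suc k) b t"
        using lift[OF t] by blast
      have "\<forall>b \<in> B. FArr F (p b) (algebra_action V (Suc k) b t) = 0"
      proof
        fix b assume b: "b \<in> B"
        then have "algebra_action V (Suc k) b t = 0" using * x by metis
        then show "FArr F (p b) (algebra_action V (Suc k) b t) = 0" using FArr_0[OF p[OF b]] by simp
      qed
      then show "(\<Sum>\<sigma> | \<sigma> permutes {..<Suc k}. FArr F (perm_arrow C V (Suc k) \<sigma>)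
          (algebra_action V (Suc k) (left_translate (inv \<sigma>) (young_symmetrizer u)) t)) = 0"
        by (rule vanish[OF id t])
    qed
    then show False using V0 zero_object_iff[OF V] FOb_0[OF V] by blast
  qed
  then obtain b x where "b \<in> B" "x \<in> FOb F ?S" "FArr F (s b) x \<noteq> 0" by blast
  then show "tensor_power C V (sum_list u) \<in> D"
    unfolding k using D_of_nonzero_arrow[OF X tensors_into_tensor_power[OF V ti] S s] by blast
qed

text \<open>Membership in the closure of \<open>D\<close> is witnessed by the direct sum with the
  single term \<open>V\<close>.\<close>

lemma basic_object_iff:
  assumes V: "V \<in> Ob C" shows "basic_object C D V \<longleftrightarrow> tensors_into C D V"
proof
  assume t: "tensors_into C D V"
  have "V \<in> overline_subcategory C D"
    unfolding overline_subcategory_def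
    using V t direct_sum_singleton[OF V] isomorphic_refl[OF V]
    by (intro CollectI conjI exI[of _ "[V]"] exI[of _ V]) auto
  then show "basic_object C D V" using t by (simp add: basic_object_def)
qed (simp add: basic_object_def)

end

text \<open>The Schur object of the empty tuple is the unit up to isomorphism and always lies in
  \<open>D\<close>, so it says nothing about \<open>V\<close>. Among nonempty tuples none is shorter
  than \<open>n\<close> if \<open>n\<close> is at most 1, although such a \<open>V\<close> is basic;
  hence the equivalence is stated from \<open>n = 2\<close> on.\<close>

theorem proposition2p4:
  fixes C :: "('o, 'a, 'e::field_char_0) tensor_category"
    and F :: "('o, 'a, 'e, 'v::ab_group_add) fibre_functor"
    and D :: "'o set"
    and V :: 'o
    and n :: nat
  assumes C: "neutral_tannakian_category C F"
    and D: "tannakian_subcategory C D"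
    and one_dimensional: "\<forall>L \<in> Ob C. fdim F L = 1 \<longrightarrow> L \<in> D"
    and V: "V \<in> Ob C"
    and n: "n = fdim F V"
  shows "(2 \<le> n \<longrightarrow>
      (basic_object C D V \<longleftrightarrow>
        (\<exists>u. young_tuple u \<and> u \<noteq> [] \<and> length u < n \<and> schur C u V \<in> D))) \<and>
    (\<forall>u. young_tuple u \<and> u \<noteq> [] \<and> length u < n \<and> schur C u V \<in> D \<longrightarrow>
      (\<forall>v. young_tuple v \<and> gcd (sum_list u) n dvd sum_list v \<longrightarrow> schur C v V \<in> D))"
proof -
  interpret neutral_tannakian_category C F by (rule C)
  interpret tannakian_pair_char_0 C F D
    by unfold_locales (use D one_dimensional in auto)
  have gen: "tensors_into C D V" "tensor_power C V (sum_list u) \<in> D"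
    if "young_tuple u" "u \<noteq> []" "length u < n" "schur C u V \<in> D" for u
    using schur_generates[OF V that(2) _ _ that(4)] that by (auto simp: young_tuple_def n)
  \<comment> \<open>The one-row tuple \<open>[n]\<close> has length 1, which is less than
    \<open>n\<close>, and its sum \<open>n\<close> is the exponent for which the determinant puts
    the tensor power into \<open>D\<close>.\<close>
  have "\<exists>u. young_tuple u \<and> u \<noteq> [] \<and> length u < n \<and> schur C u V \<in> D" if "2 \<le> n" "tensors_into C D V"
    using that schur_in_D[OF V, of "[n]"] tensor_power_fdim_in_D[OF V]
    by (intro exI[of _ "[n]"]) (auto simp: young_tuple_def n)
  moreover have "schur C v V \<in> D"
    if u: "young_tuple u" "u \<noteq> []" "length u < n" "schur C u V \<in> D" and dvd: "gcd (sum_list u) n dvd sum_list v" for u v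
  proof -
    have "\<not> is_zero_object C V" using u(3) fdim_zero_object[OF V] n by auto
    moreover have "0 < sum_list u" using u(1,2) by (cases u) (auto simp: young_tuple_def)
    ultimately have "tensor_power C V (sum_list v) \<in> D"
      using tensor_power_gcd_in_D[OF V _ gen(2)[OF u] _ dvd] tensor_power_fdim_in_D[OF V gen(1)[OF u]] n by blast
    then show ?thesis by (rule schur_in_D[OF V])
  qed
  ultimately show ?thesis unfolding basic_object_iff[OF V] using gen(1) by blast
qed

end
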